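(* Let $\mathbb{K}\in\{\mathbb{R},\mathbb{C}\}$ and $d\ge 1$. For integers $m\ge 1$ set $$\delta_{\mathbb{K}}(m):=\begin{cases}\frac{2}{m+1}\left(1+\frac{m-1}{2}\sqrt{m+2}\right) & \text{for } \mathbb{K}=\mathbb{R},\\[4pt] \frac{1}{m}\left(1+(m-1)\sqrt{m+1}\right) & \text{for } \mathbb{K}=\mathbb{C}.\end{cases}$$ Let $\mathcal{M}\subseteq\mathbb{K}^{d\times d}$ be nonempty and compact and let $J\subseteq\{1,\dots,d\}$ be an index set of cardinality $m\ge 1$. Then there exists $T\in\mathbf{GL}_d(\mathbb{K})$ such that $$\rho\big((T^{-1}\mathcal{M}T)_{J,J}\big)\leq \delta_{\mathbb{K}}(m)\,\rho(\mathcal{M})\leq \sqrt{m}\,\rho(\mathcal{M}).$$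
   Context: For a nonempty bounded set $\mathcal{M}$ of square matrices of a fixed size over $\mathbb{K}$ and an integer $t\ge 1$ let $\mathcal{S}_t := \{A(t-1)\cdots A(0) : A(s)\in\mathcal{M},\ s=0,\dots,t-1\}$ be the set of products of length $t$. The joint spectral radius is $\rho(\mathcal{M}) := \lim_{t\to\infty}\sup\{\|S\|_2 : S\in\mathcal{S}_t\}^{1/t}$, where $\|\cdot\|_2$ is the spectral norm. For $T\in\mathbf{GL}_d(\mathbb{K})$, $T^{-1}\mathcal{M}T := \{T^{-1}AT : A\in\mathcal{M}\}$. For a nonempty index set $J\subseteq\{1,\dots,d\}$ and a $d\times d$ matrix $A$, $A_{J,J}$ is the principal submatrix of $A$ obtained by deleting all rows and columns whose index is not in $J$, and for a set of $d\times d$ matrices $\mathcal{M}$, $\mathcal{M}_{J,J}:=\{A_{J,J} : A\in\mathcal{M}\}$. *)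

theory Defs
  imports "HOL-Analysis.Analysis"
begin

text \<open>
  Matrices over \<open>\<real>\<close> or \<open>\<complex>\<close> have type \<open>'a ^ 'n ^ 'n\<close>. The norm on \<open>'a ^ 'n\<close> is the Euclidean
  norm (for \<open>'a = complex\<close>: of the moduli of the entries), hence \<open>onorm ((*v) A)\<close> is the
  spectral norm of \<open>A\<close>.
\<close>

definition spectral_norm :: "'a::real_normed_field ^ 'n ^ 'n \<Rightarrow> real" where
  "spectral_norm A = onorm ((*v) A)"

primrec matrix_product :: "(nat \<Rightarrow> 'a::semiring_1 ^ 'n ^ 'n) \<Rightarrow> nat \<Rightarrow> 'a ^ 'n ^ 'n" where
  "matrix_product A 0 = mat 1"
| "matrix_product A (Suc t) = A t ** matrix_product A t"

definition products_of_length :: "('a::semiring_1 ^ 'n ^ 'n) set \<Rightarrow> nat \<Rightarrow> ('a ^ 'n ^ 'n) set" where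
  "products_of_length M t = {matrix_product A t | A. \<forall>s<t. A s \<in> M}"

text \<open>
  Meaningful for nonempty bounded \<open>M\<close>: then the suprema are taken over nonempty sets that are
  bounded above, and the limit exists by submultiplicativity.
\<close>

definition joint_spectral_radius :: "('a::real_normed_field ^ 'n ^ 'n) set \<Rightarrow> real" where
  "joint_spectral_radius M =
     lim (\<lambda>t. root t (SUP S\<in>products_of_length M t. spectral_norm S))"

definition similar_set :: "'a::real_normed_field ^ 'n ^ 'n \<Rightarrow> ('a ^ 'n ^ 'n) set \<Rightarrow> ('a ^ 'n ^ 'n) set" where
  "similar_set T M = (\<lambda>A. matrix_inv T ** A ** T) ` M"

text \<open>
  The size of a matrix is the cardinality of its index type. The principal submatrix
  \<open>A\<^sub>J\<^sub>,\<^sub>J\<close> is therefore indexed by a type \<open>'m\<close> with as many elements as \<open>J\<close>, whose elements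
  are identified with those of \<open>J\<close> by means of an enumeration \<open>e\<close>, that is,
  \<open>bij_betw e UNIV J\<close>. The increasing enumeration gives the matrix in which all rows and columns
  with index outside \<open>J\<close> are deleted; any other one gives a simultaneous permutation of its rows
  and columns.
\<close>

definition principal_submatrix :: "('m \<Rightarrow> 'n) \<Rightarrow> 'a ^ 'n ^ 'n \<Rightarrow> 'a ^ 'm ^ 'm" where
  "principal_submatrix e A = (\<chi> i j. A $ e i $ e j)"

definition delta_real :: "nat \<Rightarrow> real" where
  "delta_real m = 2 / (real m + 1) * (1 + (real m - 1) / 2 * sqrt (real m + 2))"

definition delta_complex :: "nat \<Rightarrow> real" where
  "delta_complex m = 1 / real m * (1 + (real m - 1) * sqrt (real m + 1))"

end

theory Submission
  imports Defs
begin

text \<open>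
  Let \<open>\<rho>\<close> be the joint spectral radius of \<open>M\<close> and let \<open>X\<close> be the span of the unit vectors with
  index in \<open>J\<close>. If \<open>P\<close> is a projection onto \<open>X\<close>, then in coordinates adapted to the
  decomposition into \<open>X\<close> and the kernel of \<open>P\<close> the principal submatrix of \<open>A\<close> is the compression
  of \<open>A\<close> to \<open>X\<close>, that is, \<open>P A\<close> restricted to \<open>X\<close>. The task is therefore to find a subspace of
  dimension \<open>m\<close> and a projection onto it for which all products of these compressions are small.

  \<^emph>\<open>Bounded products.\<close> Assume that \<open>\<rho> > 0\<close> and that the products of length \<open>t\<close> are
  \<open>O(\<rho>\<^sup>t)\<close>. The set \<open>F\<close> of all functionals \<open>\<rho>\<^sup>-\<^sup>t g S\<close>, with \<open>S\<close> a product of length \<open>t\<close> and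
  \<open>g\<close> of norm at most 1, is bounded, and its polar is the unit ball of a norm in which every
  \<open>A \<in> M\<close> has norm at most \<open>\<rho>\<close>. If \<open>P\<close> has norm at most \<open>\<delta>\<close> in this norm, then the
  compressions have norm at most \<open>\<delta> \<rho>\<close>. So it suffices that every subspace of dimension \<open>m\<close> of
  a normed space is the range of a projection of norm at most \<open>\<delta>\<^sub>K(m)\<close>.

  \<^emph>\<open>Projections.\<close> A separating hyperplane (\<open>exists_bounded_projection\<close>) turns this into a trace
  estimate: if \<open>E = \<Sum>\<^sub>k \<lambda>\<^sub>k y\<^sub>k \<otimes> f\<^sub>k\<close> is a convex combination with \<open>y\<^sub>k\<close> in the unit ball and \<open>f\<^sub>k\<close> in
  the dual ball, and if \<open>E\<close> maps \<open>X\<close> to \<open>X\<close>, then \<open>Re (tr E) \<le> \<delta>\<^sub>K(m)\<close>. Write the trace in an orthonormal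
  basis for the form \<open>\<Sum>\<^sub>k \<lambda>\<^sub>k f\<^sub>k(x) (f\<^sub>k(y))\<^sup>*\<close> on \<open>X\<close>. Since \<open>|f\<^sub>l(y\<^sub>k)| \<le> 1\<close>, it is at most
  \<open>\<Sum>\<^sub>k\<^sub>l t\<^sub>k t\<^sub>l |\<langle>u\<^sub>k, u\<^sub>l\<rangle>|\<close>, where \<open>t\<^sub>k\<^sup>2 = \<lambda>\<^sub>k\<close> and the \<open>u\<^sub>k\<close> form a Parseval frame of a space of
  dimension at most \<open>m\<close> (\<open>trace_le_frame_bound\<close>).

  \<^emph>\<open>Frames.\<close> On \<open>[0,1]\<close> one has \<open>z \<le> \<alpha> + \<beta> z\<^sup>2 - \<gamma> z\<^sup>4\<close>, where the even polynomial touches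
  the identity at a point \<open>c\<close> and meets it at 1; \<open>c\<close> is the cosine of the angle at which
  \<open>m (m + 1) / 2\<close> (real case) or \<open>m\<^sup>2\<close> (complex case) equiangular lines would meet. Apply this to
  the cosines of the angles between the \<open>u\<^sub>k\<close>. The sum of the quadratic terms is bounded above by the
  Parseval identity, and the sum of the quartic terms is bounded below by the Welch inequality, whose
  constant depends on the field. For
  \<open>c = 1 / sqrt (m + 2)\<close> and \<open>c = 1 / sqrt (m + 1)\<close>, respectively, the result is \<open>\<delta>\<^sub>K(m)\<close>
  (\<open>frame_bound_real\<close>, \<open>frame_bound_complex\<close>).

  \<^emph>\<open>Unbounded products.\<close> Let \<open>V\<close> be an invariant subspace of maximal dimension among those of dimension less than
  \<open>m\<close>. The vectors whose orbits modulo \<open>V\<close> are \<open>O(\<rho>\<^sup>t)\<close> form an invariant subspace \<open>W\<close>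
  containing \<open>V\<close>. Compactness of the sphere shows that \<open>W\<close> is larger than \<open>V\<close>
  (\<open>exists_bounded_orbit\<close>), hence its dimension is at least \<open>m\<close>. Choose coordinates with
  \<open>V \<subseteq> X \<subseteq> W\<close>. The compression to \<open>X\<close> is block triangular: one block is the restriction of \<open>M\<close> to \<open>V\<close>,
  with joint spectral radius at most \<open>\<rho>\<close>, and the other one is a compression of the action on \<open>W/V\<close>, to which the
  bounded case applies. Block triangular products exceed the growth of the diagonal blocks only by a
  factor that is linear in the length (\<open>block_triangular_growth\<close>).
\<close>

section \<open>Fourth moments of systems of unit vectors\<close>

text \<open>
  The difference of the two sides is \<open>(z - c)\<^sup>2 (1 - z) (z + 1 + 2 c)\<close>: it has a double zero at
  \<open>c\<close> and a simple zero at 1, and the last factor is the one that makes the cubic term vanish.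
\<close>

lemma le_quartic:
  fixes c z :: real
  assumes "0 < c" "0 \<le> z" "z \<le> 1"
  shows "2 * c * (1 + c)^2 * z \<le> c^2 * (1 + 2 * c) + (1 + 2 * c + 3 * c^2) * z^2 - z^4"
proof -
  have "0 \<le> (z - c)^2 * ((1 - z) * (z + 1 + 2 * c))"
    using assms by (intro mult_nonneg_nonneg) auto
  also have "\<dots> = c^2 * (1 + 2 * c) + (1 + 2 * c + 3 * c^2) * z^2 - z^4 - 2 * c * (1 + c)^2 * z"
    by algebra
  finally show ?thesis by simp
qed

text \<open>
  Expand \<open>0 \<le> \<parallel>B - s b\<parallel>\<^sup>2\<close>, where \<open>B = \<Sum>\<^sub>k w\<^sub>k v\<^sub>k\<close> and \<open>s = \<Sum>\<^sub>k w\<^sub>k\<close>. The Welch inequality follows with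
  \<open>v\<^sub>k\<close> a fourth tensor power of a unit vector and \<open>b\<close> the average of these powers over the unit sphere.
\<close>

lemma second_moment_bound:
  fixes v :: "'k \<Rightarrow> 'i \<Rightarrow> 'b::real_inner" and w :: "'k \<Rightarrow> real"
  assumes vb: "\<And>k. k \<in> K \<Longrightarrow> (\<Sum>i\<in>I. v k i \<bullet> b i) = h"
    and bb: "(\<Sum>i\<in>I. b i \<bullet> b i) = h"
  shows "h * (\<Sum>k\<in>K. w k)^2 \<le> (\<Sum>k\<in>K. \<Sum>l\<in>K. w k * w l * (\<Sum>i\<in>I. v k i \<bullet> v l i))"
proof -
  define s where "s = (\<Sum>k\<in>K. w k)"
  define B where "B i = (\<Sum>k\<in>K. w k *\<^sub>R v k i)" for i
  have BB: "(\<Sum>i\<in>I. B i \<bullet> B i) = (\<Sum>k\<in>K. \<Sum>l\<in>K. w k * w l * (\<Sum>i\<in>I. v k i \<bullet> v l i))"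
  proof -
    have "(\<Sum>i\<in>I. B i \<bullet> B i) = (\<Sum>i\<in>I. \<Sum>k\<in>K. \<Sum>l\<in>K. w k * w l * (v k i \<bullet> v l i))"
      unfolding B_def inner_sum_left by (simp add: inner_sum_right sum_distrib_left mult_ac)
    also have "\<dots> = (\<Sum>k\<in>K. \<Sum>l\<in>K. \<Sum>i\<in>I. w k * w l * (v k i \<bullet> v l i))"
      by (subst sum.swap) (intro sum.cong refl, subst sum.swap, simp)
    finally show ?thesis by (simp add: sum_distrib_left)
  qed
  have Bb: "(\<Sum>i\<in>I. B i \<bullet> b i) = s * h"
  proof -
    have "(\<Sum>i\<in>I. B i \<bullet> b i) = (\<Sum>k\<in>K. w k * (\<Sum>i\<in>I. v k i \<bullet> b i))"
      unfolding B_def inner_sum_left by (subst sum.swap) (simp add: sum_distrib_left)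
    then show ?thesis by (simp add: vb s_def sum_distrib_right)
  qed
  have "0 \<le> (\<Sum>i\<in>I. (B i - s *\<^sub>R b i) \<bullet> (B i - s *\<^sub>R b i))"
    by (intro sum_nonneg) auto
  also have "\<dots> = (\<Sum>i\<in>I. B i \<bullet> B i - 2 * s * (B i \<bullet> b i) + s^2 * (b i \<bullet> b i))"
    by (intro sum.cong refl)
       (simp add: inner_diff_left inner_diff_right inner_commute algebra_simps power2_eq_square)
  also have "\<dots> = (\<Sum>i\<in>I. B i \<bullet> B i) - 2 * s * (s * h) + s^2 * h"
    by (simp add: sum.distrib sum_subtractf sum_distrib_left[symmetric] Bb bb)
  finally show ?thesis unfolding BB s_def[symmetric] by (simp add: power2_eq_square algebra_simps)
qed

text \<open>
  The common part of the real and the complex case: \<open>cj\<close> is the identity on \<open>\<real>\<close> and the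
  conjugation on \<open>\<complex>\<close>. The Euclidean inner product of the scalar field, seen as a real vector space, is
  then the real part of \<open>cj x * y\<close>, and the real part itself is the inner product with 1.
\<close>

locale conjugation =
  fixes cj :: "'a::{real_normed_field,euclidean_space} \<Rightarrow> 'a"
  assumes cj_add: "cj (x + y) = cj x + cj y"
    and cj_mult: "cj (x * y) = cj x * cj y"
    and cj_cj [simp]: "cj (cj x) = x"
    and mult_cj: "x * cj x = of_real ((norm x)^2)"
    and inner_eq_cj: "x \<bullet> y = 1 \<bullet> (cj x * y)"
begin

text \<open>
  The Welch bound of order two, for weighted systems of unit vectors. The best constant \<open>h\<close> depends on the field.
\<close>

definition welch_bound :: "nat \<Rightarrow> real \<Rightarrow> bool" where
  "welch_bound p h \<longleftrightarrow> (\<forall>(K::nat set) w x. finite K \<longrightarrow>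
     (\<forall>k\<in>K. (\<Sum>i<p. (norm (x k i))^2) = 1) \<longrightarrow>
     h * (\<Sum>k\<in>K. w k)^2 \<le> (\<Sum>k\<in>K. \<Sum>l\<in>K. w k * w l * norm (\<Sum>i<p. x k i * cj (x l i))^4))"

end

lemma conjugation_real: "conjugation (\<lambda>x::real. x)"
  by unfold_locales (auto simp: power2_eq_square)

lemma conjugation_complex: "conjugation cnj"
  by unfold_locales (auto simp: inner_complex_def complex_norm_square[symmetric])

lemma sum_prod4:
  fixes f g h k :: "'i \<Rightarrow> 'b::comm_semiring_0"
  shows "(\<Sum>a\<in>A. \<Sum>b\<in>A. \<Sum>c\<in>A. \<Sum>d\<in>A. f a * g b * h c * k d) = sum f A * sum g A * sum h A * sum k A"
  by (simp add: sum_distrib_left[symmetric] sum_distrib_right[symmetric])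

lemma sum_cartesian4:
  "(\<Sum>(a, b, c, d)\<in>A \<times> A \<times> A \<times> A. f a b c d) = (\<Sum>a\<in>A. \<Sum>b\<in>A. \<Sum>c\<in>A. \<Sum>d\<in>A. f a b c d)"
  by (simp add: sum.cartesian_product)

text \<open>
  The Kronecker delta, from which the invariant tensors below are built.
\<close>

definition kron :: "nat \<Rightarrow> nat \<Rightarrow> real" where
  "kron a b = (if a = b then 1 else 0)"

lemma kron_same [simp]: "kron a a = 1"
  by (simp add: kron_def)

lemma kron_commute: "kron a b = kron b a"
  by (simp add: kron_def)

lemma sum_kron [simp]: "a < p \<Longrightarrow> (\<Sum>b<p. kron a b * f b) = f a"
  by (simp add: kron_def if_distrib[of "\<lambda>x. x * _"] cong: if_cong)

lemma sum_kron_pairs: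
  "(\<Sum>a<p. \<Sum>b<p. \<Sum>c<p. \<Sum>d<p. kron a b * (kron c d * f a b c d)) = (\<Sum>a<p. \<Sum>c<p. f a a c c)"
  "(\<Sum>a<p. \<Sum>b<p. \<Sum>c<p. \<Sum>d<p. kron a c * (kron b d * f a b c d)) = (\<Sum>a<p. \<Sum>b<p. f a b a b)"
  "(\<Sum>a<p. \<Sum>b<p. \<Sum>c<p. \<Sum>d<p. kron a d * (kron b c * f a b c d)) = (\<Sum>a<p. \<Sum>b<p. f a b b a)"
proof -
  have 1: "(\<Sum>c<p. \<Sum>d<p. kron c d * g c d) = (\<Sum>c<p. g c c)" for g
    by (intro sum.cong refl) simp
  then show "(\<Sum>a<p. \<Sum>b<p. \<Sum>c<p. \<Sum>d<p. kron a b * (kron c d * f a b c d)) = (\<Sum>a<p. \<Sum>c<p. f a a c c)"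
    by (simp add: sum_distrib_left[symmetric])
  have "(\<Sum>c<p. \<Sum>d<p. kron a c * (kron b d * g c d)) = g a b" if "a < p" "b < p" for a b g
    using that by (simp add: sum_distrib_left[symmetric])
  then show "(\<Sum>a<p. \<Sum>b<p. \<Sum>c<p. \<Sum>d<p. kron a c * (kron b d * f a b c d)) = (\<Sum>a<p. \<Sum>b<p. f a b a b)"
    by (intro sum.cong refl) simp
  have "(\<Sum>c<p. \<Sum>d<p. kron a d * (kron b c * g c d)) = g b a" if "a < p" "b < p" for a b g
    by (subst sum.swap) (use that in \<open>simp add: sum_distrib_left[symmetric]\<close>)
  then show "(\<Sum>a<p. \<Sum>b<p. \<Sum>c<p. \<Sum>d<p. kron a d * (kron b c * f a b c d)) = (\<Sum>a<p. \<Sum>b<p. f a b b a)"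
    by (intro sum.cong refl) simp
qed

lemma sum_kron_kron:
  "(\<Sum>a<p. \<Sum>b<p. kron a b * kron a b) = real p" "(\<Sum>a<p. \<Sum>b<p. kron a b * kron b a) = real p"
proof -
  have "(\<Sum>a<p. \<Sum>b<p. kron a b * kron a b) = (\<Sum>a<p. kron a a)"
    by (intro sum.cong refl) simp
  then show *: "(\<Sum>a<p. \<Sum>b<p. kron a b * kron a b) = real p" by (simp add: kron_def)
  then show "(\<Sum>a<p. \<Sum>b<p. kron a b * kron b a) = real p" by (simp add: kron_commute)
qed

text \<open>
  The average of \<open>x\<^sub>a x\<^sub>b x\<^sub>c x\<^sub>d\<close> over the unit sphere of \<open>\<real>\<^sup>p\<close> is the symmetrised product of
  two Kronecker deltas, divided by \<open>p (p + 2)\<close>. Its inner product with the fourth power of any unit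
  vector, and hence also its squared norm, is \<open>3 / (p (p + 2))\<close>.
\<close>

lemma welch_bound_real:
  assumes "p \<ge> 1"
  shows "conjugation.welch_bound (\<lambda>x::real. x) p (3 / (real p * (real p + 2)))"
  unfolding conjugation.welch_bound_def[OF conjugation_real]
proof (intro allI impI)
  fix K :: "nat set" and w and x :: "nat \<Rightarrow> nat \<Rightarrow> real"
  assume "finite K" and x: "\<forall>k\<in>K. (\<Sum>i<p. (norm (x k i))^2) = 1"
  define q where "q = 1 / (real p * (real p + 2))"
  define I where "I = {..<p} \<times> {..<p} \<times> {..<p} \<times> {..<p}"
  define v where "v k = (\<lambda>(a, b, c, d). x k a * x k b * x k c * x k d)" for k
  define D where "D = (\<lambda>(a::nat, b::nat, c::nat, d::nat).
    q * (kron a b * kron c d + kron a c * kron b d + kron a d * kron b c))"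
  have D: "(\<Sum>i\<in>I. y i \<bullet> D i) = q * ((\<Sum>a<p. \<Sum>c<p. y (a, a, c, c)) + (\<Sum>a<p. \<Sum>b<p. y (a, b, a, b))
      + (\<Sum>a<p. \<Sum>b<p. y (a, b, b, a)))" for y :: "_ \<Rightarrow> real"
  proof -
    have "(\<Sum>i\<in>I. y i \<bullet> D i) = (\<Sum>(a, b, c, d)\<in>I. y (a, b, c, d) * D (a, b, c, d))"
      by (intro sum.cong) auto
    also have "\<dots> = (\<Sum>a<p. \<Sum>b<p. \<Sum>c<p. \<Sum>d<p. y (a, b, c, d) * D (a, b, c, d))"
      unfolding I_def by (rule sum_cartesian4)
    also have "\<dots> = q * ((\<Sum>a<p. \<Sum>b<p. \<Sum>c<p. \<Sum>d<p. kron a b * (kron c d * y (a, b, c, d)))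
       + (\<Sum>a<p. \<Sum>b<p. \<Sum>c<p. \<Sum>d<p. kron a c * (kron b d * y (a, b, c, d)))
       + (\<Sum>a<p. \<Sum>b<p. \<Sum>c<p. \<Sum>d<p. kron a d * (kron b c * y (a, b, c, d))))"
      unfolding D_def by (simp add: sum_distrib_left sum.distrib algebra_simps del: sum_kron)
    also have "(\<Sum>a<p. \<Sum>b<p. \<Sum>c<p. \<Sum>d<p. kron a b * (kron c d * y (a, b, c, d)))
        = (\<Sum>a<p. \<Sum>c<p. y (a, a, c, c))"
      by (rule sum_kron_pairs)
    also have "(\<Sum>a<p. \<Sum>b<p. \<Sum>c<p. \<Sum>d<p. kron a c * (kron b d * y (a, b, c, d)))
        = (\<Sum>a<p. \<Sum>b<p. y (a, b, a, b))"
      by (rule sum_kron_pairs)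
    also have "(\<Sum>a<p. \<Sum>b<p. \<Sum>c<p. \<Sum>d<p. kron a d * (kron b c * y (a, b, c, d)))
        = (\<Sum>a<p. \<Sum>b<p. y (a, b, b, a))"
      by (rule sum_kron_pairs)
    finally show ?thesis .
  qed
  have vD: "(\<Sum>i\<in>I. v k i \<bullet> D i) = 3 * q" if "k \<in> K" for k
  proof -
    have 1: "(\<Sum>a<p. \<Sum>c<p. (x k a)^2 * (x k c)^2) = 1"
      using x that by (simp add: sum_distrib_left[symmetric] sum_distrib_right[symmetric])
    have "(\<Sum>a<p. \<Sum>c<p. v k (a, a, c, c)) = 1" "(\<Sum>a<p. \<Sum>b<p. v k (a, b, a, b)) = 1"
         "(\<Sum>a<p. \<Sum>b<p. v k (a, b, b, a)) = 1"
      unfolding 1[symmetric] v_def by (simp_all add: power2_eq_square mult_ac)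
    then show ?thesis unfolding D by simp
  qed
  have DD: "(\<Sum>i\<in>I. D i \<bullet> D i) = 3 * q"
  proof -
    have "(\<Sum>a<p. \<Sum>c<p. D (a, a, c, c)) = q * ((real p)^2 + 2 * real p)"
         "(\<Sum>a<p. \<Sum>b<p. D (a, b, a, b)) = q * ((real p)^2 + 2 * real p)"
         "(\<Sum>a<p. \<Sum>b<p. D (a, b, b, a)) = q * ((real p)^2 + 2 * real p)"
      unfolding D_def
      by (simp_all add: sum_distrib_left[symmetric] sum.distrib sum_kron_kron power2_eq_square del: sum_kron)
    then have "(\<Sum>i\<in>I. D i \<bullet> D i) = 3 * q * (q * ((real p)^2 + 2 * real p))"
      unfolding D by simp
    also have "q * ((real p)^2 + 2 * real p) = 1"
    proof -
      have "real p * (real p + 2) \<noteq> 0" using assms by simp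
      then show ?thesis unfolding q_def by (simp add: power2_eq_square algebra_simps)
    qed
    finally show ?thesis by simp
  qed
  have vv: "(\<Sum>i\<in>I. v k i \<bullet> v l i) = norm (\<Sum>i<p. x k i * x l i)^4" for k l
  proof -
    have "(\<Sum>i\<in>I. v k i \<bullet> v l i) =
       (\<Sum>(a, b, c, d)\<in>I. (x k a * x l a) * (x k b * x l b) * (x k c * x l c) * (x k d * x l d))"
      by (intro sum.cong) (auto simp: v_def)
    also have "\<dots> = (\<Sum>i<p. x k i * x l i)^4"
      unfolding I_def sum_cartesian4 sum_prod4 by (simp add: power4_eq_xxxx)
    finally show ?thesis by (simp add: power_even_abs_numeral)
  qed
  from second_moment_bound[of K v D I "3 * q" w, OF vD DD]
  show "3 / (real p * (real p + 2)) * (\<Sum>k\<in>K. w k)^2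
     \<le> (\<Sum>k\<in>K. \<Sum>l\<in>K. w k * w l * norm (\<Sum>i<p. x k i * x l i)^4)"
    unfolding vv q_def by simp
qed

text \<open>
  Over \<open>\<complex>\<close> two of the four factors are conjugated, and only the two pairings of a
  conjugated with an unconjugated index survive in the average over the sphere.
\<close>

lemma welch_bound_complex:
  assumes "p \<ge> 1"
  shows "conjugation.welch_bound cnj p (2 / (real p * (real p + 1)))"
  unfolding conjugation.welch_bound_def[OF conjugation_complex]
proof (intro allI impI)
  fix K :: "nat set" and w and x :: "nat \<Rightarrow> nat \<Rightarrow> complex"
  assume "finite K" and x: "\<forall>k\<in>K. (\<Sum>i<p. (norm (x k i))^2) = 1"
  define q where "q = 1 / (real p * (real p + 1))"
  define I where "I = {..<p} \<times> {..<p} \<times> {..<p} \<times> {..<p}"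
  define v where "v k = (\<lambda>(a, b, c, d). x k a * x k b * cnj (x k c) * cnj (x k d))" for k
  define D where "D = (\<lambda>(a::nat, b::nat, c::nat, d::nat).
    complex_of_real (q * (kron a c * kron b d + kron a d * kron b c)))"
  have D: "(\<Sum>i\<in>I. y i \<bullet> D i) = q * ((\<Sum>a<p. \<Sum>b<p. Re (y (a, b, a, b)))
      + (\<Sum>a<p. \<Sum>b<p. Re (y (a, b, b, a))))" for y :: "_ \<Rightarrow> complex"
  proof -
    have "(\<Sum>i\<in>I. y i \<bullet> D i) = (\<Sum>(a, b, c, d)\<in>I. y (a, b, c, d) \<bullet> D (a, b, c, d))"
      by (intro sum.cong) auto
    also have "\<dots> = (\<Sum>a<p. \<Sum>b<p. \<Sum>c<p. \<Sum>d<p. y (a, b, c, d) \<bullet> D (a, b, c, d))"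
      unfolding I_def by (rule sum_cartesian4)
    also have "\<dots> = q * ((\<Sum>a<p. \<Sum>b<p. \<Sum>c<p. \<Sum>d<p. kron a c * (kron b d * Re (y (a, b, c, d))))
       + (\<Sum>a<p. \<Sum>b<p. \<Sum>c<p. \<Sum>d<p. kron a d * (kron b c * Re (y (a, b, c, d)))))"
      unfolding D_def by (simp add: inner_complex_def sum_distrib_left sum.distrib algebra_simps del: sum_kron)
    also have "(\<Sum>a<p. \<Sum>b<p. \<Sum>c<p. \<Sum>d<p. kron a c * (kron b d * Re (y (a, b, c, d))))
        = (\<Sum>a<p. \<Sum>b<p. Re (y (a, b, a, b)))"
      by (rule sum_kron_pairs)
    also have "(\<Sum>a<p. \<Sum>b<p. \<Sum>c<p. \<Sum>d<p. kron a d * (kron b c * Re (y (a, b, c, d))))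
        = (\<Sum>a<p. \<Sum>b<p. Re (y (a, b, b, a)))"
      by (rule sum_kron_pairs)
    finally show ?thesis .
  qed
  have vD: "(\<Sum>i\<in>I. v k i \<bullet> D i) = 2 * q" if "k \<in> K" for k
  proof -
    have 1: "(\<Sum>a<p. \<Sum>c<p. (cmod (x k a))^2 * (cmod (x k c))^2) = 1"
      using x that by (simp add: sum_distrib_left[symmetric] sum_distrib_right[symmetric])
    have 2: "v k (a, b, a, b) = of_real ((cmod (x k a))^2 * (cmod (x k b))^2)"
        "v k (a, b, b, a) = of_real ((cmod (x k a))^2 * (cmod (x k b))^2)" for a b
      unfolding v_def of_real_mult complex_norm_square by (simp_all add: mult_ac)
    show ?thesis unfolding D 2 Re_complex_of_real 1 by simp
  qed
  have DD: "(\<Sum>i\<in>I. D i \<bullet> D i) = 2 * q"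
  proof -
    have "(\<Sum>a<p. \<Sum>b<p. Re (D (a, b, a, b))) = q * ((real p)^2 + real p)"
         "(\<Sum>a<p. \<Sum>b<p. Re (D (a, b, b, a))) = q * ((real p)^2 + real p)"
      unfolding D_def
      by (simp_all add: sum_distrib_left[symmetric] sum.distrib sum_kron_kron power2_eq_square del: sum_kron)
    then have "(\<Sum>i\<in>I. D i \<bullet> D i) = 2 * q * (q * ((real p)^2 + real p))"
      unfolding D by simp
    also have "q * ((real p)^2 + real p) = 1"
    proof -
      have "real p * (real p + 1) \<noteq> 0" using assms by simp
      then show ?thesis unfolding q_def by (simp add: power2_eq_square algebra_simps)
    qed
    finally show ?thesis by simp
  qed
  have vv: "(\<Sum>i\<in>I. v k i \<bullet> v l i) = norm (\<Sum>i<p. x k i * cnj (x l i))^4" for k l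
  proof -
    let ?g = "\<Sum>i<p. x k i * cnj (x l i)"
    have "(\<Sum>i\<in>I. v k i \<bullet> v l i) = Re (\<Sum>i\<in>I. v k i * cnj (v l i))"
      by (simp add: inner_complex_def)
    also have "(\<Sum>i\<in>I. v k i * cnj (v l i)) =
       (\<Sum>(a, b, c, d)\<in>I. (x k a * cnj (x l a)) * (x k b * cnj (x l b))
          * (cnj (x k c) * x l c) * (cnj (x k d) * x l d))"
      by (intro sum.cong) (auto simp: v_def)
    also have "\<dots> = ?g * ?g * cnj ?g * cnj ?g"
      unfolding I_def sum_cartesian4 sum_prod4 by simp
    also have "\<dots> = (?g * cnj ?g)^2" by (simp add: power2_eq_square mult_ac)
    also have "\<dots> = of_real (cmod ?g ^ 4)"
      unfolding complex_norm_square[symmetric] by (simp flip: power_mult)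
    finally show ?thesis by simp
  qed
  from second_moment_bound[of K v D I "2 * q" w, OF vD DD]
  show "2 / (real p * (real p + 1)) * (\<Sum>k\<in>K. w k)^2
     \<le> (\<Sum>k\<in>K. \<Sum>l\<in>K. w k * w l * norm (\<Sum>i<p. x k i * cnj (x l i))^4)"
    unfolding vv q_def by simp
qed

section \<open>An inequality for Parseval frames\<close>

context conjugation
begin

abbreviation re :: "'a \<Rightarrow> real" where "re x \<equiv> 1 \<bullet> x"

lemma re_of_real [simp]: "re (of_real r) = r"
  by (simp add: of_real_def dot_square_norm)

lemma abs_re_le: "\<bar>re x\<bar> \<le> norm x"
  using Cauchy_Schwarz_ineq2[of 1 x] by simp

lemma re_le: "re x \<le> norm x"
  using abs_re_le[of x] by simp

lemma norm_cj [simp]: "norm (cj x) = norm x"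
proof -
  have "of_real ((norm (cj x))^2) = (of_real ((norm x)^2) :: 'a)"
    by (simp only: mult_cj[symmetric]) (simp add: mult.commute)
  then show ?thesis by (simp only: of_real_eq_iff) simp
qed

lemma cj_0 [simp]: "cj 0 = 0"
  using norm_cj[of 0] by (simp only: norm_zero norm_eq_zero)

lemma cj_sum: "cj (sum f S) = (\<Sum>i\<in>S. cj (f i))"
  by (induction S rule: infinite_finite_induct) (auto simp: cj_add)

lemma cj_of_real [simp]: "cj (of_real r) = of_real r"
proof (cases "r = 0")
  case False
  have "of_real r * cj (of_real r) = (of_real (r^2) :: 'a)"
    using mult_cj[of "of_real r"] by simp
  also have "\<dots> = of_real r * of_real r" by (simp add: power2_eq_square)
  finally show ?thesis using False by simp
qed simp

lemma re_cj [simp]: "re (cj x) = re x"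
  using inner_eq_cj[of x 1] by (simp add: inner_commute)

lemma re_mult_cj_self [simp]: "re (x * cj x) = (norm x)^2"
  by (simp only: mult_cj re_of_real)

lemma re_of_real_mult [simp]: "re (of_real r * x) = r * re x"
  by (simp flip: scaleR_conv_of_real)

lemma re_sum: "re (sum f S) = (\<Sum>i\<in>S. re (f i))"
  by (simp add: inner_sum_right)

text \<open>
  The quartic inequality is applied to the normalised entries of the Gram matrix \<open>g\<close> of the
  frame. With \<open>a\<^sub>k = \<parallel>u\<^sub>k\<parallel>\<close>, this leaves three sums: \<open>s\<^sup>2\<close>, which is at most \<open>p\<close> by
  Cauchy--Schwarz; the quadratic sum \<open>Q\<close>, which is at most 1 because \<open>g\<close> is a
  projection; and the quartic sum \<open>R\<close>, which the Welch bound estimates from below. The second bound is the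
  cruder estimate by \<open>s\<^sup>2\<close> alone, for the dimension \<open>p = 1\<close>.
\<close>

lemma nontrivial_parseval_frame_bound:
  fixes u :: "nat \<Rightarrow> nat \<Rightarrow> 'a" and t :: "nat \<Rightarrow> real"
  assumes fin: "finite K"
    and tight: "\<And>i j. i < p \<Longrightarrow> j < p \<Longrightarrow> (\<Sum>k\<in>K. u k i * cj (u k j)) = of_bool (i = j)"
    and t0: "\<And>k. k \<in> K \<Longrightarrow> 0 \<le> t k" and t1: "(\<Sum>k\<in>K. (t k)^2) \<le> 1"
    and nz: "\<And>k. k \<in> K \<Longrightarrow> (\<Sum>i<p. (norm (u k i))^2) \<noteq> 0"
    and welch: "welch_bound p h" and c: "0 < c" and h: "h \<le> c^2 * (1 + 2 * c)"
  defines "G \<equiv> (\<Sum>k\<in>K. \<Sum>l\<in>K. t k * t l * norm (\<Sum>i<p. u k i * cj (u l i)))"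
  shows "2 * c * (1 + c)^2 * G \<le> (c^2 * (1 + 2 * c) - h) * p + (1 + 2 * c + 3 * c^2)"
    and "G \<le> p"
proof -
  define a where "a k = sqrt (\<Sum>i<p. (norm (u k i))^2)" for k
  have a2: "(a k)^2 = (\<Sum>i<p. (norm (u k i))^2)" for k
    unfolding a_def by (simp add: sum_nonneg)
  have a_pos: "a k > 0" if "k \<in> K" for k
    using nz[OF that] unfolding a_def by (simp add: sum_nonneg less_le)
  define g where "g k l = (\<Sum>i<p. u k i * cj (u l i))" for k l
  have g_cj: "cj (g k l) = g l k" for k l
    unfolding g_def by (simp add: cj_sum cj_mult mult.commute)
  have g_le: "norm (g k l) \<le> a k * a l" for k l
  proof -
    have "norm (g k l) \<le> (\<Sum>i<p. \<bar>norm (u k i)\<bar> * \<bar>norm (u l i)\<bar>)"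
      unfolding g_def by (rule order.trans[OF norm_sum]) (simp add: norm_mult)
    also have "\<dots> \<le> a k * a l"
      using L2_set_mult_ineq[of "\<lambda>i. norm (u k i)" "\<lambda>i. norm (u l i)" "{..<p}"]
      unfolding a_def L2_set_def by simp
    finally show ?thesis .
  qed
  have sum_a2: "(\<Sum>k\<in>K. (a k)^2) = p"
  proof -
    have "(\<Sum>k\<in>K. (a k)^2) = re (\<Sum>i<p. \<Sum>k\<in>K. u k i * cj (u k i))"
      unfolding a2 by (subst sum.swap) (simp add: re_sum)
    also have "(\<Sum>i<p. \<Sum>k\<in>K. u k i * cj (u k i)) = of_real (real p)"
      by (simp add: tight)
    finally show ?thesis by (simp only: re_of_real)
  qed
  define s where "s = (\<Sum>k\<in>K. t k * a k)"
  have s2: "s^2 \<le> p"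
  proof -
    have "s^2 \<le> (\<Sum>k\<in>K. (t k)^2) * (\<Sum>k\<in>K. (a k)^2)"
      unfolding s_def by (rule Cauchy_Schwarz_ineq_sum)
    also have "\<dots> \<le> 1 * real p"
      unfolding sum_a2 using t1 by (intro mult_right_mono) auto
    finally show ?thesis by simp
  qed
  have s_sq: "s^2 = (\<Sum>k\<in>K. \<Sum>l\<in>K. t k * t l * (a k * a l))"
    unfolding s_def power2_eq_square sum_product by (simp add: mult_ac)
  have G_eq: "G = (\<Sum>k\<in>K. \<Sum>l\<in>K. t k * t l * norm (g k l))"
    unfolding G_def g_def ..
  have "G \<le> s^2"
    unfolding G_eq s_sq using t0 g_le by (intro sum_mono mult_left_mono) auto
  with s2 show "G \<le> p" by simp
  define Q where "Q = (\<Sum>k\<in>K. \<Sum>l\<in>K. t k * t l * ((norm (g k l))^2 / (a k * a l)))"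
  have Q: "Q \<le> 1"
  proof -
    \<comment> \<open>The vector \<open>v\<^sub>k\<close> is the image of \<open>u\<^sub>k\<close> under the operator \<open>\<Sum>\<^sub>l (t\<^sub>l / a\<^sub>l) u\<^sub>l u\<^sub>l\<^sup>*\<close>. Both
      \<open>\<Sum>\<^sub>k \<parallel>v\<^sub>k\<parallel>\<^sup>2\<close> and \<open>\<Sum>\<^sub>k (t\<^sub>k / a\<^sub>k) \<langle>u\<^sub>k, v\<^sub>k\<rangle>\<close> equal \<open>Q\<close>, so that
      \<open>\<Sum>\<^sub>k \<parallel>(t\<^sub>k / a\<^sub>k) u\<^sub>k - v\<^sub>k\<parallel>\<^sup>2 = \<Sum>\<^sub>k t\<^sub>k\<^sup>2 - Q\<close>.\<close>
    define v where "v k i = (\<Sum>l\<in>K. of_real (t l / a l) * g k l * u l i)" for k i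
    have norm_v: "(\<Sum>k\<in>K. \<Sum>i<p. (norm (v k i))^2) = Q"
    proof -
      \<comment> \<open>The Gram matrix of a Parseval frame is a projection.\<close>
      have gg: "(\<Sum>k\<in>K. g l' k * g k l) = g l' l" for l l'
      proof -
        have "(\<Sum>k\<in>K. g l' k * g k l) = (\<Sum>k\<in>K. \<Sum>i<p. \<Sum>j<p. u l' i * cj (u k i) * (u k j * cj (u l j)))"
          unfolding g_def sum_product ..
        also have "\<dots> = (\<Sum>i<p. \<Sum>j<p. \<Sum>k\<in>K. u l' i * cj (u k i) * (u k j * cj (u l j)))"
          by (rule trans[OF sum.swap]) (rule sum.cong[OF refl], rule sum.swap)
        also have "\<dots> = (\<Sum>i<p. \<Sum>j<p. u l' i * cj (u l j) * (\<Sum>k\<in>K. u k j * cj (u k i)))"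
          by (simp add: sum_distrib_left mult_ac)
        also have "\<dots> = (\<Sum>i<p. \<Sum>j<p. u l' i * cj (u l j) * of_bool (j = i))"
          by (simp add: tight)
        also have "\<dots> = g l' l"
          unfolding g_def by (intro sum.cong refl) (simp add: of_bool_def if_distrib cong: if_cong)
        finally show ?thesis .
      qed
      have "(\<Sum>i<p. v k i * cj (v k i)) = (\<Sum>l\<in>K. \<Sum>l'\<in>K.
            of_real (t l / a l * (t l' / a l')) * g l l' * (g l' k * g k l))" for k
      proof -
        have "(\<Sum>i<p. v k i * cj (v k i)) = (\<Sum>i<p. \<Sum>l\<in>K. \<Sum>l'\<in>K.
            (of_real (t l / a l) * g k l * u l i) * (of_real (t l' / a l') * g l' k * cj (u l' i)))"
          unfolding v_def cj_sum sum_product by (simp add: cj_mult g_cj del: of_real_divide)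
        also have "\<dots> = (\<Sum>l\<in>K. \<Sum>l'\<in>K. \<Sum>i<p.
            (of_real (t l / a l) * g k l * u l i) * (of_real (t l' / a l') * g l' k * cj (u l' i)))"
          by (rule trans[OF sum.swap]) (rule sum.cong[OF refl], rule sum.swap)
        also have "\<dots> = (\<Sum>l\<in>K. \<Sum>l'\<in>K.
            of_real (t l / a l * (t l' / a l')) * g l l' * (g l' k * g k l))"
        proof (intro sum.cong refl)
          fix l l'
          show "(\<Sum>i<p. (of_real (t l / a l) * g k l * u l i) * (of_real (t l' / a l') * g l' k * cj (u l' i)))
            = of_real (t l / a l * (t l' / a l')) * g l l' * (g l' k * g k l)"
            unfolding g_def[of l l'] of_real_mult sum_distrib_left sum_distrib_right
            by (intro sum.cong refl) (simp only: mult_ac)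
        qed
        finally show ?thesis .
      qed
      then have "(\<Sum>k\<in>K. \<Sum>i<p. v k i * cj (v k i)) = (\<Sum>l\<in>K. \<Sum>l'\<in>K. \<Sum>k\<in>K.
            of_real (t l / a l * (t l' / a l')) * g l l' * (g l' k * g k l))"
        by simp (rule trans[OF sum.swap], rule sum.cong[OF refl], rule sum.swap)
      also have "\<dots> = (\<Sum>l\<in>K. \<Sum>l'\<in>K. of_real (t l / a l * (t l' / a l')) * g l l' * g l' l)"
        unfolding sum_distrib_left[symmetric] gg ..
      also have "\<dots> = (\<Sum>l\<in>K. \<Sum>l'\<in>K. of_real (t l / a l * (t l' / a l') * (norm (g l l'))^2))"
        using mult_cj[of "g l l'" for l l'] unfolding g_cj by (simp only: mult.assoc of_real_mult)
      finally have "re (\<Sum>k\<in>K. \<Sum>i<p. v k i * cj (v k i)) =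
         re (\<Sum>l\<in>K. \<Sum>l'\<in>K. of_real (t l / a l * (t l' / a l') * (norm (g l l'))^2))"
        by simp
      then show ?thesis
        unfolding re_sum re_of_real re_mult_cj_self Q_def by (simp add: field_simps)
    qed
    have uv: "re (\<Sum>i<p. u k i * cj (v k i)) = (\<Sum>l\<in>K. t l / a l * (norm (g k l))^2)" for k
    proof -
      have "(\<Sum>i<p. u k i * cj (v k i)) = (\<Sum>i<p. \<Sum>l\<in>K. of_real (t l / a l) * g l k * (u k i * cj (u l i)))"
        unfolding v_def cj_sum sum_distrib_left
        by (simp add: cj_mult g_cj mult_ac del: of_real_divide)
      also have "\<dots> = (\<Sum>l\<in>K. \<Sum>i<p. of_real (t l / a l) * g l k * (u k i * cj (u l i)))"
        by (rule sum.swap)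
      also have "\<dots> = (\<Sum>l\<in>K. of_real (t l / a l) * g l k * g k l)"
        by (simp only: g_def[of k] sum_distrib_left)
      also have "\<dots> = (\<Sum>l\<in>K. of_real (t l / a l * (norm (g k l))^2))"
        using mult_cj[of "g k l" for l] by (simp add: g_cj mult_ac)
      finally show ?thesis by (simp only: re_sum re_of_real)
    qed
    have sq: "(norm (x - y))^2 = (norm x)^2 - 2 * re (x * cj y) + (norm y)^2" for x y :: 'a
    proof -
      have "x \<bullet> y = re (x * cj y)"
        using inner_eq_cj[of x y] re_cj[of "cj x * y"] by (simp add: cj_mult)
      then show ?thesis
        by (simp add: power2_norm_eq_inner inner_diff_left inner_diff_right inner_commute)
    qed
    have "0 \<le> (\<Sum>k\<in>K. \<Sum>i<p. (norm (of_real (t k / a k) * u k i - v k i))^2)"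
      by (intro sum_nonneg) auto
    also have "\<dots> = (\<Sum>k\<in>K. (t k / a k)^2 * (\<Sum>i<p. (norm (u k i))^2)
        - 2 * (t k / a k * re (\<Sum>i<p. u k i * cj (v k i))) + (\<Sum>i<p. (norm (v k i))^2))"
      unfolding sq re_sum
      by (simp add: sum.distrib sum_subtractf sum_distrib_left norm_mult power_mult_distrib power_divide mult.assoc del: of_real_divide)
    also have "\<dots> = (\<Sum>k\<in>K. (t k)^2 - 2 * (t k / a k * re (\<Sum>i<p. u k i * cj (v k i))) + (\<Sum>i<p. (norm (v k i))^2))"
    proof (intro sum.cong refl)
      fix k assume "k \<in> K"
      then have "(t k / a k)^2 * (a k)^2 = (t k)^2" using a_pos[of k] by (simp add: power_divide)
      then show "(t k / a k)^2 * (\<Sum>i<p. (norm (u k i))^2)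
          - 2 * (t k / a k * re (\<Sum>i<p. u k i * cj (v k i))) + (\<Sum>i<p. (norm (v k i))^2)
        = (t k)^2 - 2 * (t k / a k * re (\<Sum>i<p. u k i * cj (v k i))) + (\<Sum>i<p. (norm (v k i))^2)"
        by (simp only: a2)
    qed
    also have "\<dots> = (\<Sum>k\<in>K. (t k)^2) - 2 * (\<Sum>k\<in>K. t k / a k * re (\<Sum>i<p. u k i * cj (v k i))) + Q"
      by (simp only: sum.distrib sum_subtractf norm_v sum_distrib_left[symmetric])
    also have "(\<Sum>k\<in>K. t k / a k * re (\<Sum>i<p. u k i * cj (v k i))) = Q"
      unfolding uv Q_def by (simp add: sum_distrib_left field_simps)
    finally show ?thesis using t1 by simp
  qed
  define R where "R = (\<Sum>k\<in>K. \<Sum>l\<in>K. t k * t l * ((norm (g k l))^4 / (a k * a l)^3))"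
  have R: "h * s^2 \<le> R"
  proof -
    define x where "x k i = of_real (1 / a k) * u k i" for k i
    have "(\<Sum>i<p. (norm (x k i))^2) = 1" if "k \<in> K" for k
    proof -
      have "(\<Sum>i<p. (norm (x k i))^2) = (1 / a k)^2 * (a k)^2"
        unfolding a2 x_def by (simp add: norm_mult power_mult_distrib sum_distrib_left norm_divide power_divide)
      also have "\<dots> = 1" using a_pos[OF that] by (simp add: power_divide)
      finally show ?thesis .
    qed
    then have *: "h * (\<Sum>k\<in>K. t k * a k)^2
       \<le> (\<Sum>k\<in>K. \<Sum>l\<in>K. (t k * a k) * (t l * a l) * norm (\<Sum>i<p. x k i * cj (x l i))^4)"
      using welch fin unfolding welch_bound_def by blast
    have xx: "(\<Sum>i<p. x k i * cj (x l i)) = of_real (1 / (a k * a l)) * g k l" for k l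
      unfolding x_def g_def sum_distrib_left
      by (intro sum.cong refl) (simp add: cj_mult mult_ac del: of_real_divide flip: of_real_mult)
    have "(t k * a k) * (t l * a l) * norm (\<Sum>i<p. x k i * cj (x l i))^4 =
        t k * t l * ((norm (g k l))^4 / (a k * a l)^3)" if "k \<in> K" "l \<in> K" for k l
    proof -
      have "norm (\<Sum>i<p. x k i * cj (x l i)) = norm (g k l) / (a k * a l)"
        unfolding xx using a_pos[of k] a_pos[of l] that by (simp add: norm_mult norm_divide)
      then show ?thesis
        using a_pos[of k] a_pos[of l] that
        by (simp add: power_divide power_mult_distrib power4_eq_xxxx power3_eq_cube)
    qed
    then have "(\<Sum>k\<in>K. \<Sum>l\<in>K. (t k * a k) * (t l * a l) * norm (\<Sum>i<p. x k i * cj (x l i))^4) = R"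
      unfolding R_def by (intro sum.cong refl) simp
    with * show ?thesis unfolding s_def by simp
  qed
  have "2 * c * (1 + c)^2 * (t k * t l * norm (g k l)) \<le>
     c^2 * (1 + 2 * c) * (t k * t l * (a k * a l))
     + (1 + 2 * c + 3 * c^2) * (t k * t l * ((norm (g k l))^2 / (a k * a l)))
     - t k * t l * ((norm (g k l))^4 / (a k * a l)^3)" if "k \<in> K" "l \<in> K" for k l
  proof -
    define b where "b = a k * a l"
    define z where "z = norm (g k l) / b"
    have b: "b > 0" unfolding b_def using a_pos that by simp
    have z: "norm (g k l) = b * z" unfolding z_def using b by simp
    have "z \<le> 1" unfolding z_def using g_le[of k l] b b_def by simp
    moreover have "z \<ge> 0" unfolding z_def using b by simp
    ultimately have "(t k * t l * b) * (2 * c * (1 + c)^2 * z)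
      \<le> (t k * t l * b) * (c^2 * (1 + 2 * c) + (1 + 2 * c + 3 * c^2) * z^2 - z^4)"
      using le_quartic[OF c] t0 that b by (intro mult_left_mono) auto
    moreover have "(b * z)^2 / b = b * z^2" "(b * z)^4 / b^3 = b * z^4"
      using b by (simp_all add: power2_eq_square power4_eq_xxxx power3_eq_cube)
    ultimately show ?thesis
      unfolding b_def[symmetric] z by (simp add: algebra_simps)
  qed
  then have "2 * c * (1 + c)^2 * G \<le> (\<Sum>k\<in>K. \<Sum>l\<in>K. c^2 * (1 + 2 * c) * (t k * t l * (a k * a l))
     + (1 + 2 * c + 3 * c^2) * (t k * t l * ((norm (g k l))^2 / (a k * a l)))
     - t k * t l * ((norm (g k l))^4 / (a k * a l)^3))"
    unfolding G_eq sum_distrib_left by (intro sum_mono) simp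
  also have "\<dots> = c^2 * (1 + 2 * c) * s^2 + (1 + 2 * c + 3 * c^2) * Q - R"
    by (simp only: sum.distrib sum_subtractf sum_distrib_left[symmetric] s_sq Q_def R_def)
  also have "\<dots> \<le> (c^2 * (1 + 2 * c) - h) * s^2 + (1 + 2 * c + 3 * c^2) * 1"
  proof -
    have "(1 + 2 * c + 3 * c^2) * Q \<le> (1 + 2 * c + 3 * c^2) * 1"
      using Q c by (intro mult_left_mono) auto
    with R show ?thesis by (simp add: left_diff_distrib)
  qed
  also have "\<dots> \<le> (c^2 * (1 + 2 * c) - h) * p + (1 + 2 * c + 3 * c^2) * 1"
    using s2 h by (intro add_right_mono mult_left_mono) auto
  finally show "2 * c * (1 + c)^2 * G \<le> (c^2 * (1 + 2 * c) - h) * p + (1 + 2 * c + 3 * c^2)"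
    by simp
qed

text \<open>
  The dimension \<open>p\<close> may be smaller than \<open>m\<close>, because the functionals in a convex combination of dyads
  need not separate the points of the subspace.
\<close>

definition frame_bound :: "nat \<Rightarrow> real \<Rightarrow> bool" where
  "frame_bound m b \<longleftrightarrow> (\<forall>(K::nat set) (u :: nat \<Rightarrow> nat \<Rightarrow> 'a) t p. finite K \<longrightarrow> p \<le> m \<longrightarrow>
     (\<forall>i<p. \<forall>j<p. (\<Sum>k\<in>K. u k i * cj (u k j)) = of_bool (i = j)) \<longrightarrow>
     (\<forall>k\<in>K. 0 \<le> t k) \<longrightarrow> (\<Sum>k\<in>K. (t k)^2) \<le> 1 \<longrightarrow>
     (\<Sum>k\<in>K. \<Sum>l\<in>K. t k * t l * norm (\<Sum>i<p. u k i * cj (u l i))) \<le> b)"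

text \<open>
  Vectors \<open>u\<^sub>k = 0\<close> contribute nothing and are dropped. For \<open>m = 1\<close> the coefficient
  \<open>c\<^sup>2 (1 + 2 c) - h\<close> of \<open>s\<^sup>2\<close> is negative in the real case, and the crude bound \<open>p \<le> 1\<close> takes over.
\<close>

lemma frame_boundI:
  assumes welch: "\<And>p. 1 \<le> p \<Longrightarrow> p \<le> m \<Longrightarrow> welch_bound p h" and c: "0 < c"
    and h: "h \<le> c^2 * (1 + 2 * c) \<or> m \<le> 1" and b: "b \<ge> 1"
    and bound: "(c^2 * (1 + 2 * c) - h) * m + (1 + 2 * c + 3 * c^2) \<le> 2 * c * (1 + c)^2 * b"
  shows "frame_bound m b"
  unfolding frame_bound_def
proof (intro allI impI)
  fix K :: "nat set" and u :: "nat \<Rightarrow> nat \<Rightarrow> 'a" and t :: "nat \<Rightarrow> real" and p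
  assume fin: "finite K" and p: "p \<le> m"
    and tight: "\<forall>i<p. \<forall>j<p. (\<Sum>k\<in>K. u k i * cj (u k j)) = of_bool (i = j)"
    and t0: "\<forall>k\<in>K. 0 \<le> t k" and t1: "(\<Sum>k\<in>K. (t k)^2) \<le> 1"
  define K' where "K' = {k\<in>K. (\<Sum>i<p. (norm (u k i))^2) \<noteq> 0}"
  define G where "G = (\<Sum>k\<in>K'. \<Sum>l\<in>K'. t k * t l * norm (\<Sum>i<p. u k i * cj (u l i)))"
  have K': "K' \<subseteq> K" unfolding K'_def by auto
  have u0: "u k i = 0" if "k \<in> K - K'" "i < p" for k i
    using that unfolding K'_def by (auto simp: sum_nonneg_eq_0_iff)
  have G: "(\<Sum>k\<in>K. \<Sum>l\<in>K. t k * t l * norm (\<Sum>i<p. u k i * cj (u l i))) = G"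
    unfolding G_def
    by (intro sum.mono_neutral_cong_right[OF fin K'] ballI sum.neutral)
       (auto simp: u0)
  have fin': "finite K'" using fin K' by (rule finite_subset[rotated])
  have tight': "(\<Sum>k\<in>K'. u k i * cj (u k j)) = of_bool (i = j)" if "i < p" "j < p" for i j
  proof -
    have "(\<Sum>k\<in>K'. u k i * cj (u k j)) = (\<Sum>k\<in>K. u k i * cj (u k j))"
      using that by (intro sum.mono_neutral_left[OF fin K']) (auto simp: u0)
    then show ?thesis using tight that by simp
  qed
  have t0': "0 \<le> t k" if "k \<in> K'" for k using t0 K' that by auto
  have "(\<Sum>k\<in>K'. (t k)^2) \<le> (\<Sum>k\<in>K. (t k)^2)"
    by (rule sum_mono2[OF fin K']) auto
  with t1 have t1': "(\<Sum>k\<in>K'. (t k)^2) \<le> 1" by simp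
  have nz: "(\<Sum>i<p. (norm (u k i))^2) \<noteq> 0" if "k \<in> K'" for k
    using that K'_def by auto
  have "G \<le> b"
  proof -
    consider "p = 0" | "p \<ge> 1" "m \<le> 1" | "p \<ge> 1" "h \<le> c^2 * (1 + 2 * c)"
      using h by linarith
    then show ?thesis
    proof cases
      case 1
      then show ?thesis using b by (simp add: G_def)
    next
      case 2
      \<comment> \<open>Any constant that meets the side condition serves here, since the second bound does not contain it.\<close>
      define c' where "c' = max 1 h"
      have c': "1 \<le> c'" "h \<le> c'" unfolding c'_def by auto
      then have "1 * (1 + 2 * c') \<le> c'^2 * (1 + 2 * c')" by (intro mult_right_mono) auto
      moreover have "h \<le> 1 * (1 + 2 * c')" using c' by (simp add: max_def)
      ultimately have "h \<le> c'^2 * (1 + 2 * c')" by (rule order_trans[rotated])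
      moreover have "welch_bound p h" using 2(1) p by (rule welch)
      ultimately have "G \<le> p" unfolding G_def
        using nontrivial_parseval_frame_bound(2)[of K' p u t h c'] fin' tight' t0' t1' nz c' by simp
      with 2 p b show ?thesis by simp
    next
      case 3
      from 3(1) p have w: "welch_bound p h" by (rule welch)
      have "2 * c * (1 + c)^2 * G \<le> (c^2 * (1 + 2 * c) - h) * p + (1 + 2 * c + 3 * c^2)"
        using nontrivial_parseval_frame_bound(1)[of K' p u t h c] fin' tight' t0' t1' nz c w 3(2)
        unfolding G_def by simp
      also have "\<dots> \<le> (c^2 * (1 + 2 * c) - h) * m + (1 + 2 * c + 3 * c^2)"
        using p 3(2) by (intro add_right_mono mult_left_mono) auto
      also note bound
      finally have "2 * c * (1 + c)^2 * G \<le> 2 * c * (1 + c)^2 * b" .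
      moreover have "2 * c * (1 + c)^2 > 0" using c by (simp add: zero_less_mult_iff)
      ultimately show ?thesis by (simp only: mult_le_cancel_left_pos)
    qed
  qed
  then show "(\<Sum>k\<in>K. \<Sum>l\<in>K. t k * t l * norm (\<Sum>i<p. u k i * cj (u l i))) \<le> b"
    unfolding G .
qed

lemma welch_bound_mono: "welch_bound p h \<Longrightarrow> h' \<le> h \<Longrightarrow> welch_bound p h'"
  unfolding welch_bound_def by (meson mult_right_mono order_trans zero_le_power2)

end

section \<open>The constants\<close>

text \<open>
  In terms of \<open>c\<close> one has \<open>m = 1 / c\<^sup>2 - 2\<close>, and the constant becomes a rational function of
  \<open>c\<close>, in the form in which the frame bound produces it.
\<close>

lemma delta_real_eq:
  assumes "m \<ge> 1" "c = 1 / sqrt (real m + 2)"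
  shows "c * (1 + c) * delta_real m = (1 - c) * (1 + 2 * c)"
    "c > 0" "c^2 * (real m + 2) = 1"
proof -
  show c: "c > 0" using assms by simp
  show c2: "c^2 * (real m + 2) = 1" using assms by (simp add: power_divide)
  have r: "sqrt (real m + 2) * c = 1" using assms by simp
  define r where "r = sqrt (real m + 2)"
  have cr: "c * r = 1" using r by (simp add: r_def mult.commute)
  have d: "(real m + 1) * delta_real m = 2 + (real m - 1) * r"
    unfolding delta_real_def r_def[symmetric] by (simp add: field_simps)
  have "c < 1"
    using assms by simp
  have "(c^2 * (real m + 2) - c^2) * (c * delta_real m) = 2 * c^3 + (c^2 * (real m + 2) - 3 * c^2) * (c * r)"
    using arg_cong[OF d, of "\<lambda>x. c^3 * x"] by (simp add: algebra_simps power2_eq_square power3_eq_cube)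
  then have "(1 - c) * (c * (1 + c) * delta_real m) = (1 - c) * ((1 - c) * (1 + 2 * c))"
    unfolding c2 cr by (simp add: algebra_simps power2_eq_square power3_eq_cube)
  with \<open>c < 1\<close> show "c * (1 + c) * delta_real m = (1 - c) * (1 + 2 * c)" by simp
qed

lemma delta_complex_eq:
  assumes "m \<ge> 1" "c = 1 / sqrt (real m + 1)"
  shows "c * (1 + c) * delta_complex m = 1 + c - c^2"
    "c > 0" "c^2 * (real m + 1) = 1"
proof -
  show c: "c > 0" using assms by simp
  show c2: "c^2 * (real m + 1) = 1" using assms by (simp add: power_divide)
  define r where "r = sqrt (real m + 1)"
  have cr: "c * r = 1" using assms by (simp add: r_def)
  have d: "real m * delta_complex m = 1 + (real m - 1) * r"
    unfolding delta_complex_def r_def[symmetric] using assms by (simp add: field_simps)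
  have "c < 1"
    using assms by simp
  have "(c^2 * (real m + 1) - c^2) * (c * delta_complex m) = c^3 + (c^2 * (real m + 1) - 2 * c^2) * (c * r)"
    using arg_cong[OF d, of "\<lambda>x. c^3 * x"] by (simp add: algebra_simps power2_eq_square power3_eq_cube)
  then have "(1 - c) * (c * (1 + c) * delta_complex m) = (1 - c) * (1 + c - c^2)"
    unfolding c2 cr by (simp add: algebra_simps power2_eq_square power3_eq_cube)
  with \<open>c < 1\<close> show "c * (1 + c) * delta_complex m = 1 + c - c^2" by simp
qed

lemma delta_real_ge_1: "m \<ge> 1 \<Longrightarrow> delta_real m \<ge> 1"
proof -
  assume "m \<ge> 1"
  then have "(real m - 1) * 1 \<le> (real m - 1) * sqrt (real m + 2)"
    by (intro mult_left_mono) auto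
  then show ?thesis unfolding delta_real_def by (simp add: field_simps)
qed

lemma delta_complex_ge_1: "m \<ge> 1 \<Longrightarrow> delta_complex m \<ge> 1"
proof -
  assume "m \<ge> 1"
  then have "(real m - 1) * 1 \<le> (real m - 1) * sqrt (real m + 1)"
    by (intro mult_left_mono) auto
  with \<open>m \<ge> 1\<close> show ?thesis unfolding delta_complex_def by (simp add: field_simps)
qed

text \<open>
  With \<open>s = sqrt m\<close>, the difference of the squares in the main step is \<open>2 (s\<^sup>2 + 1) (s - 1)\<^sup>2\<close>; in the complex case
  below it is \<open>s\<^sup>2 (s - 1)\<^sup>2\<close>.
\<close>

lemma delta_real_le_sqrt: "m \<ge> 1 \<Longrightarrow> delta_real m \<le> sqrt m"
proof -
  assume m: "m \<ge> 1"
  define s where "s = sqrt m"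
  have s: "s \<ge> 1" "real m = s^2" using m by (auto simp: s_def)
  have "(real m - 1) * sqrt (real m + 2) \<le> (real m + 1) * s - 2"
  proof (rule power2_le_imp_le)
    have "0 \<le> 2 * (s^2 + 1) * (s - 1)^2" by simp
    then show "((real m - 1) * sqrt (real m + 2))^2 \<le> ((real m + 1) * s - 2)^2"
      unfolding power_mult_distrib s(2) by (simp add: algebra_simps power2_eq_square)
    have "2 * 1 \<le> (real m + 1) * s" using s(1) m by (intro mult_mono) auto
    then show "0 \<le> (real m + 1) * s - 2" by simp
  qed
  then show ?thesis unfolding delta_real_def s_def by (simp add: field_simps)
qed

lemma delta_complex_le_sqrt: "m \<ge> 1 \<Longrightarrow> delta_complex m \<le> sqrt m"
proof -
  assume m: "m \<ge> 1"
  define s where "s = sqrt m"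
  have s: "s \<ge> 1" "real m = s^2" using m by (auto simp: s_def)
  have "(real m - 1) * sqrt (real m + 1) \<le> real m * s - 1"
  proof (rule power2_le_imp_le)
    have "0 \<le> s^2 * (s - 1)^2" by simp
    then show "((real m - 1) * sqrt (real m + 1))^2 \<le> (real m * s - 1)^2"
      unfolding power_mult_distrib s(2) by (simp add: algebra_simps power2_eq_square)
    have "1 * 1 \<le> real m * s" using s(1) m by (intro mult_mono) auto
    then show "0 \<le> real m * s - 1" by simp
  qed
  with m show ?thesis unfolding delta_complex_def s_def by (simp add: field_simps)
qed

lemma frame_bound_real:
  assumes m: "m \<ge> 1"
  shows "conjugation.frame_bound (\<lambda>x::real. x) m (delta_real m)"
proof -
  define c where "c = 1 / sqrt (real m + 2)"
  note c = delta_real_eq[OF m c_def]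
  define h where "h = 3 / (real m * (real m + 2))"
  have "c^2 = 1 / (real m + 2)" using c(3) m by (simp add: eq_divide_eq)
  then have hm: "h * m = 3 * c^2"
    using m by (simp add: h_def)
  show ?thesis
  proof (rule conjugation.frame_boundI[OF conjugation_real])
    fix p assume p: "1 \<le> p" "p \<le> m"
    have "real p * (real p + 2) \<le> real m * (real m + 2)" using p by (intro mult_mono) auto
    moreover have "0 < real p * (real p + 2)" using p by simp
    ultimately have "h \<le> 3 / (real p * (real p + 2))"
      unfolding h_def by (intro divide_left_mono) (auto intro: mult_pos_pos)
    with welch_bound_real[OF p(1)] show "conjugation.welch_bound (\<lambda>x::real. x) p h"
      by (rule conjugation.welch_bound_mono[OF conjugation_real])
  next
    show "h \<le> c^2 * (1 + 2 * c) \<or> m \<le> 1"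
    proof (cases "m \<le> 1")
      case False
      have "3 \<le> (1 + 2 * c) * m"
      proof (cases "m = 2")
        case True
        then show ?thesis by (simp add: c_def)
      next
        case m2: False
        have "1 * 3 \<le> (1 + 2 * c) * m"
          using c(2) m2 False by (intro mult_mono) auto
        then show ?thesis by simp
      qed
      then have "h * m \<le> c^2 * (1 + 2 * c) * m"
        unfolding hm using mult_left_mono[of 3 "(1 + 2 * c) * m" "c^2"] by (simp add: mult_ac)
      with m show ?thesis using mult_right_le_imp_le[of h "real m" "c^2 * (1 + 2 * c)"] by simp
    qed simp
    have "(c^2 * (1 + 2 * c) - h) * m + (1 + 2 * c + 3 * c^2)
       = (c^2 * (real m + 2) - 2 * c^2) * (1 + 2 * c) - h * m + (1 + 2 * c + 3 * c^2)"
      by (simp add: algebra_simps)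
    also have "\<dots> = 2 * (1 + c) * ((1 - c) * (1 + 2 * c))"
      unfolding c(3) hm by (simp add: algebra_simps power2_eq_square)
    also have "\<dots> = 2 * c * (1 + c)^2 * delta_real m"
      unfolding c(1)[symmetric] by (simp add: power2_eq_square mult_ac)
    finally show "(c^2 * (1 + 2 * c) - h) * m + (1 + 2 * c + 3 * c^2) \<le> 2 * c * (1 + c)^2 * delta_real m"
      by simp
  qed (use c delta_real_ge_1[OF m] in auto)
qed

lemma frame_bound_complex:
  assumes m: "m \<ge> 1"
  shows "conjugation.frame_bound cnj m (delta_complex m)"
proof -
  define c where "c = 1 / sqrt (real m + 1)"
  note c = delta_complex_eq[OF m c_def]
  define h where "h = 2 / (real m * (real m + 1))"
  have "c^2 = 1 / (real m + 1)" using c(3) m by (simp add: eq_divide_eq)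
  then have hm: "h * m = 2 * c^2"
    using m by (simp add: h_def)
  show ?thesis
  proof (rule conjugation.frame_boundI[OF conjugation_complex])
    fix p assume p: "1 \<le> p" "p \<le> m"
    have "real p * (real p + 1) \<le> real m * (real m + 1)" using p by (intro mult_mono) auto
    moreover have "0 < real p * (real p + 1)" using p by simp
    ultimately have "h \<le> 2 / (real p * (real p + 1))"
      unfolding h_def by (intro divide_left_mono) (auto intro: mult_pos_pos)
    with welch_bound_complex[OF p(1)] show "conjugation.welch_bound cnj p h"
      by (rule conjugation.welch_bound_mono[OF conjugation_complex])
  next
    show "h \<le> c^2 * (1 + 2 * c) \<or> m \<le> 1"
    proof (cases "m \<le> 1")
      case False
      have "1 * 2 \<le> (1 + 2 * c) * m"
        using c(2) False by (intro mult_mono) auto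
      then have "h * m \<le> c^2 * (1 + 2 * c) * m"
        unfolding hm using mult_left_mono[of 2 "(1 + 2 * c) * m" "c^2"] by (simp add: mult_ac)
      with m show ?thesis using mult_right_le_imp_le[of h "real m" "c^2 * (1 + 2 * c)"] by simp
    qed simp
    have "(c^2 * (1 + 2 * c) - h) * m + (1 + 2 * c + 3 * c^2)
       = (c^2 * (real m + 1) - c^2) * (1 + 2 * c) - h * m + (1 + 2 * c + 3 * c^2)"
      by (simp add: algebra_simps)
    also have "\<dots> = 2 * (1 + c) * (1 + c - c^2)"
      unfolding c(3) hm by (simp add: algebra_simps power2_eq_square)
    also have "\<dots> = 2 * c * (1 + c)^2 * delta_complex m"
      unfolding c(1)[symmetric] by (simp add: power2_eq_square mult_ac)
    finally show "(c^2 * (1 + 2 * c) - h) * m + (1 + 2 * c + 3 * c^2) \<le> 2 * c * (1 + c)^2 * delta_complex m"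
      by simp
  qed (use c delta_complex_ge_1[OF m] in auto)
qed

section \<open>Products of matrices and the joint spectral radius\<close>

lemma norm_matrix_vector_le:
  fixes A :: "'a::real_normed_field ^ 'n ^ 'm"
  shows "norm (A *v x) \<le> norm A * norm x"
proof -
  have "norm ((A *v x) $ i) \<le> norm (A $ i) * norm x" for i
  proof -
    have "norm ((A *v x) $ i) \<le> (\<Sum>j\<in>UNIV. \<bar>norm (A $ i $ j)\<bar> * \<bar>norm (x $ j)\<bar>)"
      unfolding matrix_vector_mult_def vec_lambda_beta
      by (rule order.trans[OF norm_sum]) (simp add: norm_mult)
    also have "\<dots> \<le> norm (A $ i) * norm x"
      unfolding norm_vec_def by (rule L2_set_mult_ineq)
    finally show ?thesis .
  qed
  then have "norm (A *v x) \<le> L2_set (\<lambda>i. norm x * norm (A $ i)) UNIV"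
    unfolding norm_vec_def[of "A *v x"] by (intro L2_set_mono) (auto simp: mult.commute)
  also have "\<dots> = norm A * norm x"
    by (simp add: L2_set_right_distrib norm_vec_def mult.commute)
  finally show ?thesis .
qed

lemma norm_le_spectral_norm:
  fixes A :: "'a::{real_normed_field,euclidean_space} ^ 'n ^ 'n"
  shows "norm (A *v x) \<le> spectral_norm A * norm x"
  unfolding spectral_norm_def by (rule onorm) simp

lemma spectral_norm_le:
  fixes A :: "'a::{real_normed_field,euclidean_space} ^ 'n ^ 'n"
  assumes "\<And>x. norm (A *v x) \<le> b * norm x"
  shows "spectral_norm A \<le> b"
  unfolding spectral_norm_def by (rule onorm_le) (use assms in auto)

lemma spectral_norm_nonneg:
  fixes A :: "'a::{real_normed_field,euclidean_space} ^ 'n ^ 'n"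
  shows "0 \<le> spectral_norm A"
  unfolding spectral_norm_def by (rule onorm_pos_le) simp

lemma spectral_norm_mult:
  fixes A B :: "'a::{real_normed_field,euclidean_space} ^ 'n ^ 'n"
  shows "spectral_norm (A ** B) \<le> spectral_norm A * spectral_norm B"
proof (rule spectral_norm_le)
  fix x
  have "norm (A ** B *v x) \<le> spectral_norm A * norm (B *v x)"
    by (simp add: norm_le_spectral_norm flip: matrix_vector_mul_assoc)
  also have "\<dots> \<le> spectral_norm A * (spectral_norm B * norm x)"
    by (intro mult_left_mono norm_le_spectral_norm spectral_norm_nonneg)
  finally show "norm (A ** B *v x) \<le> spectral_norm A * spectral_norm B * norm x"
    by (simp add: mult.assoc)
qed

lemma products_of_length_0 [simp]: "products_of_length M 0 = {mat 1}"
  by (auto simp: products_of_length_def)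

lemma matrix_product_cong: "(\<And>s. s < t \<Longrightarrow> A s = B s) \<Longrightarrow> matrix_product A t = matrix_product B t"
  by (induction t) auto

lemma products_of_length_Suc:
  "products_of_length M (Suc t) = {A ** S | A S. A \<in> M \<and> S \<in> products_of_length M t}"
proof (intro equalityI subsetI)
  fix X assume "X \<in> products_of_length M (Suc t)"
  then obtain A where A: "\<forall>s<Suc t. A s \<in> M" "X = A t ** matrix_product A t"
    by (auto simp: products_of_length_def)
  then have "matrix_product A t \<in> products_of_length M t"
    by (auto simp: products_of_length_def)
  with A show "X \<in> {A ** S | A S. A \<in> M \<and> S \<in> products_of_length M t}" by blast
next
  fix X assume "X \<in> {A ** S | A S. A \<in> M \<and> S \<in> products_of_length M t}"
  then obtain A B where A: "A \<in> M" "\<forall>s<t. B s \<in> M" "X = A ** matrix_product B t"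
    by (auto simp: products_of_length_def)
  have "matrix_product (B(t := A)) t = matrix_product B t"
    by (rule matrix_product_cong) auto
  with A have "X = matrix_product (B(t := A)) (Suc t)" "\<forall>s<Suc t. (B(t := A)) s \<in> M"
    by (auto simp: less_Suc_eq)
  then show "X \<in> products_of_length M (Suc t)"
    unfolding products_of_length_def by blast
qed

lemma products_of_length_add:
  "products_of_length M (s + t) =
    {R ** S | R S. R \<in> products_of_length M s \<and> S \<in> products_of_length M t}"
proof (induction s)
  case (Suc s)
  have "products_of_length M (Suc s + t) =
     {A ** (R ** S) | A R S. A \<in> M \<and> R \<in> products_of_length M s \<and> S \<in> products_of_length M t}"
    unfolding add_Suc products_of_length_Suc Suc.IH by blast
  also have "\<dots> = {R ** S | R S. R \<in> products_of_length M (Suc s) \<and> S \<in> products_of_length M t}"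
    unfolding products_of_length_Suc by (auto simp: matrix_mul_assoc)
  finally show ?case .
qed auto

lemma products_of_length_mult:
  "R \<in> products_of_length M s \<Longrightarrow> S \<in> products_of_length M t \<Longrightarrow> R ** S \<in> products_of_length M (s + t)"
  unfolding products_of_length_add by blast

lemma products_of_length_SucI:
  "A \<in> M \<Longrightarrow> S \<in> products_of_length M t \<Longrightarrow> A ** S \<in> products_of_length M (Suc t)"
  unfolding products_of_length_Suc by blast

lemma products_of_length_SucE:
  assumes "X \<in> products_of_length M (Suc t)"
  obtains A S where "A \<in> M" "S \<in> products_of_length M t" "X = A ** S"
  using assms unfolding products_of_length_Suc by blast

lemma products_of_length_1: "A \<in> M \<Longrightarrow> A \<in> products_of_length M 1"
  using products_of_length_SucI[of A M "mat 1" 0] by simp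

lemma products_of_length_SucI':
  assumes "A \<in> M" "S \<in> products_of_length M t"
  shows "S ** A \<in> products_of_length M (Suc t)"
  using products_of_length_mult[OF assms(2) products_of_length_1[OF assms(1)]] by simp

lemma products_of_length_nonempty: "M \<noteq> {} \<Longrightarrow> products_of_length M t \<noteq> {}"
  by (induction t) (auto simp: products_of_length_Suc)

text \<open>
  Fekete's lemma for submultiplicative sequences. The limit is the infimum of the roots. The last
  two conclusions are the two ways in which the limit controls the sequence itself.
\<close>

lemma fekete_root:
  fixes a :: "nat \<Rightarrow> real"
  assumes a0: "\<And>t. 0 \<le> a t" and sub: "\<And>s t. a (s + t) \<le> a s * a t"
  obtains L where "(\<lambda>t. root t (a t)) \<longlonglongrightarrow> L" "0 \<le> L" "\<And>t. 0 < t \<Longrightarrow> L ^ t \<le> a t"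
    "\<And>r. L < r \<Longrightarrow> \<exists>K>0. \<forall>t. a t \<le> K * r ^ t"
proof
  define L where "L = (INF n\<in>{1..}. root n (a n))"
  have bdd: "bdd_below ((\<lambda>n. root n (a n)) ` {1..})"
    by (rule bdd_belowI[of _ 0]) (auto simp: a0 real_root_ge_zero)
  show L0: "0 \<le> L" unfolding L_def
    by (rule cINF_greatest) (auto simp: a0 real_root_ge_zero)
  have le_root: "L \<le> root t (a t)" if "0 < t" for t
    unfolding L_def by (rule cINF_lower[OF bdd]) (use that in auto)
  show "L ^ t \<le> a t" if "0 < t" for t
    using power_mono[OF le_root[OF that] L0, of t] that a0 by simp
  show growth: "\<exists>K>0. \<forall>t. a t \<le> K * r ^ t" if "L < r" for r
  proof -
    have r: "r > 0" using that L0 by simp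
    have "\<exists>n\<in>{1..}. root n (a n) < r"
      using that bdd unfolding L_def by (subst (asm) cINF_less_iff) auto
    then obtain n where n: "n \<ge> 1" "root n (a n) < r" by auto
    have an: "a n \<le> r ^ n"
      using power_mono[of "root n (a n)" r n] n a0 by (simp add: real_root_ge_zero)
    define K where "K = 1 + (\<Sum>s<n. a s / r ^ s)"
    have K0: "K > 0" unfolding K_def using a0 r by (auto intro!: add_pos_nonneg sum_nonneg)
    have as: "a s \<le> K * r ^ s" if "s < n" for s
    proof -
      have "a s / r ^ s \<le> (\<Sum>s<n. a s / r ^ s)"
        by (rule member_le_sum) (use that a0 r in auto)
      then show ?thesis using r by (simp add: K_def field_simps add_increasing)
    qed
    \<comment> \<open>Division with remainder by an \<open>n\<close> with \<open>a n \<le> r\<^sup>n\<close>; the constant \<open>K\<close> absorbs the remainders.\<close>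
    have "a (q * n + s) \<le> K * r ^ (q * n + s)" if "s < n" for q s
    proof (induction q)
      case (Suc q)
      have "a (Suc q * n + s) \<le> a n * a (q * n + s)"
        using sub[of n "q * n + s"] by (simp add: add.assoc)
      also have "\<dots> \<le> r ^ n * (K * r ^ (q * n + s))"
        using an Suc a0 r by (intro mult_mono) auto
      finally show ?case by (simp add: power_add mult_ac)
    qed (use as that in simp)
    from this[of "t mod n" "t div n" for t] n(1) have "\<forall>t. a t \<le> K * r ^ t"
      by simp
    with K0 show ?thesis by blast
  qed
  show "(\<lambda>t. root t (a t)) \<longlonglongrightarrow> L"
  proof (rule order_tendstoI)
    fix y assume "y < L"
    then show "\<forall>\<^sub>F t in sequentially. y < root t (a t)"
      using le_root by (intro eventually_sequentiallyI[of 1]) (auto intro: less_le_trans)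
  next
    fix y assume "L < y"
    then obtain r where r: "L < r" "r < y" using dense by blast
    then obtain K where K: "K > 0" "\<And>t. a t \<le> K * r ^ t" using growth by blast
    have r0: "r > 0" using r L0 by simp
    have "(\<lambda>t. root t K * r) \<longlonglongrightarrow> 1 * r"
      by (intro tendsto_mult LIMSEQ_root_const K tendsto_const)
    then have "\<forall>\<^sub>F t in sequentially. root t K * r < y"
      using r by (intro order_tendstoD) auto
    moreover have "\<forall>\<^sub>F t in sequentially. root t (a t) \<le> root t K * r"
    proof (rule eventually_sequentiallyI[of 1])
      fix t :: nat assume t: "t \<ge> 1"
      then have "root t (a t) \<le> root t (K * r ^ t)" using K by simp
      also have "\<dots> = root t K * r" using t r0 by (simp add: real_root_mult real_root_power_cancel)
      finally show "root t (a t) \<le> root t K * r" .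
    qed
    ultimately show "\<forall>\<^sub>F t in sequentially. root t (a t) < y"
      by eventually_elim simp
  qed
qed

context
  fixes M :: "('a::{real_normed_field,euclidean_space} ^ 'n ^ 'n) set"
  assumes M_ne: "M \<noteq> {}" and M_bdd: "bounded M"
begin

definition "product_growth t = (SUP S\<in>products_of_length M t. spectral_norm S)"

lemma spectral_norm_le_product_growth:
  assumes "S \<in> products_of_length M t"
  shows "spectral_norm S \<le> product_growth t"
proof -
  obtain C where C: "\<And>A. A \<in> M \<Longrightarrow> norm A \<le> C" using M_bdd bounded_iff by blast
  have sC: "spectral_norm A \<le> C" if "A \<in> M" for A
  proof -
    have "norm A * norm x \<le> C * norm x" for x :: "'a ^ 'n"
      using C[OF that] by (rule mult_right_mono) simp
    then show ?thesis
      by (intro spectral_norm_le order.trans[OF norm_matrix_vector_le])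
  qed
  then have C0: "C \<ge> 0" using M_ne spectral_norm_nonneg order_trans by blast
  have "spectral_norm S \<le> C ^ t" if "S \<in> products_of_length M t" for S t
    using that
  proof (induction t arbitrary: S)
    case 0
    then show ?case by (auto intro: spectral_norm_le)
  next
    case (Suc t)
    then obtain A R where "A \<in> M" "R \<in> products_of_length M t" "S = A ** R"
      by (elim products_of_length_SucE)
    then have "spectral_norm S \<le> spectral_norm A * spectral_norm R"
      by (simp add: spectral_norm_mult)
    also have "\<dots> \<le> C * C ^ t"
      using sC[OF \<open>A \<in> M\<close>] Suc.IH[OF \<open>R \<in> _\<close>] C0 by (intro mult_mono spectral_norm_nonneg) auto
    finally show ?case by simp
  qed
  then show ?thesis
    unfolding product_growth_def using assms by (intro cSUP_upper bdd_aboveI) auto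
qed

lemma product_growth_le:
  assumes "\<And>S. S \<in> products_of_length M t \<Longrightarrow> spectral_norm S \<le> b"
  shows "product_growth t \<le> b"
  unfolding product_growth_def
  using products_of_length_nonempty[OF M_ne] assms by (rule cSUP_least)

lemma product_growth_nonneg: "0 \<le> product_growth t"
proof -
  obtain S where "S \<in> products_of_length M t"
    using products_of_length_nonempty[OF M_ne] by blast
  from spectral_norm_le_product_growth[OF this] show ?thesis
    using spectral_norm_nonneg order_trans by blast
qed

lemma root_product_growth_limit:
  obtains "(\<lambda>t. root t (product_growth t)) \<longlonglongrightarrow> joint_spectral_radius M"
    "0 \<le> joint_spectral_radius M"
    "\<And>t. 0 < t \<Longrightarrow> joint_spectral_radius M ^ t \<le> product_growth t"
    "\<And>r. joint_spectral_radius M < r \<Longrightarrow> \<exists>K>0. \<forall>t. product_growth t \<le> K * r ^ t"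
proof -
  have "product_growth (s + t) \<le> product_growth s * product_growth t" for s t
  proof (rule product_growth_le)
    fix X assume "X \<in> products_of_length M (s + t)"
    then obtain R S where "R \<in> products_of_length M s" "S \<in> products_of_length M t" "X = R ** S"
      unfolding products_of_length_add by blast
    then show "spectral_norm X \<le> product_growth s * product_growth t"
      by (metis spectral_norm_le_product_growth mult_mono order.trans product_growth_nonneg
          spectral_norm_mult spectral_norm_nonneg)
  qed
  from fekete_root[of product_growth, OF product_growth_nonneg this] obtain L where
    L: "(\<lambda>t. root t (product_growth t)) \<longlonglongrightarrow> L" "0 \<le> L"
      "\<And>t. 0 < t \<Longrightarrow> L ^ t \<le> product_growth t"
      "\<And>r. L < r \<Longrightarrow> \<exists>K>0. \<forall>t. product_growth t \<le> K * r ^ t" by blast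
  moreover have "joint_spectral_radius M = L"
    unfolding joint_spectral_radius_def using L(1) by (intro limI) (simp add: product_growth_def)
  ultimately show ?thesis using that by simp
qed

lemma joint_spectral_radius_nonneg: "0 \<le> joint_spectral_radius M"
  using root_product_growth_limit by blast

lemma product_bound:
  assumes "joint_spectral_radius M < r"
  obtains K where "K > 0" "\<And>t S x. S \<in> products_of_length M t \<Longrightarrow> norm (S *v x) \<le> K * r ^ t * norm x"
proof -
  obtain K where K: "K > 0" "\<And>t. product_growth t \<le> K * r ^ t"
    using root_product_growth_limit assms by metis
  have "norm (S *v x) \<le> K * r ^ t * norm x" if "S \<in> products_of_length M t" for t S x
  proof -
    have "spectral_norm S \<le> K * r ^ t"
      using spectral_norm_le_product_growth[OF that] K(2)[of t] by simp
    then show ?thesis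
      using norm_le_spectral_norm[of S x] mult_right_mono[of "spectral_norm S" "K * r ^ t" "norm x"] by simp
  qed
  with K(1) show ?thesis by (rule that)
qed

text \<open>
  The factor \<open>t + 1\<close> is what block triangular products need; its roots tend to 1.
\<close>

lemma joint_spectral_radius_le:
  assumes K: "\<And>t S x. S \<in> products_of_length M t \<Longrightarrow> norm (S *v x) \<le> K * (real t + 1) * r ^ t * norm x"
    and r: "r \<ge> 0"
  shows "joint_spectral_radius M \<le> r"
proof -
  define K' where "K' = max K 1"
  have K': "K' > 0" "K \<le> K'" unfolding K'_def by auto
  have lim: "(\<lambda>t. root t (product_growth t)) \<longlonglongrightarrow> joint_spectral_radius M"
    using root_product_growth_limit by blast
  have "(\<lambda>t. root t (2 * K') * root t (real t) * r) \<longlonglongrightarrow> 1 * 1 * r"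
    using K' by (intro tendsto_mult LIMSEQ_root_const LIMSEQ_root tendsto_const) auto
  then have "(\<lambda>t. root t (2 * K') * root t (real t) * r) \<longlonglongrightarrow> r" by simp
  from lim this show ?thesis
  proof (rule LIMSEQ_le)
    have "root t (product_growth t) \<le> root t (2 * K') * root t (real t) * r" if t: "t \<ge> 1" for t
    proof -
      have "product_growth t \<le> 2 * K' * real t * r ^ t"
      proof (rule product_growth_le, rule spectral_norm_le)
        fix S and x :: "'a ^ 'n" assume "S \<in> products_of_length M t"
        then have "norm (S *v x) \<le> K * (real t + 1) * (r ^ t * norm x)"
          using K by (simp add: mult_ac)
        also have "\<dots> \<le> (K' * (real t + real t)) * (r ^ t * norm x)"
          using K' t r by (intro mult_right_mono mult_mono) auto
        finally show "norm (S *v x) \<le> 2 * K' * real t * r ^ t * norm x" by (simp add: mult_ac)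
      qed
      then have "root t (product_growth t) \<le> root t (2 * K' * real t * r ^ t)" using t by simp
      also have "\<dots> = root t (2 * K') * root t (real t) * r"
        using t r by (simp add: real_root_mult real_root_power_cancel)
      finally show ?thesis .
    qed
    then show "\<exists>N. \<forall>n\<ge>N. root n (product_growth n) \<le> root n (2 * K') * root n (real n) * r"
      by blast
  qed
qed

text \<open>
  Growth along some arbitrarily long products is enough, because the joint spectral radius is a limit
  and not only an upper limit.
\<close>

lemma joint_spectral_radius_ge:
  assumes c: "0 < c"
    and "\<And>N. \<exists>t\<ge>N. \<exists>S\<in>products_of_length M t. \<exists>x. x \<noteq> 0 \<and> c * \<eta> ^ t * norm x \<le> norm (S *v x)"
  shows "\<eta> \<le> joint_spectral_radius M"
proof (rule ccontr)
  assume *: "\<not> \<eta> \<le> joint_spectral_radius M"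
  define \<rho> where "\<rho> = joint_spectral_radius M"
  obtain r where r: "\<rho> < r" "r < \<eta>" using * dense unfolding \<rho>_def by (metis not_le)
  then obtain K where K: "K > 0" "\<And>t S x. S \<in> products_of_length M t \<Longrightarrow> norm (S *v x) \<le> K * r ^ t * norm x"
    using product_bound unfolding \<rho>_def by blast
  have r0: "r > 0" using joint_spectral_radius_nonneg r unfolding \<rho>_def by simp
  then have "\<eta> / r > 1" using r by simp
  then obtain N where N: "K / c < (\<eta> / r) ^ N" using real_arch_pow by blast
  obtain t S x where t: "t \<ge> N" "S \<in> products_of_length M t" "x \<noteq> 0" "c * \<eta> ^ t * norm x \<le> norm (S *v x)"
    using assms(2) by blast
  then have "c * \<eta> ^ t * norm x \<le> K * r ^ t * norm x" using K(2) order_trans by blast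
  then have "(\<eta> / r) ^ t \<le> K / c" using t(3) r0 c by (simp add: power_divide field_simps)
  moreover have "(\<eta> / r) ^ N \<le> (\<eta> / r) ^ t"
    using t(1) \<open>\<eta> / r > 1\<close> by (intro power_increasing) auto
  ultimately show False using N by simp
qed

end

section \<open>Projections of small norm\<close>

text \<open>
  The bilinear pairing, without conjugation: it identifies vectors with linear functionals
  over the scalar field.
\<close>

definition dotp :: "'a::comm_semiring_1 ^ 'n \<Rightarrow> 'a ^ 'n \<Rightarrow> 'a" where
  "dotp f y = (\<Sum>i\<in>UNIV. f $ i * y $ i)"

lemma dotp_add_right: "dotp f (x + y) = dotp f x + dotp f y"
  by (simp add: dotp_def distrib_left sum.distrib)

lemma dotp_diff_right: "dotp f (x - y) = dotp f x - dotp (f :: 'a::comm_ring_1 ^ 'n) y"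
  by (simp add: dotp_def right_diff_distrib sum_subtractf)

lemma dotp_scale_right: "dotp f (c *s x) = c * dotp f x"
  by (simp add: dotp_def sum_distrib_left mult_ac)

lemma dotp_scale_left: "dotp (c *s f) x = c * dotp f x"
  by (simp add: dotp_def sum_distrib_left mult_ac)

lemma dotp_0_right [simp]: "dotp f 0 = 0"
  by (simp add: dotp_def)

lemma dotp_sum_right: "dotp f (sum g S) = (\<Sum>i\<in>S. dotp f (g i))"
  by (induction S rule: infinite_finite_induct) (auto simp: dotp_add_right)

lemma dotp_axis_right [simp]: "dotp f (axis i c) = f $ i * c"
proof -
  have "dotp f (axis i c) = (\<Sum>j\<in>UNIV. if j = i then f $ j * c else 0)"
    unfolding dotp_def axis_def by (intro sum.cong) auto
  then show ?thesis by simp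
qed

lemma dotp_commute: "dotp f y = dotp y f"
  by (simp add: dotp_def mult.commute)

lemma norm_dotp_le:
  fixes f :: "'a::real_normed_field ^ 'n"
  shows "norm (dotp f y) \<le> norm f * norm y"
proof -
  have "norm (dotp f y) \<le> (\<Sum>j\<in>UNIV. \<bar>norm (f $ j)\<bar> * \<bar>norm (y $ j)\<bar>)"
    unfolding dotp_def by (rule order.trans[OF norm_sum]) (simp add: norm_mult)
  also have "\<dots> \<le> norm f * norm y"
    unfolding norm_vec_def by (rule L2_set_mult_ineq)
  finally show ?thesis .
qed

context conjugation
begin

text \<open>
  Gram--Schmidt for the semidefinite form \<open>H\<close>. A maximal orthonormal system exists because
  orthonormal vectors are independent. By maximality the part of \<open>x\<close> orthogonal to it is null for \<open>H\<close>, hence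
  it is annihilated by all the functionals \<open>\<phi>\<^sub>k\<close>; for them \<open>x\<close> can be
  replaced by its expansion.
\<close>

lemma orthonormal_expansion:
  fixes \<phi> :: "nat \<Rightarrow> 'a ^ 'm"
  assumes fin: "finite K"
  defines "H \<equiv> \<lambda>x y. \<Sum>k\<in>K. dotp (\<phi> k) x * cj (dotp (\<phi> k) y)"
  obtains p and e :: "nat \<Rightarrow> 'a ^ 'm" where "p \<le> CARD('m)"
    "\<And>i j. i < p \<Longrightarrow> j < p \<Longrightarrow> H (e i) (e j) = of_bool (i = j)"
    "\<And>x k. k \<in> K \<Longrightarrow> dotp (\<phi> k) x = (\<Sum>i<p. H x (e i) * dotp (\<phi> k) (e i))"
proof -
  have H_diff: "H (x - y) z = H x z - H y z" for x y z
    by (simp add: H_def dotp_diff_right left_diff_distrib sum_subtractf)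
  have H_scale: "H (c *s x) z = c * H x z" for c x z
    by (simp add: H_def dotp_scale_right sum_distrib_left mult_ac)
  have H_sum: "H (sum g S) z = (\<Sum>i\<in>S. H (g i) z)" for g :: "nat \<Rightarrow> _" and S z
    unfolding H_def dotp_sum_right sum_distrib_right by (rule sum.swap)
  have H_0: "H 0 z = 0" for z by (simp add: H_def)
  have H_cj: "cj (H x y) = H y x" for x y
    unfolding H_def cj_sum by (intro sum.cong refl) (simp add: cj_mult mult.commute)
  have H_self: "H x x = of_real (\<Sum>k\<in>K. (norm (dotp (\<phi> k) x))^2)" for x
    by (simp only: H_def mult_cj of_real_sum)
  define orth where "orth p \<longleftrightarrow> (\<exists>e. \<forall>i<p. \<forall>j<p. H (e i) (e j) = of_bool (i = j))" for p :: nat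
  have le: "p \<le> CARD('m)" if orth: "orth p" for p
  proof -
    obtain e where e: "\<And>i j. i < p \<Longrightarrow> j < p \<Longrightarrow> H (e i) (e j) = of_bool (i = j)"
      using orth unfolding orth_def by blast
    have inj: "inj_on e {..<p}"
    proof (rule inj_onI)
      fix i j assume *: "i \<in> {..<p}" "j \<in> {..<p}" "e i = e j"
      then have "H (e i) (e j) = 1" using e[of i i] by simp
      with * e[of i j] show "i = j" by (simp split: if_splits)
    qed
    have "vec.independent (e ` {..<p})"
    proof (rule vec.independent_if_scalars_zero)
      fix f x assume s: "(\<Sum>x\<in>e ` {..<p}. f x *s x) = 0" and "x \<in> e ` {..<p}"
      then obtain j where j: "j < p" "x = e j" by auto
      have "0 = H (\<Sum>i<p. f (e i) *s e i) (e j)"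
        using s by (simp add: sum.reindex[OF inj] H_0)
      also have "\<dots> = (\<Sum>i<p. f (e i) * of_bool (i = j))"
        unfolding H_sum H_scale using j e by simp
      also have "\<dots> = f x" using j by (simp add: of_bool_def if_distrib cong: if_cong)
      finally show "f x = 0" by simp
    qed simp
    then have "card (e ` {..<p}) \<le> vec.dim (UNIV :: ('a ^ 'm) set)"
      by (intro vec.independent_card_le_dim) auto
    then show ?thesis using inj by (simp add: card_image card_cart_basis)
  qed
  have "orth 0" by (simp add: orth_def)
  then obtain p where p: "orth p" "\<And>q. orth q \<Longrightarrow> q \<le> p"
    using ex_has_greatest_nat[of orth 0 "\<lambda>n. n" "Suc CARD('m)"] le by (auto simp: less_Suc_eq_le)
  then obtain e where e: "\<And>i j. i < p \<Longrightarrow> j < p \<Longrightarrow> H (e i) (e j) = of_bool (i = j)"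
    unfolding orth_def by blast
  have "dotp (\<phi> k) x = (\<Sum>i<p. H x (e i) * dotp (\<phi> k) (e i))" if k: "k \<in> K" for x k
  proof -
    define r where "r = x - (\<Sum>i<p. H x (e i) *s e i)"
    have re: "H r (e j) = 0" if "j < p" for j
    proof -
      have "H r (e j) = H x (e j) - (\<Sum>i<p. H x (e i) * of_bool (i = j))"
        unfolding r_def H_diff H_sum H_scale using that e by simp
      also have "(\<Sum>i<p. H x (e i) * of_bool (i = j)) = H x (e j)"
        using that by (simp add: of_bool_def if_distrib cong: if_cong)
      finally show ?thesis by simp
    qed
    have er: "H (e j) r = 0" if "j < p" for j
      using re[OF that] H_cj[of r "e j"] by simp
    define q where "q = (\<Sum>k\<in>K. (norm (dotp (\<phi> k) r))^2)"
    have "q \<ge> 0" unfolding q_def by (simp add: sum_nonneg)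
    have "q = 0"
    proof (rule ccontr)
      assume "q \<noteq> 0"
      with \<open>q \<ge> 0\<close> have q: "q > 0" by simp
      define c where "c = (of_real (1 / sqrt q) :: 'a)"
      have cc: "cj c = c" unfolding c_def by (simp only: cj_of_real)
      have H_scale_r: "H y (c *s r) = c * H y r" for y
        using H_cj[of "c *s r" y] H_cj[of r y] by (simp add: H_scale cj_mult cc)
      have "H (c *s r) (c *s r) = c * (c * H r r)"
        by (simp only: H_scale H_scale_r)
      also have "\<dots> = of_real (1 / sqrt q * (1 / sqrt q) * q)"
        unfolding H_self[of r] q_def[symmetric] c_def by (simp only: of_real_mult mult.assoc)
      also have "1 / sqrt q * (1 / sqrt q) * q = 1" using q by simp
      finally have one: "H (c *s r) (c *s r) = 1" by simp
      have "\<forall>i<Suc p. \<forall>j<Suc p. H ((e(p := c *s r)) i) ((e(p := c *s r)) j) = of_bool (i = j)"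
        using e one re er by (auto simp: less_Suc_eq H_scale H_scale_r)
      then have "orth (Suc p)" unfolding orth_def by blast
      with p(2) show False by fastforce
    qed
    then have "dotp (\<phi> k) r = 0"
      unfolding q_def using k fin by (simp add: sum_nonneg_eq_0_iff)
    then show ?thesis
      unfolding r_def by (simp add: dotp_diff_right dotp_sum_right dotp_scale_right)
  qed
  with that[OF le[OF p(1)] e] show ?thesis by blast
qed

definition polar :: "('a ^ 'n) set \<Rightarrow> ('a ^ 'n) set" where
  "polar F = {y. \<forall>f\<in>F. norm (dotp f y) \<le> 1}"

text \<open>
  The operator \<open>x \<mapsto> f(x) y\<close> on the coordinate subspace with index set \<open>range e\<close>, as a matrix.
\<close>

definition restricted_dyad :: "('m \<Rightarrow> 'd) \<Rightarrow> 'a ^ 'd \<Rightarrow> 'a ^ 'd \<Rightarrow> 'a ^ 'm ^ 'd" where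
  "restricted_dyad e y f = (\<chi> i j. y $ i * f $ e j)"

definition restricted_dyads :: "('m \<Rightarrow> 'd) \<Rightarrow> ('a ^ 'd) set \<Rightarrow> ('a ^ 'm ^ 'd) set" where
  "restricted_dyads e F = {restricted_dyad e y f | y f. y \<in> polar F \<and> f \<in> F}"

text \<open>
  The trace of \<open>E = \<Sum>\<^sub>k t\<^sub>k y\<^sub>k \<otimes> f\<^sub>k\<close> is computed in the orthonormal system \<open>b'\<close> of the form
  \<open>H(x,y) = \<Sum>\<^sub>k t\<^sub>k f\<^sub>k(x) (f\<^sub>k(y))\<^sup>*\<close>. The coefficients of the expansion involve only the functionals \<open>f\<^sub>l\<close>, and
  these may be applied to \<open>E b'\<^sub>i\<close> on the whole space because the range of \<open>E\<close> lies in the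
  subspace. The outcome is \<open>\<Sum>\<^sub>k\<^sub>l s\<^sub>k s\<^sub>l f\<^sub>l(y\<^sub>k) \<langle>u\<^sub>k, u\<^sub>l\<rangle>\<close>, where \<open>s\<^sub>k\<^sup>2 = t\<^sub>k\<close> and the \<open>u\<^sub>k\<close> form a
  Parseval frame.
\<close>

lemma trace_le_frame_bound:
  fixes E :: "'a ^ 'm ^ 'd"
  assumes e: "inj e" and fb: "frame_bound CARD('m) b"
    and E: "E \<in> convex hull (restricted_dyads e F)"
    and supp: "\<And>i. i \<notin> range e \<Longrightarrow> E $ i = 0"
  shows "re (\<Sum>j\<in>UNIV. E $ e j $ j) \<le> b"
proof -
  obtain n t Z where t0: "\<forall>k\<in>{1..n::nat}. 0 \<le> t k \<and> Z k \<in> restricted_dyads e F"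
    and t1: "sum t {1..n} = 1" and EZ: "(\<Sum>k\<in>{1..n}. t k *\<^sub>R Z k) = E"
    using E unfolding convex_hull_indexed by blast
  define K where "K = {1..n}"
  have "\<exists>y f. y \<in> polar F \<and> f \<in> F \<and> Z k = restricted_dyad e y f" if "k \<in> K" for k
    using t0 that unfolding K_def restricted_dyads_def by blast
  then obtain y f where yf: "\<And>k. k \<in> K \<Longrightarrow> y k \<in> polar F" "\<And>k. k \<in> K \<Longrightarrow> f k \<in> F"
      "\<And>k. k \<in> K \<Longrightarrow> Z k = restricted_dyad e (y k) (f k)" by metis
  have fin: "finite K" by (simp add: K_def)
  have tpos: "0 \<le> t k" if "k \<in> K" for k using t0 that K_def by simp
  have E_entry: "E $ i $ j = (\<Sum>k\<in>K. of_real (t k) * (y k $ i * f k $ e j))" for i j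
  proof -
    have "E = (\<Sum>k\<in>K. t k *\<^sub>R restricted_dyad e (y k) (f k))"
      unfolding EZ[symmetric] K_def[symmetric] using yf(3) by simp
    then show ?thesis
      by (simp add: restricted_dyad_def) (simp add: scaleR_conv_of_real)
  qed
  define g where "g k = (\<chi> j. f k $ e j)" for k
  define \<phi> where "\<phi> k = of_real (sqrt (t k)) *s g k" for k
  define H where "H x y = (\<Sum>k\<in>K. dotp (\<phi> k) x * cj (dotp (\<phi> k) y))" for x y
  obtain p and b' :: "nat \<Rightarrow> 'a ^ 'm" where p: "p \<le> CARD('m)"
    and orth: "\<And>i j. i < p \<Longrightarrow> j < p \<Longrightarrow> H (b' i) (b' j) = of_bool (i = j)"
    and expand: "\<And>x k. k \<in> K \<Longrightarrow> dotp (\<phi> k) x = (\<Sum>i<p. H x (b' i) * dotp (\<phi> k) (b' i))"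
    using orthonormal_expansion[OF fin, of \<phi>, folded H_def] by metis
  define u where "u k i = dotp (\<phi> k) (b' i)" for k i
  define s where "s k = sqrt (t k)" for k
  have ss: "of_real (s k) * of_real (s k) = (of_real (t k) :: 'a)" if "k \<in> K" for k
    using tpos[OF that] unfolding s_def of_real_mult[symmetric] by simp
  have \<phi>: "dotp (\<phi> k) x = of_real (s k) * dotp (g k) x" for k x
    unfolding \<phi>_def s_def by (rule dotp_scale_left)
  have H_axis: "H (axis j 1) (b' i) = (\<Sum>l\<in>K. of_real (s l) * f l $ e j * cj (u l i))" for i j
    unfolding H_def u_def \<phi> by (simp add: g_def)
  have tr1: "(\<Sum>j\<in>UNIV. E $ e j $ j) =
      (\<Sum>i<p. \<Sum>l\<in>K. of_real (s l) * cj (u l i) * (\<Sum>k\<in>K. of_real (s k) * u k i * (\<Sum>j\<in>UNIV. f l $ e j * y k $ e j)))"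
  proof -
    have "of_real (s k) * f k $ e j = (\<Sum>i<p. H (axis j 1) (b' i) * u k i)" if "k \<in> K" for k j
      using expand[OF that, of "axis j 1"] unfolding u_def \<phi> by (simp add: g_def)
    then have *: "of_real (t k) * (y k $ e j * f k $ e j) =
      of_real (s k) * y k $ e j * (\<Sum>i<p. H (axis j 1) (b' i) * u k i)" if "k \<in> K" for k j
      using that by (simp flip: ss add: mult_ac)
    have "(\<Sum>j\<in>UNIV. E $ e j $ j) =
      (\<Sum>j\<in>UNIV. \<Sum>k\<in>K. of_real (s k) * y k $ e j * (\<Sum>i<p. H (axis j 1) (b' i) * u k i))"
      unfolding E_entry by (intro sum.cong refl *)
    also have "\<dots> = (\<Sum>j\<in>UNIV. \<Sum>k\<in>K. \<Sum>i<p. \<Sum>l\<in>K.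
       of_real (s l) * cj (u l i) * (of_real (s k) * u k i * (f l $ e j * y k $ e j)))"
      unfolding H_axis by (simp add: sum_distrib_left sum_distrib_right mult_ac)
    also have "\<dots> = (\<Sum>i<p. \<Sum>l\<in>K. \<Sum>k\<in>K. \<Sum>j\<in>UNIV.
       of_real (s l) * cj (u l i) * (of_real (s k) * u k i * (f l $ e j * y k $ e j)))"
      (is "(\<Sum>j\<in>UNIV. \<Sum>k\<in>K. \<Sum>i<p. \<Sum>l\<in>K. ?h i l k j) = _")
    proof -
      have "(\<Sum>j\<in>UNIV. \<Sum>k\<in>K. \<Sum>i<p. \<Sum>l\<in>K. ?h i l k j) = (\<Sum>j\<in>UNIV. \<Sum>i<p. \<Sum>k\<in>K. \<Sum>l\<in>K. ?h i l k j)"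
        by (rule sum.cong[OF refl], rule sum.swap)
      also have "\<dots> = (\<Sum>i<p. \<Sum>j\<in>UNIV. \<Sum>k\<in>K. \<Sum>l\<in>K. ?h i l k j)" by (rule sum.swap)
      also have "\<dots> = (\<Sum>i<p. \<Sum>j\<in>UNIV. \<Sum>l\<in>K. \<Sum>k\<in>K. ?h i l k j)"
        by (rule sum.cong[OF refl], rule sum.cong[OF refl], rule sum.swap)
      also have "\<dots> = (\<Sum>i<p. \<Sum>l\<in>K. \<Sum>j\<in>UNIV. \<Sum>k\<in>K. ?h i l k j)"
        by (rule sum.cong[OF refl], rule sum.swap)
      also have "\<dots> = (\<Sum>i<p. \<Sum>l\<in>K. \<Sum>k\<in>K. \<Sum>j\<in>UNIV. ?h i l k j)"
        by (rule sum.cong[OF refl], rule sum.cong[OF refl], rule sum.swap)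
      finally show ?thesis .
    qed
    finally show ?thesis by (simp only: sum_distrib_left)
  qed
  have inner_sum: "(\<Sum>k\<in>K. of_real (s k) * u k i * (\<Sum>j\<in>UNIV. f l $ e j * y k $ e j))
      = (\<Sum>k\<in>K. of_real (s k) * u k i * dotp (f l) (y k))" for l i
  proof -
    \<comment> \<open>The vector \<open>z\<close> is \<open>E b'\<^sub>i\<close>, so its coordinates outside the subspace vanish.\<close>
    define z where "z = (\<Sum>k\<in>K. (of_real (s k) * u k i) *s y k)"
    have z: "z $ d = (\<Sum>j\<in>UNIV. E $ d $ j * b' i $ j)" for d
    proof -
      have "z $ d = (\<Sum>k\<in>K. of_real (t k) * (\<Sum>j\<in>UNIV. f k $ e j * b' i $ j) * y k $ d)"
        unfolding z_def u_def \<phi> by (simp add: g_def dotp_def ss flip: mult.assoc)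
      also have "\<dots> = (\<Sum>k\<in>K. \<Sum>j\<in>UNIV. of_real (t k) * (y k $ d * f k $ e j) * b' i $ j)"
        by (simp add: sum_distrib_left sum_distrib_right mult_ac)
      also have "\<dots> = (\<Sum>j\<in>UNIV. \<Sum>k\<in>K. of_real (t k) * (y k $ d * f k $ e j) * b' i $ j)"
        by (rule sum.swap)
      finally show ?thesis by (simp only: E_entry sum_distrib_right)
    qed
    have z0: "z $ d = 0" if "d \<notin> range e" for d
      unfolding z supp[OF that] by simp
    have "(\<Sum>k\<in>K. of_real (s k) * u k i * dotp (f l) (y k)) = dotp (f l) z"
      unfolding z_def dotp_sum_right dotp_scale_right ..
    also have "\<dots> = (\<Sum>d\<in>range e. f l $ d * z $ d)"
      unfolding dotp_def by (rule sum.mono_neutral_right) (auto simp: z0)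
    also have "\<dots> = (\<Sum>j\<in>UNIV. f l $ e j * z $ e j)"
      by (rule sum.reindex[OF e, unfolded comp_def])
    also have "\<dots> = (\<Sum>j\<in>UNIV. \<Sum>k\<in>K. of_real (s k) * u k i * (f l $ e j * y k $ e j))"
      unfolding z_def by (simp add: sum_distrib_left mult_ac)
    also have "\<dots> = (\<Sum>k\<in>K. \<Sum>j\<in>UNIV. of_real (s k) * u k i * (f l $ e j * y k $ e j))"
      by (rule sum.swap)
    finally show ?thesis by (simp only: sum_distrib_left)
  qed
  have "(\<Sum>j\<in>UNIV. E $ e j $ j) = (\<Sum>i<p. \<Sum>l\<in>K. \<Sum>k\<in>K.
     of_real (s l * s k) * dotp (f l) (y k) * (u k i * cj (u l i)))"
    unfolding tr1 inner_sum by (simp add: sum_distrib_left mult_ac)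
  also have "\<dots> = (\<Sum>l\<in>K. \<Sum>i<p. \<Sum>k\<in>K.
     of_real (s l * s k) * dotp (f l) (y k) * (u k i * cj (u l i)))"
    by (rule sum.swap)
  also have "\<dots> = (\<Sum>l\<in>K. \<Sum>k\<in>K. \<Sum>i<p.
     of_real (s l * s k) * dotp (f l) (y k) * (u k i * cj (u l i)))"
    by (rule sum.cong[OF refl], rule sum.swap)
  also have "\<dots> = (\<Sum>l\<in>K. \<Sum>k\<in>K. of_real (s l * s k) * dotp (f l) (y k) * (\<Sum>i<p. u k i * cj (u l i)))"
    by (simp only: sum_distrib_left)
  finally have tr2: "re (\<Sum>j\<in>UNIV. E $ e j $ j) =
    (\<Sum>l\<in>K. \<Sum>k\<in>K. re (of_real (s l * s k) * dotp (f l) (y k) * (\<Sum>i<p. u k i * cj (u l i))))"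
    by (simp only: re_sum)
  also have "\<dots> \<le> (\<Sum>l\<in>K. \<Sum>k\<in>K. s k * s l * norm (\<Sum>i<p. u k i * cj (u l i)))"
  proof (intro sum_mono)
    fix l k assume "l \<in> K" "k \<in> K"
    then have s0: "0 \<le> s k * s l" using tpos unfolding s_def by simp
    have d1: "norm (dotp (f l) (y k)) \<le> 1"
      using yf(1)[OF \<open>k \<in> K\<close>] yf(2)[OF \<open>l \<in> K\<close>] unfolding polar_def by blast
    let ?w = "\<Sum>i<p. u k i * cj (u l i)"
    have "re (of_real (s l * s k) * dotp (f l) (y k) * ?w) \<le> norm (of_real (s l * s k) * dotp (f l) (y k) * ?w)"
      by (rule re_le)
    also have "\<dots> = (s k * s l) * (norm (dotp (f l) (y k)) * norm ?w)"
      using s0 by (simp only: norm_mult norm_of_real) (simp add: abs_mult[symmetric] mult_ac)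
    also have "\<dots> \<le> (s k * s l) * (1 * norm ?w)"
      using d1 s0 by (intro mult_left_mono mult_right_mono) auto
    finally show "re (of_real (s l * s k) * dotp (f l) (y k) * ?w) \<le> s k * s l * norm ?w" by simp
  qed
  also have "\<dots> = (\<Sum>k\<in>K. \<Sum>l\<in>K. s k * s l * norm (\<Sum>i<p. u k i * cj (u l i)))"
    by (rule sum.swap)
  also have "\<dots> \<le> b"
  proof -
    have 1: "\<forall>i<p. \<forall>j<p. (\<Sum>k\<in>K. u k i * cj (u k j)) = of_bool (i = j)"
      using orth unfolding H_def u_def by blast
    have 2: "\<forall>k\<in>K. 0 \<le> s k" using tpos unfolding s_def by simp
    have "(\<Sum>k\<in>K. (s k)^2) = (\<Sum>k\<in>K. t k)"
      using tpos unfolding s_def by (intro sum.cong refl) simp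
    then have 3: "(\<Sum>k\<in>K. (s k)^2) \<le> 1" using t1 K_def by simp
    from fb fin p 1 2 3 show ?thesis unfolding frame_bound_def by blast
  qed
  finally show ?thesis .
qed

end

context conjugation
begin

text \<open>
  The convex hull of the dyads is disjoint from the convex set of operators that map the subspace to
  itself and have a trace with real part above \<open>b\<close>. A separating functional \<open>a\<close> is constant on the operators
  of the subspace with a given real part of the trace, so there it is a positive multiple \<open>\<kappa>\<close> of the real part of the trace. After division
  by \<open>\<kappa>\<close> it is of the form \<open>E \<mapsto> Re (tr (P E))\<close>, where \<open>P\<close> is the identity on the subspace,
  and its bound on the dyads is the bound on the norm of \<open>P\<close>.
\<close>

lemma exists_bounded_projection:
  fixes e :: "'m::finite \<Rightarrow> 'd::finite" and F :: "('a ^ 'd) set"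
  assumes e: "inj e" and fb: "frame_bound CARD('m) b"
    and F_ball: "\<And>f. norm f \<le> 1 \<Longrightarrow> f \<in> F"
    and F_bdd: "\<And>f. f \<in> F \<Longrightarrow> norm f \<le> C"
    and F_balanced: "\<And>f c. f \<in> F \<Longrightarrow> norm c \<le> 1 \<Longrightarrow> c *s f \<in> F"
  obtains P :: "'a ^ 'd ^ 'm" where "\<And>i j. P $ i $ e j = of_bool (i = j)"
    "\<And>f y. f \<in> F \<Longrightarrow> y \<in> polar F \<Longrightarrow> norm (\<Sum>j\<in>UNIV. f $ e j * (P *v y) $ j) \<le> b"
proof -
  define KK where "KK = convex hull (restricted_dyads e F)"
  define tr where "tr E = re (\<Sum>j\<in>UNIV. E $ e j $ j)" for E :: "'a ^ 'm ^ 'd"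
  define TT where "TT = {E. (\<forall>i. i \<notin> range e \<longrightarrow> E $ i = 0) \<and> b < tr E}"
  have tr_add: "tr (X + Y) = tr X + tr Y" and tr_scale: "tr (r *\<^sub>R X) = r * tr X" for X Y r
    unfolding tr_def by (simp_all add: sum.distrib inner_add_right flip: scaleR_right.sum)
  \<comment> \<open>The elementary operators of the coordinate subspace.\<close>
  define punit where "punit i j z = (axis (e i) (axis j z) :: 'a ^ 'm ^ 'd)" for i j z
  have tr_punit: "tr (punit i j z) = (if i = j then re z else 0)" for i j z
  proof -
    have "(\<Sum>k\<in>UNIV. punit i j z $ e k $ k) = (\<Sum>k\<in>UNIV. if k = i then (if i = j then z else 0) else 0)"
      unfolding punit_def by (intro sum.cong refl) (auto simp: axis_def inj_eq[OF e])
    then show ?thesis unfolding tr_def by simp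
  qed
  have supp_punit: "d \<notin> range e \<Longrightarrow> punit i j z $ d = 0" for d i j z
    by (auto simp: punit_def axis_def)
  have zero_dyad: "0 \<in> restricted_dyads e F"
  proof -
    have "restricted_dyad e 0 0 = (0 :: 'a ^ 'm ^ 'd)" by (simp add: restricted_dyad_def vec_eq_iff)
    moreover have "0 \<in> polar F" "0 \<in> F" using F_ball[of 0] by (auto simp: polar_def)
    ultimately show ?thesis unfolding restricted_dyads_def by (metis (mono_tags, lifting) mem_Collect_eq)
  qed
  have dyad_KK: "restricted_dyad e y f \<in> KK" if "y \<in> polar F" "f \<in> F" for y f
    unfolding KK_def using that by (intro hull_inc) (auto simp: restricted_dyads_def)
  have "\<exists>a c. a \<noteq> 0 \<and> (\<forall>x\<in>KK. a \<bullet> x \<le> c) \<and> (\<forall>x\<in>TT. a \<bullet> x \<ge> c)"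
  proof (rule separating_hyperplane_sets)
    show "convex KK" unfolding KK_def by (rule convex_convex_hull)
    show "convex TT"
      unfolding convex_def TT_def mem_Collect_eq tr_add tr_scale
    proof (intro ballI allI impI conjI, goal_cases)
      case (2 X Y u v)
      then have *: "b < tr X" "b < tr Y" "0 \<le> u" "0 \<le> v" "u + v = 1" by auto
      have "b = u * b + v * b" using *(5) by (simp flip: distrib_right)
      also have "\<dots> < u * tr X + v * tr Y"
      proof (cases "u = 0")
        case True
        then show ?thesis using * by simp
      next
        case False
        then have "u * b < u * tr X" "v * b \<le> v * tr Y"
          using * by (auto intro: mult_left_mono)
        then show ?thesis by simp
      qed
      finally show ?case .
    qed auto
    show "KK \<noteq> {}" unfolding KK_def using zero_dyad by auto
    have "punit i i (of_real (b + 1)) \<in> TT" for i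
      unfolding TT_def by (auto simp: supp_punit tr_punit simp del: of_real_add)
    then show "TT \<noteq> {}" by blast
    show "KK \<inter> TT = {}"
      using trace_le_frame_bound[OF e fb] unfolding KK_def TT_def tr_def by fastforce
  qed
  then obtain a c where a: "a \<noteq> 0" and aK: "\<And>x. x \<in> KK \<Longrightarrow> a \<bullet> x \<le> c" and aT: "\<And>x. x \<in> TT \<Longrightarrow> c \<le> a \<bullet> x"
    by blast
  have a_punit: "a \<bullet> punit i j z = a $ e i $ j \<bullet> z" for i j z
    unfolding punit_def by (simp add: inner_axis)
  \<comment> \<open>The dyads span all operators, so \<open>a\<close> does not vanish on all of them; test \<open>a\<close> on a dyad
    supported at a nonzero entry of \<open>a\<close>.\<close>
  have c0: "c > 0"
  proof -
    obtain i j where aij: "a $ i $ j \<noteq> 0"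
      using a by (auto simp: vec_eq_iff)
    define C' where "C' = max C 1"
    have C': "C' \<ge> 1" "C \<le> C'" unfolding C'_def by auto
    define y where "y = (axis i (of_real (1 / C')) :: 'a ^ 'd)"
    define f where "f = (axis (e j) (a $ i $ j / of_real (norm (a $ i $ j))) :: 'a ^ 'd)"
    have "norm (dotp g y) \<le> 1" if "g \<in> F" for g
    proof -
      have "norm (g $ i) \<le> C'" using F_bdd[OF that] Finite_Cartesian_Product.norm_nth_le[of g i] C' by linarith
      then show ?thesis unfolding y_def using C' by (simp add: norm_mult norm_divide field_simps)
    qed
    then have y: "y \<in> polar F" unfolding polar_def by blast
    have "norm f \<le> 1"
    proof -
      have "norm f = norm (a $ i $ j / of_real (norm (a $ i $ j)))"
        unfolding f_def by (simp only: norm_eq_sqrt_inner inner_axis_axis) simp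
      then show ?thesis using aij by (simp add: norm_divide)
    qed
    then have "f \<in> F" by (rule F_ball)
    have "restricted_dyad e y f = axis i (axis j (of_real (1 / C') * (a $ i $ j / of_real (norm (a $ i $ j)))))"
      unfolding restricted_dyad_def y_def f_def
      by (auto simp: vec_eq_iff axis_def inj_eq[OF e])
    then have "a \<bullet> restricted_dyad e y f = a $ i $ j \<bullet> ((1 / C' / norm (a $ i $ j)) *\<^sub>R a $ i $ j)"
      by (simp add: inner_axis scaleR_conv_of_real)
    also have "\<dots> = norm (a $ i $ j) / C'"
      using aij by (simp add: dot_square_norm power2_eq_square)
    finally have "norm (a $ i $ j) / C' \<le> c"
      using aK[OF dyad_KK[OF y \<open>f \<in> F\<close>]] by simp
    moreover have "norm (a $ i $ j) / C' > 0" using aij C' by simp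
    ultimately show ?thesis by simp
  qed
  \<comment> \<open>Adding multiples of a traceless operator does not leave the set on which \<open>a\<close> is bounded below.\<close>
  have a_null: "a \<bullet> N = 0" if N: "tr N = 0" "\<And>d. d \<notin> range e \<Longrightarrow> N $ d = 0" for N
  proof (rule ccontr)
    assume an: "a \<bullet> N \<noteq> 0"
    fix i :: 'm
    define E where "E = punit i i (of_real (b + 1))"
    define r where "r = (c - 1 - a \<bullet> E) / (a \<bullet> N)"
    have "E + r *\<^sub>R N \<in> TT"
      unfolding TT_def E_def using N by (simp add: tr_add tr_scale tr_punit supp_punit del: of_real_add)
    from aT[OF this] have "c \<le> a \<bullet> E + r * (a \<bullet> N)" by (simp add: inner_add_right)
    then show False using an by (simp add: r_def)
  qed
  have a_off: "a $ e i $ j = 0" if "i \<noteq> j" for i j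
  proof -
    have "a \<bullet> punit i j (a $ e i $ j) = 0"
      by (rule a_null) (use that in \<open>auto simp: tr_punit supp_punit\<close>)
    then show ?thesis by (simp add: a_punit)
  qed
  have a_real: "a $ e i $ i = of_real (re (a $ e i $ i))" for i
  proof -
    define z where "z = a $ e i $ i - of_real (re (a $ e i $ i))"
    have rez: "re z = 0" unfolding z_def by (simp add: inner_diff_right)
    then have "a \<bullet> punit i i z = 0"
      by (intro a_null) (auto simp: tr_punit supp_punit)
    then have "(z + re (a $ e i $ i) *\<^sub>R 1) \<bullet> z = 0"
      unfolding a_punit by (simp add: z_def scaleR_conv_of_real)
    then have "z \<bullet> z = 0" using rez by (simp only: inner_add_left inner_scaleR_left mult_zero_right add_0_right)
    then show ?thesis unfolding z_def by simp
  qed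
  define \<kappa> where "\<kappa> = re (a $ e undefined $ undefined)"
  have a_diag: "a $ e i $ i = of_real \<kappa>" for i
  proof -
    have "a \<bullet> (punit i i 1 - punit undefined undefined 1) = 0"
    proof (rule a_null)
      show "tr (punit i i 1 - punit undefined undefined 1) = 0"
        using tr_add[of "punit i i 1" "(-1) *\<^sub>R punit undefined undefined 1"]
        by (simp only: tr_scale) (simp add: tr_punit)
    qed (simp add: supp_punit)
    then have "re (a $ e i $ i) = \<kappa>"
      unfolding inner_diff_right a_punit \<kappa>_def by (simp add: inner_commute)
    with a_real[of i] show ?thesis by simp
  qed
  have c_le: "c \<le> \<kappa> * b"
  proof (rule field_le_epsilon)
    fix \<epsilon> :: real assume "0 < \<epsilon>"
    define \<delta> where "\<delta> = \<epsilon> / (\<bar>\<kappa>\<bar> + 1)"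
    have "\<delta> > 0" unfolding \<delta>_def using \<open>0 < \<epsilon>\<close> by simp
    then have "punit undefined undefined (of_real (b + \<delta>)) \<in> TT"
      unfolding TT_def by (simp add: tr_punit supp_punit del: of_real_add)
    from aT[OF this] have "c \<le> of_real \<kappa> \<bullet> (of_real (b + \<delta>) :: 'a)"
      unfolding a_punit a_diag .
    also have "\<dots> = \<kappa> * (b + \<delta>)"
      by (simp add: of_real_def dot_square_norm)
    also have "\<dots> \<le> \<kappa> * b + \<epsilon>"
    proof -
      have "\<kappa> * \<delta> \<le> (\<bar>\<kappa>\<bar> + 1) * \<delta>" using \<open>\<delta> > 0\<close> by (intro mult_right_mono) auto
      also have "\<dots> = \<epsilon>" unfolding \<delta>_def by simp
      finally show ?thesis by (simp add: distrib_left)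
    qed
    finally show "c \<le> \<kappa> * b + \<epsilon>" .
  qed
  have b0: "0 \<le> b"
    using trace_le_frame_bound[OF e fb, of 0 F] zero_dyad hull_inc[OF zero_dyad, of convex] by simp
  have \<kappa>0: "\<kappa> > 0"
    using c0 c_le b0 by (smt (verit) mult_nonneg_nonneg mult_nonpos_nonneg)
  define P where "P = (\<chi> j i. cj (a $ i $ j) / of_real \<kappa>)"
  show ?thesis
  proof (rule that[of P])
    show "P $ i $ e j = of_bool (i = j)" for i j
      using a_off[of j i] a_diag[of j] \<kappa>0 by (auto simp: P_def)
    show "norm (\<Sum>j\<in>UNIV. f $ e j * (P *v y) $ j) \<le> b" if f: "f \<in> F" and y: "y \<in> polar F" for f y
    proof -
      define val where "val f = (\<Sum>j\<in>UNIV. f $ e j * (P *v y) $ j)" for f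
      have re_le: "re (val f) \<le> b" if f: "f \<in> F" for f
      proof -
        have "\<kappa> * re (val f) = re (of_real \<kappa> * val f)" by (rule re_of_real_mult[symmetric])
        also have "of_real \<kappa> * val f = (\<Sum>j\<in>UNIV. \<Sum>i\<in>UNIV. cj (a $ i $ j) * (y $ i * f $ e j))"
          unfolding val_def P_def matrix_vector_mult_def using \<kappa>0
          by (simp add: sum_distrib_left mult_ac)
        also have "re \<dots> = (\<Sum>j\<in>UNIV. \<Sum>i\<in>UNIV. a $ i $ j \<bullet> (y $ i * f $ e j))"
          unfolding re_sum inner_eq_cj[of "a $ i $ j" for i j] ..
        also have "\<dots> = a \<bullet> restricted_dyad e y f"
          unfolding restricted_dyad_def inner_vec_def by (subst sum.swap) simp
        also have "\<dots> \<le> c" by (rule aK[OF dyad_KK[OF y f]])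
        also note c_le
        finally show ?thesis using \<kappa>0 by simp
      qed
      have val_scale: "val (z *s f) = z * val f" for z
        unfolding val_def by (simp add: sum_distrib_left mult_ac)
      \<comment> \<open>Since \<open>F\<close> is balanced, the bound on the real part gives the bound on the modulus.\<close>
      define w where "w = cj (val f) / of_real (norm (val f))"
      have "norm w \<le> 1" unfolding w_def by (simp add: norm_divide)
      then have "re (val (w *s f)) \<le> b" by (intro re_le F_balanced f)
      moreover have "val (w *s f) = of_real (norm (val f))"
      proof (cases "val f = 0")
        case False
        then show ?thesis
          unfolding val_scale w_def using mult_cj[of "val f"]
          by (simp add: mult.commute power2_eq_square)
      qed (simp add: val_scale)
      ultimately show ?thesis unfolding val_def by (simp only: re_of_real)
    qed
  qed
qed

end

section \<open>Bounded orbits and adapted bases\<close>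

text \<open>
  The range of \<open>Q\<close> stands for a quotient by an invariant subspace, the kernel of \<open>Q\<close>. If every
  nonzero vector \<open>x\<close> of the range had a product of some length \<open>t\<close> that expands it by more than
  \<open>\<rho>\<^sup>t\<close>, then by compactness of the sphere finitely many products would suffice, with a common rate
  \<open>\<eta> > \<rho>\<close>. Composing them yields arbitrarily long products that grow at the rate \<open>\<eta>\<close>.
\<close>

lemma exists_bounded_orbit:
  fixes M :: "('a::{real_normed_field,euclidean_space} ^ 'n ^ 'n) set" and Q :: "'a ^ 'n ^ 'n"
  assumes M: "M \<noteq> {}" "bounded M"
    and QA: "\<And>A. A \<in> M \<Longrightarrow> Q ** A ** Q = Q ** A" and QQ: "Q ** Q = Q" and Q0: "Q \<noteq> 0"
  obtains x where "x \<noteq> 0" "Q *v x = x"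
    "\<And>t S. S \<in> products_of_length M t \<Longrightarrow> norm (Q *v (S *v x)) \<le> joint_spectral_radius M ^ t * norm x"
proof -
  define \<rho> where "\<rho> = joint_spectral_radius M"
  have "\<exists>x. x \<noteq> 0 \<and> Q *v x = x \<and>
    (\<forall>t. \<forall>S\<in>products_of_length M t. norm (Q *v (S *v x)) \<le> \<rho> ^ t * norm x)"
  proof (rule ccontr)
    assume escapes: "\<not> ?thesis"
    have \<rho>0: "0 \<le> \<rho>" unfolding \<rho>_def by (rule joint_spectral_radius_nonneg[OF M])
    have escape: "\<exists>t S. S \<in> products_of_length M t \<and> \<rho> ^ t * norm x < norm (Q *v (S *v x))"
      if "x \<noteq> 0" "Q *v x = x" for x
      using that escapes by (meson not_le)
    define C where "C = {x. Q *v x = x \<and> norm x = 1}"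
    have "compact C"
    proof -
      have "closed {x. Q *v x = x}"
        by (intro closed_Collect_eq continuous_on_id linear_continuous_on matrix_vector_mul_bounded_linear)
      moreover have "C = {x. Q *v x = x} \<inter> sphere 0 1" unfolding C_def by auto
      ultimately show ?thesis by (simp add: closed_Int_compact)
    qed
    obtain y where y: "Q *v y \<noteq> 0" using Q0 by (metis matrix_eq matrix_vector_mult_0)
    define D where "D = {(t, S, \<eta>). 0 < t \<and> S \<in> products_of_length M t \<and> \<rho> < \<eta>}"
    define U where "U = (\<lambda>(t, S :: 'a ^ 'n ^ 'n, \<eta>). {x. \<eta> ^ t < norm (Q *v (S *v x))})"
    have cover: "C \<subseteq> (\<Union>d\<in>D. U d)"
    proof
      fix x assume x: "x \<in> C"
      then have "x \<noteq> 0" by (auto simp: C_def)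
      then obtain t S where S: "S \<in> products_of_length M t" "\<rho> ^ t < norm (Q *v (S *v x))"
        using escape[of x] x by (auto simp: C_def)
      have t: "t > 0" using S x by (cases t) (auto simp: C_def)
      define v where "v = norm (Q *v (S *v x))"
      have "root t (\<rho> ^ t) < root t v" unfolding v_def using S t by simp
      then obtain \<eta> where \<eta>: "\<rho> < \<eta>" "\<eta> < root t v"
        using dense t \<rho>0 by (auto simp: real_root_power_cancel)
      have "\<eta> ^ t < root t v ^ t"
        using \<eta> \<rho>0 t by (intro power_strict_mono) auto
      then have "\<eta> ^ t < v" using t by (simp add: v_def)
      then show "x \<in> (\<Union>d\<in>D. U d)"
        unfolding D_def U_def v_def using S t \<eta> by (intro UN_I[of "(t, S, \<eta>)"]) auto
    qed
    have "open (U d)" for d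
    proof -
      have "continuous_on UNIV (\<lambda>x. norm (Q ** S *v x))" for S :: "'a ^ 'n ^ 'n"
        by (intro continuous_on_norm linear_continuous_on matrix_vector_mul_bounded_linear)
      then show ?thesis
        unfolding U_def
        by (cases d) (auto intro!: open_Collect_less continuous_on_const simp: matrix_vector_mul_assoc)
    qed
    with \<open>compact C\<close> cover obtain D' where D': "D' \<subseteq> D" "finite D'" "C \<subseteq> (\<Union>d\<in>D'. U d)"
      by (elim compactE_image) auto
    define \<eta> where "\<eta> = Min (insert (\<rho> + 1) ((\<lambda>(t, S, \<eta>). \<eta>) ` D'))"
    have \<eta>: "\<rho> < \<eta>" unfolding \<eta>_def using D' by (subst Min_gr_iff) (auto simp: D_def)
    have expand: "\<exists>t>0. \<exists>S\<in>products_of_length M t. \<eta> ^ t * norm x \<le> norm (Q *v (S *v x))"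
      if x: "x \<noteq> 0" "Q *v x = x" for x
    proof -
      define x' where "x' = (1 / norm x) *\<^sub>R x"
      have "x' \<in> C" unfolding C_def x'_def using x by (simp add: linear_scale[OF matrix_vector_mul_linear])
      then obtain t S \<eta>' where d: "(t, S, \<eta>') \<in> D'" "\<eta>' ^ t < norm (Q *v (S *v x'))"
        using D'(3) unfolding U_def by fastforce
      have "\<eta> \<le> \<eta>'" unfolding \<eta>_def using D'(2) d(1) by (intro Min_le) force+
      then have "\<eta> ^ t \<le> \<eta>' ^ t" using \<eta> \<rho>0 by (intro power_mono) auto
      also have "\<dots> \<le> norm (Q *v (S *v x))  / norm x"
        using d(2) x unfolding x'_def by (simp add: linear_scale[OF matrix_vector_mul_linear])
      finally have "\<eta> ^ t * norm x \<le> norm (Q *v (S *v x))" using x by (simp add: field_simps)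
      with d(1) D'(1) show ?thesis unfolding D_def by blast
    qed
    have QS: "Q ** S ** Q = Q ** S" if "S \<in> products_of_length M t" for S t
      using that
    proof (induction t arbitrary: S)
      case (Suc t)
      then obtain A R where AR: "A \<in> M" "R \<in> products_of_length M t" "S = A ** R"
        by (elim products_of_length_SucE)
      have "Q ** (A ** R) ** Q = (Q ** A ** Q) ** R ** Q"
        using QA[OF AR(1)] by (simp add: matrix_mul_assoc)
      also have "\<dots> = Q ** A ** (Q ** R ** Q)" by (simp add: matrix_mul_assoc)
      also have "\<dots> = Q ** A ** (Q ** R)" using Suc.IH[OF AR(2)] by simp
      also have "\<dots> = (Q ** A ** Q) ** R" by (simp add: matrix_mul_assoc)
      also have "\<dots> = Q ** (A ** R)" using QA[OF AR(1)] by (simp add: matrix_mul_assoc)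
      finally show ?case using AR by simp
    qed (use QQ in simp)
    define x where "x = Q *v y"
    have x: "x \<noteq> 0" "Q *v x = x" unfolding x_def using y QQ by (auto simp: matrix_vector_mul_assoc)
    have grow: "\<exists>t\<ge>N. \<exists>S\<in>products_of_length M t. \<eta> ^ t * norm x \<le> norm (Q *v (S *v x))" for N
    proof (induction N)
      case 0
      show ?case by (intro exI[of _ 0]) (simp add: x)
    next
      case (Suc N)
      then obtain t S where S: "t \<ge> N" "S \<in> products_of_length M t" "\<eta> ^ t * norm x \<le> norm (Q *v (S *v x))"
        by blast
      define z where "z = Q *v (S *v x)"
      have "0 < \<eta> ^ t * norm x" using \<eta> \<rho>0 x by simp
      then have z0: "z \<noteq> 0" using S unfolding z_def by force
      moreover have "Q *v z = z" unfolding z_def using QQ by (simp add: matrix_vector_mul_assoc matrix_mul_assoc)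
      ultimately obtain t' R where R: "t' > 0" "R \<in> products_of_length M t'" "\<eta> ^ t' * norm z \<le> norm (Q *v (R *v z))"
        using expand by blast
      have "\<eta> ^ (t' + t) * norm x = \<eta> ^ t' * (\<eta> ^ t * norm x)" by (simp add: power_add)
      also have "\<dots> \<le> \<eta> ^ t' * norm z" using S \<eta> \<rho>0 unfolding z_def by (intro mult_left_mono) auto
      also note R(3)
      also have "Q *v (R *v z) = Q ** R ** Q *v (S *v x)"
        unfolding z_def by (simp add: matrix_vector_mul_assoc matrix_mul_assoc)
      also have "\<dots> = Q *v (R ** S *v x)"
        unfolding QS[OF R(2)] by (simp add: matrix_vector_mul_assoc matrix_mul_assoc)
      finally show ?case
        using products_of_length_mult[OF R(2) S(2)] S(1) R(1) by (intro exI[of _ "t' + t"]) auto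
    qed
    have sQ: "spectral_norm Q > 0"
      using norm_le_spectral_norm[of Q y] y spectral_norm_nonneg[of Q]
      by (cases "spectral_norm Q = 0") auto
    have "\<eta> \<le> \<rho>" unfolding \<rho>_def
    proof (rule joint_spectral_radius_ge[OF M])
      show "0 < 1 / spectral_norm Q" using sQ by simp
      show "\<exists>t\<ge>N. \<exists>S\<in>products_of_length M t. \<exists>x. x \<noteq> 0 \<and> 1 / spectral_norm Q * \<eta> ^ t * norm x \<le> norm (S *v x)" for N
      proof -
        obtain t S where S: "t \<ge> N" "S \<in> products_of_length M t" "\<eta> ^ t * norm x \<le> norm (Q *v (S *v x))"
          using grow by blast
        then have "\<eta> ^ t * norm x \<le> spectral_norm Q * norm (S *v x)"
          using norm_le_spectral_norm order_trans by blast
        then have "1 / spectral_norm Q * \<eta> ^ t * norm x \<le> norm (S *v x)"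
          using sQ by (simp add: field_simps)
        with S x show ?thesis by blast
      qed
    qed
    with \<eta> show False by simp
  qed
  then show ?thesis using that unfolding \<rho>_def by blast
qed

lemma exists_projection_killing_subspace:
  fixes V :: "('a::field ^ 'n) set"
  assumes V: "vec.subspace V"
  obtains Q :: "'a ^ 'n ^ 'n" where "\<And>x. x \<in> V \<longleftrightarrow> Q *v x = 0" "\<And>x. x - Q *v x \<in> V" "Q ** Q = Q"
proof -
  obtain B1 where B1: "B1 \<subseteq> V" "vec.independent B1" "V \<subseteq> vec.span B1" "card B1 = vec.dim V"
    by (rule vec.basis_exists)
  obtain B where B: "B1 \<subseteq> B" "B \<subseteq> UNIV" "vec.independent B" "UNIV \<subseteq> vec.span B"
    using subset_UNIV B1(2) by (rule vec.maximal_independent_subset_extend)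
  obtain g where g: "\<forall>x\<in>B. g x = (if x \<in> B1 then 0 else x)" "Vector_Spaces.linear (*s) (*s) g"
    using vec.linear_independent_extend[OF B(3), of "\<lambda>x. if x \<in> B1 then 0 else x"] by metis
  define Q where "Q = matrix g"
  have Q: "Q *v x = g x" for x unfolding Q_def using g(2) by (rule matrix_works)
  have "vec.subspace {x. Q *v x = 0}"
    by (auto simp: vec.subspace_def matrix_vector_right_distrib vector_scalar_commute)
  moreover have "B1 \<subseteq> {x. Q *v x = 0}" using B g(1) by (auto simp: Q)
  ultimately have Q0: "Q *v x = 0" if "x \<in> V" for x
    using vec.span_minimal[of B1 "{x. Q *v x = 0}"] B1(3) that by blast
  have "vec.subspace {x. x - Q *v x \<in> V}"
  proof (intro vec.subspaceI)
    show "0 \<in> {x. x - Q *v x \<in> V}" using V by (simp add: vec.subspace_0)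
  next
    fix x y assume "x \<in> {x. x - Q *v x \<in> V}" "y \<in> {x. x - Q *v x \<in> V}"
    then have "(x - Q *v x) + (y - Q *v y) \<in> V" by (intro vec.subspace_add[OF V]) auto
    then show "x + y \<in> {x. x - Q *v x \<in> V}" by (simp add: matrix_vector_right_distrib algebra_simps)
  next
    fix c x assume "x \<in> {x. x - Q *v x \<in> V}"
    then have "c *s (x - Q *v x) \<in> V" by (intro vec.subspace_scale[OF V]) auto
    then show "c *s x \<in> {x. x - Q *v x \<in> V}" by (simp add: vector_scalar_commute vector_ssub_ldistrib)
  qed
  moreover have "B \<subseteq> {x. x - Q *v x \<in> V}"
    using g(1) B1(1) V by (auto simp: Q vec.subspace_0)
  ultimately have QV: "x - Q *v x \<in> V" for x
    using vec.span_minimal[of B "{x. x - Q *v x \<in> V}"] B(4) by blast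
  have "x \<in> V \<longleftrightarrow> Q *v x = 0" for x using Q0[of x] QV[of x] by auto
  moreover have "Q ** Q = Q"
    unfolding matrix_eq
  proof
    fix x
    have "Q *v (x - Q *v x) = 0" using Q0 QV by blast
    then show "Q ** Q *v x = Q *v x"
      by (simp add: matrix_vector_mult_diff_distrib matrix_vector_mul_assoc)
  qed
  ultimately show ?thesis using that QV by blast
qed

definition supported_on :: "'n set \<Rightarrow> 'a::zero ^ 'n \<Rightarrow> bool" where
  "supported_on I x \<longleftrightarrow> (\<forall>i. i \<notin> I \<longrightarrow> x $ i = 0)"

text \<open>
  Extend a basis of \<open>V\<close> to one of \<open>W\<close> and further to one of the whole space, and choose \<open>card J\<close> of its
  elements between the first two bases. The columns of \<open>R\<close> are the basis vectors, arranged so that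
  the chosen ones have their indices in \<open>J\<close>.
\<close>

lemma exists_adapted_basis:
  fixes V W :: "('a::field ^ 'd) set" and J :: "'d set"
  assumes V: "vec.subspace V" and W: "vec.subspace W" and VW: "V \<subseteq> W"
    and J: "vec.dim V \<le> card J" "card J \<le> vec.dim W"
  obtains R :: "'a ^ 'd ^ 'd" and J1 I where "invertible R" "J1 \<subseteq> J" "J \<subseteq> I"
    "V = (*v) R ` {x. supported_on J1 x}" "W = (*v) R ` {x. supported_on I x}"
proof -
  obtain B1 where B1: "B1 \<subseteq> V" "vec.independent B1" "V \<subseteq> vec.span B1" "card B1 = vec.dim V"
    by (rule vec.basis_exists)
  obtain B3 where B3: "B1 \<subseteq> B3" "B3 \<subseteq> W" "vec.independent B3" "W \<subseteq> vec.span B3"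
    using order_trans[OF B1(1) VW] B1(2) by (rule vec.maximal_independent_subset_extend)
  obtain B where B: "B3 \<subseteq> B" "B \<subseteq> UNIV" "vec.independent B" "UNIV \<subseteq> vec.span B"
    using subset_UNIV B3(3) by (rule vec.maximal_independent_subset_extend)
  have finB: "finite B" using B(3) by (rule vec.finiteI_independent)
  have finB3: "finite B3" using finite_subset[OF B(1) finB] .
  have "card B3 = vec.dim W" by (rule vec.basis_card_eq_dim) (use B3 in auto)
  then obtain B2 where B2: "B1 \<subseteq> B2" "B2 \<subseteq> B3" "card B2 = card J"
    using exists_subset_between[of B1 "card J" B3] J B1(4) B3(1) finB3 by auto
  have finB2: "finite B2" using finite_subset[OF B2(2) finB3] .
  have "card B = vec.dim (UNIV :: ('a ^ 'd) set)"
    by (rule vec.basis_card_eq_dim) (use B in auto)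
  then have cardB: "card B = CARD('d)" by (simp add: card_cart_basis)
  obtain f where f: "bij_betw f J B2"
    using finite_same_card_bij[of J B2] finB2 B2(3) by auto
  have "card (- J) = card (B - B2)"
    using B2 B(1) finB2 cardB by (simp add: Compl_eq_Diff_UNIV card_Diff_subset)
  then obtain g where g: "bij_betw g (- J) (B - B2)"
    using finite_same_card_bij[of "- J" "B - B2"] finB by auto
  define b where "b i = (if i \<in> J then f i else g i)" for i
  have "bij_betw b (J \<union> - J) (B2 \<union> (B - B2))"
  proof (rule bij_betw_combine)
    show "bij_betw b J B2" using f by (rule iffD1[OF bij_betw_cong, rotated]) (simp add: b_def)
    show "bij_betw b (- J) (B - B2)" using g by (rule iffD1[OF bij_betw_cong, rotated]) (simp add: b_def)
  qed auto
  moreover have "B2 \<union> (B - B2) = B" using B2 B(1) by blast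
  ultimately have b: "bij_betw b UNIV B" by simp
  have inj: "inj b" using b by (rule bij_betw_imp_inj_on)
  have bJ: "b ` J = B2" using f unfolding bij_betw_def by (auto simp: b_def)
  define R where "R = (\<chi> i j. b j $ i)"
  have col: "column j R = b j" for j unfolding R_def column_def by (simp add: vec_eq_iff)
  have Rx: "R *v x = (\<Sum>j\<in>UNIV. x $ j *s b j)" for x
    unfolding matrix_mult_sum col ..
  have "columns R = B" unfolding columns_def col using b by (auto simp: bij_betw_def)
  then have "\<exists>R'. R ** R' = mat 1"
    using B(4) unfolding matrix_right_invertible_span_columns by blast
  then have "invertible R" using invertible_right_inverse by blast
  have span: "vec.span (b ` I) = (*v) R ` {x. supported_on I x}" for I
  proof -
    have injI: "inj_on b I" using inj by (rule inj_on_subset) simp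
    have "vec.span (b ` I) = range (\<lambda>u. \<Sum>v\<in>b ` I. u v *s v)" by (rule vec.span_finite) simp
    also have "\<dots> = range (\<lambda>u. \<Sum>j\<in>I. u (b j) *s b j)"
      unfolding sum.reindex[OF injI] comp_def ..
    also have "\<dots> = (*v) R ` {x. supported_on I x}"
    proof (intro equalityI subsetI; elim imageE)
      fix y u assume "y = (\<Sum>j\<in>I. u (b j) *s b j)"
      also have "\<dots> = (\<Sum>j\<in>I. (\<chi> j. if j \<in> I then u (b j) else 0) $ j *s b j)" by simp
      also have "\<dots> = R *v (\<chi> j. if j \<in> I then u (b j) else 0)"
        unfolding Rx by (rule sum.mono_neutral_left) auto
      finally show "y \<in> (*v) R ` {x. supported_on I x}"
        by (rule image_eqI) (auto simp: supported_on_def)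
    next
      fix y x assume y: "y = R *v x" and x: "x \<in> {x. supported_on I x}"
      have "y = (\<Sum>j\<in>I. x $ j *s b j)"
        unfolding y Rx by (rule sum.mono_neutral_right) (use x in \<open>auto simp: supported_on_def\<close>)
      also have "\<dots> = (\<Sum>j\<in>I. x $ inv b (b j) *s b j)" using inj by simp
      finally show "y \<in> range (\<lambda>u. \<Sum>j\<in>I. u (b j) *s b j)"
        by (rule image_eqI[where x = "\<lambda>v. x $ inv b v"]) simp
    qed
    finally show ?thesis .
  qed
  have img: "b ` (b -` X) = X" if "X \<subseteq> B" for X
    using b that by (auto simp: bij_betw_def)
  have "V = vec.span B1" using B1 vec.span_minimal[OF B1(1) V] by blast
  then have V_eq: "V = (*v) R ` {x. supported_on (b -` B1) x}"
    using img[of B1] B3 B span[of "b -` B1"] by auto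
  have "W = vec.span B3" using B3 vec.span_minimal[OF B3(2) W] by blast
  then have W_eq: "W = (*v) R ` {x. supported_on (b -` B3) x}"
    using img[of B3] B span[of "b -` B3"] by auto
  have "b -` B1 \<subseteq> J"
  proof
    fix i assume "i \<in> b -` B1"
    then have "b i \<in> b ` J" using B2(1) bJ by auto
    then show "i \<in> J" using inj by (simp add: inj_image_mem_iff)
  qed
  moreover have "J \<subseteq> b -` B3" using B2(2) bJ by blast
  ultimately show ?thesis using that \<open>invertible R\<close> V_eq W_eq by blast
qed

section \<open>Compressions of block triangular sets\<close>

definition cut :: "'n set \<Rightarrow> 'a::zero ^ 'n \<Rightarrow> 'a ^ 'n" where
  "cut I x = (\<chi> i. if i \<in> I then x $ i else 0)"

lemma cut_nth [simp]: "cut I x $ i = (if i \<in> I then x $ i else 0)"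
  by (simp add: cut_def)

lemma supported_on_cut: "supported_on I (cut I x)"
  by (simp add: supported_on_def)

lemma cut_split: "cut I x + cut (- I) x = (x :: 'a::monoid_add ^ 'n)"
  by (simp add: vec_eq_iff)

lemma cut_add: "cut I (x + y) = cut I x + cut I (y :: 'a::monoid_add ^ 'n)"
  by (simp add: vec_eq_iff)

lemma cut_0 [simp]: "cut I 0 = 0"
  by (simp add: vec_eq_iff)

lemma cut_idem: "supported_on I x \<Longrightarrow> cut I x = x"
  by (auto simp: vec_eq_iff supported_on_def)

lemma cut_eq_0: "supported_on I x \<Longrightarrow> I \<inter> I' = {} \<Longrightarrow> cut I' x = 0"
  by (auto simp: vec_eq_iff supported_on_def)

lemma supported_on_mono: "supported_on I x \<Longrightarrow> I \<subseteq> I' \<Longrightarrow> supported_on I' x"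
  by (auto simp: supported_on_def)

lemma norm_cut_le: "norm (cut I x) \<le> norm (x :: 'a::real_normed_vector ^ 'n)"
  unfolding norm_vec_def by (rule L2_set_mono) auto

text \<open>
  Along a product, components of a vector can pass from the quotient into \<open>U\<close>, but not back. The factors
  after the passage are controlled by the restriction to \<open>U\<close>, those before it by the quotient. Summing
  over the position of the passage gives the linear factor in \<open>t\<close>.
\<close>

lemma block_triangular_growth:
  fixes M :: "('a::{real_normed_field,euclidean_space} ^ 'n ^ 'n) set"
  assumes inv: "\<And>A x. A \<in> M \<Longrightarrow> supported_on U x \<Longrightarrow> supported_on U (A *v x)"
    and K1: "\<And>t S x. S \<in> products_of_length M t \<Longrightarrow> supported_on U x \<Longrightarrow> norm (S *v x) \<le> K1 * r ^ t * norm x"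
    and K2: "\<And>t S x. S \<in> products_of_length M t \<Longrightarrow> norm (cut (- U) (S *v x)) \<le> K2 * r ^ t * norm x"
    and c: "\<And>A x. A \<in> M \<Longrightarrow> norm (A *v x) \<le> c * norm x"
    and pos: "0 < r" "0 \<le> K1" "0 \<le> K2" "0 \<le> c"
  obtains K where "\<And>t S x. S \<in> products_of_length M t \<Longrightarrow> norm (S *v x) \<le> K * (real t + 1) * r ^ t * norm x"
proof -
  define L where "L = K1 * c * K2 / r"
  have L0: "L \<ge> 0" unfolding L_def using pos by simp
  have step: "norm (R *v cut U (S *v x)) \<le> (K1 + real t * L) * r ^ (q + t) * norm x"
    if "S \<in> products_of_length M t" "R \<in> products_of_length M q" for S R t q x
    using that
  proof (induction t arbitrary: q R S)
    case 0
    have "norm (R *v cut U x) \<le> K1 * r ^ q * norm (cut U x)"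
      using 0 by (intro K1) (auto simp: supported_on_cut)
    also have "\<dots> \<le> K1 * r ^ q * norm x"
      using pos by (intro mult_left_mono norm_cut_le) auto
    finally show ?case using 0 by simp
  next
    case (Suc t)
    from Suc.prems(1) obtain A S' where A: "A \<in> M" "S' \<in> products_of_length M t" "S = A ** S'"
      by (elim products_of_length_SucE)
    let ?u = "cut U (S' *v x)" and ?w = "cut (- U) (S' *v x)"
    have "S *v x = A *v ?u + A *v ?w"
      unfolding matrix_vector_right_distrib[symmetric] cut_split A(3) by (simp add: matrix_vector_mul_assoc)
    then have "cut U (S *v x) = A *v ?u + cut U (A *v ?w)"
      using cut_idem[OF inv[OF A(1) supported_on_cut]] by (simp add: cut_add)
    then have "norm (R *v cut U (S *v x)) \<le> norm (R ** A *v ?u) + norm (R *v cut U (A *v ?w))"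
      by (simp add: matrix_vector_right_distrib matrix_vector_mul_assoc norm_triangle_ineq)
    also have "norm (R ** A *v ?u) \<le> (K1 + real t * L) * r ^ (Suc q + t) * norm x"
      by (rule Suc.IH[OF A(2) products_of_length_SucI'[OF A(1) Suc.prems(2)]])
    also have "norm (R *v cut U (A *v ?w)) \<le> L * r ^ (Suc q + t) * norm x"
    proof -
      have "norm (R *v cut U (A *v ?w)) \<le> K1 * r ^ q * norm (cut U (A *v ?w))"
        by (rule K1[OF Suc.prems(2) supported_on_cut])
      also have "\<dots> \<le> K1 * r ^ q * (c * (K2 * r ^ t * norm x))"
      proof (intro mult_left_mono)
        have "norm (cut U (A *v ?w)) \<le> norm (A *v ?w)" by (rule norm_cut_le)
        also have "\<dots> \<le> c * norm ?w" by (rule c[OF A(1)])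
        also have "\<dots> \<le> c * (K2 * r ^ t * norm x)" using pos K2[OF A(2)] by (intro mult_left_mono) auto
        finally show "norm (cut U (A *v ?w)) \<le> c * (K2 * r ^ t * norm x)" .
      qed (use pos in auto)
      also have "\<dots> = L * r ^ (Suc q + t) * norm x"
        using pos by (simp add: L_def power_add mult_ac)
      finally show ?thesis .
    qed
    finally show ?case by (simp add: algebra_simps)
  qed
  show ?thesis
  proof (rule that[of "K1 + L + K2"])
    fix t S and x :: "'a ^ 'n" assume S: "S \<in> products_of_length M t"
    have "norm (S *v x) \<le> norm (mat 1 *v cut U (S *v x)) + norm (cut (- U) (S *v x))"
      using norm_triangle_ineq[of "cut U (S *v x)" "cut (- U) (S *v x)"] by (simp add: cut_split)
    also have "\<dots> \<le> (K1 + real t * L) * r ^ (0 + t) * norm x + K2 * r ^ t * norm x"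
      by (intro add_mono step K2 S) simp
    also have "\<dots> = (K1 + real t * L + K2) * (r ^ t * norm x)" by (simp add: algebra_simps)
    also have "\<dots> \<le> ((K1 + L + K2) * (real t + 1)) * (r ^ t * norm x)"
      using pos L0 by (intro mult_right_mono) (auto simp: algebra_simps)
    finally show "norm (S *v x) \<le> (K1 + L + K2) * (real t + 1) * r ^ t * norm x" by (simp add: mult_ac)
  qed
qed

definition inclusion :: "('m \<Rightarrow> 'd) \<Rightarrow> 'a::zero_neq_one ^ 'm ^ 'd" where
  "inclusion e = (\<chi> i j. of_bool (i = e j))"

lemma inclusion_nth:
  fixes x :: "'a::semiring_1 ^ 'm::finite"
  assumes "inj e"
  shows "(inclusion e *v x) $ e j = x $ j" "i \<notin> range e \<Longrightarrow> (inclusion e *v x) $ i = 0"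
proof -
  have "(inclusion e *v x) $ e j = (\<Sum>k\<in>UNIV. if k = j then x $ k else 0)"
    unfolding matrix_vector_mult_def inclusion_def vec_lambda_beta
    by (intro sum.cong refl) (auto simp: inj_eq[OF assms])
  then show "(inclusion e *v x) $ e j = x $ j" by simp
  show "(inclusion e *v x) $ i = 0" if "i \<notin> range e"
    unfolding matrix_vector_mult_def inclusion_def vec_lambda_beta
    using that by (intro sum.neutral) auto
qed

lemma dotp_inclusion:
  assumes "inj e"
  shows "dotp f (inclusion e *v x) = (\<Sum>j\<in>UNIV. f $ e j * x $ j)"
proof -
  have "dotp f (inclusion e *v x) = (\<Sum>i\<in>range e. f $ i * (inclusion e *v x) $ i)"
    unfolding dotp_def by (intro sum.mono_neutral_right) (auto simp: inclusion_nth(2)[OF assms])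
  also have "\<dots> = (\<Sum>j\<in>UNIV. f $ e j * (inclusion e *v x) $ e j)"
    by (rule sum.reindex[OF assms, unfolded comp_def])
  finally show ?thesis by (simp add: inclusion_nth[OF assms])
qed

lemma norm_inclusion:
  fixes x :: "'a::real_normed_field ^ 'm::finite"
  assumes "inj e"
  shows "norm (inclusion e *v x) = norm x"
proof -
  have "(\<Sum>i\<in>UNIV. (norm ((inclusion e *v x) $ i))^2) = (\<Sum>i\<in>range e. (norm ((inclusion e *v x) $ i))^2)"
    by (intro sum.mono_neutral_right) (auto simp: inclusion_nth(2)[OF assms])
  also have "\<dots> = (\<Sum>j\<in>UNIV. (norm ((inclusion e *v x) $ e j))^2)"
    by (rule sum.reindex[OF assms, unfolded comp_def])
  finally show ?thesis by (simp add: norm_vec_def L2_set_def inclusion_nth[OF assms])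
qed

lemma dotp_vector_matrix: "dotp (g v* S) y = dotp g (S *v y)"
proof -
  have "dotp (g v* S) y = (\<Sum>j\<in>UNIV. \<Sum>i\<in>UNIV. S $ i $ j * g $ i * y $ j)"
    unfolding dotp_def vector_matrix_mult_def by (simp add: sum_distrib_right) (simp add: mult_ac)
  also have "\<dots> = (\<Sum>i\<in>UNIV. \<Sum>j\<in>UNIV. S $ i $ j * g $ i * y $ j)"
    by (rule sum.swap)
  also have "\<dots> = dotp g (S *v y)"
    unfolding dotp_def matrix_vector_mult_def by (simp add: sum_distrib_left mult_ac)
  finally show ?thesis .
qed

lemma norm_axis_one: "norm (axis i 1 :: 'a::{real_normed_field,euclidean_space} ^ 'n) = 1"
  unfolding norm_eq_sqrt_inner[of "axis _ _"] inner_axis_axis by (simp add: dot_square_norm)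

lemma norm_le_sum_nth: "norm (x :: 'a::real_normed_vector ^ 'n) \<le> (\<Sum>i\<in>UNIV. norm (x $ i))"
  unfolding norm_vec_def by (rule L2_set_le_sum) simp

context conjugation
begin

text \<open>
  For \<open>\<rho> > 0\<close> the polar of \<open>F\<close> is the unit ball of a norm in which all elements of \<open>N\<close> have norm at most
  \<open>\<rho>\<close>, because \<open>F\<close> is closed under \<open>f \<mapsto> \<rho>\<^sup>-\<^sup>1 f A\<close>. Compressing with a projection of norm at most \<open>b\<close>
  costs a factor \<open>b\<close> per step. For \<open>\<rho> = 0\<close> the hypothesis, with the convention \<open>0\<^sup>0 = 1\<close>, says that \<open>N\<close> contains
  no matrix other than 0.
\<close>

lemma exists_projection_bounding_products:
  fixes e :: "'m::finite \<Rightarrow> 'd::finite" and N :: "('a ^ 'd ^ 'd) set"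
  assumes e: "inj e" and fb: "frame_bound CARD('m) b" and b: "1 \<le> b" and \<rho>: "0 \<le> \<rho>"
    and K: "\<And>t S y. S \<in> products_of_length N t \<Longrightarrow> norm (S *v y) \<le> K * \<rho> ^ t * norm y"
  obtains P :: "'a ^ 'd ^ 'm" and K2 where "\<And>i j. P $ i $ e j = of_bool (i = j)" "0 \<le> K2"
    "\<And>t S x. S \<in> products_of_length ((\<lambda>A. P ** A ** inclusion e) ` N) t \<Longrightarrow>
      norm (S *v x) \<le> K2 * (b * \<rho>) ^ t * norm x"
proof (cases "\<rho> = 0")
  case True
  have N0: "A = 0" if "A \<in> N" for A
    unfolding matrix_eq using K[OF products_of_length_1[OF that]] True by simp
  define P where "P = (\<chi> i d. of_bool (e i = d) :: 'a ^ 'd ^ 'm)"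
  show ?thesis
  proof (rule that[of P 1])
    show "P $ i $ e j = of_bool (i = j)" for i j unfolding P_def by (simp add: inj_eq[OF e])
    fix t S and x :: "'a ^ 'm" assume "S \<in> products_of_length ((\<lambda>A. P ** A ** inclusion e) ` N) t"
    then show "norm (S *v x) \<le> 1 * (b * \<rho>) ^ t * norm x"
      using True by (cases t) (auto simp: products_of_length_Suc dest!: N0)
  qed simp
next
  case False
  with \<rho> have \<rho>: "\<rho> > 0" by simp
  define F where "F = {of_real (1 / \<rho> ^ t) *s (g v* S) | g S t. norm g \<le> 1 \<and> S \<in> products_of_length N t}"
  have F_ball: "f \<in> F" if "norm f \<le> 1" for f
    unfolding F_def using that by (intro CollectI exI[of _ f] exI[of _ "mat 1"] exI[of _ 0]) simp
  have F_dotp: "norm (dotp f y) \<le> \<bar>K\<bar> * norm y" if f: "f \<in> F" for f y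
  proof -
    obtain g S t where g: "f = of_real (1 / \<rho> ^ t) *s (g v* S)" "norm g \<le> 1" "S \<in> products_of_length N t"
      using f unfolding F_def by blast
    have "norm (dotp g (S *v y)) \<le> norm g * norm (S *v y)" by (rule norm_dotp_le)
    also have "\<dots> \<le> 1 * (K * \<rho> ^ t * norm y)"
      using g K by (intro mult_mono) auto
    finally have "norm (dotp g (S *v y)) \<le> K * norm y * \<rho> ^ t" by (simp add: mult_ac)
    then have "norm (dotp f y) \<le> K * norm y"
      unfolding g(1) dotp_scale_left dotp_vector_matrix
      using \<rho> by (simp add: norm_mult norm_divide norm_power pos_divide_le_eq)
    also have "\<dots> \<le> \<bar>K\<bar> * norm y" by (intro mult_right_mono) auto
    finally show ?thesis .
  qed
  have F_bdd: "norm f \<le> \<bar>K\<bar> * CARD('d)" if f: "f \<in> F" for f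
  proof -
    have "norm (f $ i) \<le> \<bar>K\<bar>" for i
      using F_dotp[OF f, of "axis i 1"] by (simp add: norm_axis_one)
    then have "(\<Sum>i\<in>UNIV. norm (f $ i)) \<le> \<bar>K\<bar> * CARD('d)"
      using sum_bounded_above[of UNIV "\<lambda>i. norm (f $ i)" "\<bar>K\<bar>"] by (simp add: mult.commute)
    with norm_le_sum_nth[of f] show ?thesis by simp
  qed
  have norm_smult: "norm (c *s g) = norm c * norm g" for c and g :: "'a ^ 'd"
    unfolding norm_vec_def by (simp add: norm_mult L2_set_right_distrib)
  have F_balanced: "c *s f \<in> F" if f: "f \<in> F" and c: "norm c \<le> 1" for f c
  proof -
    obtain g S t where g: "f = of_real (1 / \<rho> ^ t) *s (g v* S)" "norm g \<le> 1" "S \<in> products_of_length N t"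
      using f unfolding F_def by blast
    have "c *s f = of_real (1 / \<rho> ^ t) *s ((c *s g) v* S)"
      unfolding g(1) by (simp add: vec_eq_iff vector_matrix_mult_def sum_distrib_left mult_ac)
    moreover have "norm (c *s g) \<le> 1" using mult_mono[OF c g(2)] by (simp add: norm_smult)
    ultimately show ?thesis unfolding F_def using g(3) by blast
  qed
  obtain P :: "'a ^ 'd ^ 'm" where P: "\<And>i j. P $ i $ e j = of_bool (i = j)"
    "\<And>f y. f \<in> F \<Longrightarrow> y \<in> polar F \<Longrightarrow> norm (\<Sum>j\<in>UNIV. f $ e j * (P *v y) $ j) \<le> b"
    using exists_bounded_projection[OF e fb F_ball F_bdd F_balanced] by metis
  \<comment> \<open>The norm with unit ball \<open>polar F\<close>, through the inequality \<open>\<parallel>y\<parallel> \<le> s\<close>.\<close>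
  define gauge where "gauge s y \<longleftrightarrow> (\<forall>f\<in>F. norm (dotp f y) \<le> s)" for s y
  have polar_gauge: "of_real (1 / s) *s y \<in> polar F" if "gauge s y" "0 < s" for s y
    using that unfolding polar_def gauge_def
    by (auto simp: dotp_scale_right norm_mult norm_divide)
  have gauge_N: "gauge (\<rho> * s) (A *v y)" if "gauge s y" and A: "A \<in> N" for s y A
    unfolding gauge_def
  proof
    fix f assume "f \<in> F"
    then obtain g S t where g: "f = of_real (1 / \<rho> ^ t) *s (g v* S)" "norm g \<le> 1" "S \<in> products_of_length N t"
      unfolding F_def by blast
    define f' where "f' = of_real (1 / \<rho> ^ Suc t) *s (g v* (S ** A))"
    have "f' \<in> F" unfolding F_def f'_def using g(2) products_of_length_SucI'[OF A g(3)] by blast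
    then have "norm (dotp f' y) \<le> s" using that unfolding gauge_def by blast
    moreover have "dotp f (A *v y) = of_real \<rho> * dotp f' y"
      unfolding g(1) f'_def dotp_scale_left dotp_vector_matrix using \<rho>
      by (simp add: matrix_vector_mul_assoc)
    ultimately show "norm (dotp f (A *v y)) \<le> \<rho> * s"
      using \<rho> by (simp add: norm_mult)
  qed
  have gauge_P: "gauge (b * s) (inclusion e *v (P *v y))" if y: "gauge s y" "0 < s" for s y
    unfolding gauge_def dotp_inclusion[OF e]
  proof
    fix f assume "f \<in> F"
    have "norm (\<Sum>j\<in>UNIV. f $ e j * (P *v (of_real (1 / s) *s y)) $ j) \<le> b"
      by (rule P(2)[OF \<open>f \<in> F\<close> polar_gauge[OF y]])
    also have "(\<Sum>j\<in>UNIV. f $ e j * (P *v (of_real (1 / s) *s y)) $ j)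
        = of_real (1 / s) * (\<Sum>j\<in>UNIV. f $ e j * (P *v y) $ j)"
      by (simp add: vector_scalar_commute sum_distrib_left mult_ac)
    finally show "norm (\<Sum>j\<in>UNIV. f $ e j * (P *v y) $ j) \<le> b * s"
      using y(2) by (simp add: norm_mult norm_divide pos_divide_le_eq)
  qed
  have gauge_products: "gauge ((b * \<rho>) ^ t * s) (inclusion e *v (S *v x))"
    if "S \<in> products_of_length ((\<lambda>A. P ** A ** inclusion e) ` N) t"
      "gauge s (inclusion e *v x)" "0 < s" for S t s x
    using that(1)
  proof (induction t arbitrary: S)
    case 0
    then show ?case using that by simp
  next
    case (Suc t)
    then obtain A S' where A: "A \<in> N" "S = (P ** A ** inclusion e) ** S'"
        and S': "S' \<in> products_of_length ((\<lambda>A. P ** A ** inclusion e) ` N) t"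
      by (elim products_of_length_SucE) blast
    have "gauge (b * (\<rho> * ((b * \<rho>) ^ t * s))) (inclusion e *v (P *v (A *v (inclusion e *v (S' *v x)))))"
      using \<rho> b that(3) by (intro gauge_P gauge_N Suc.IH S' A) auto
    then show ?case unfolding A(2) by (simp add: matrix_vector_mul_assoc matrix_mul_assoc mult_ac)
  qed
  define K2 where "K2 = CARD('m) * (\<bar>K\<bar> + 1)"
  show ?thesis
  proof (rule that[of P K2])
    show "P $ i $ e j = of_bool (i = j)" for i j by (rule P(1))
    show "0 \<le> K2" unfolding K2_def by simp
    fix t S and x :: "'a ^ 'm"
    assume S: "S \<in> products_of_length ((\<lambda>A. P ** A ** inclusion e) ` N) t"
    show "norm (S *v x) \<le> K2 * (b * \<rho>) ^ t * norm x"
    proof (cases "x = 0")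
      case False
      define s where "s = (\<bar>K\<bar> + 1) * norm x"
      have s: "s > 0" unfolding s_def using False by (simp add: add_nonneg_pos)
      have "\<bar>K\<bar> * norm x \<le> s" unfolding s_def by (intro mult_right_mono) auto
      then have "gauge s (inclusion e *v x)"
        unfolding gauge_def using F_dotp[of _ "inclusion e *v x"]
        by (auto simp: norm_inclusion[OF e] intro: order_trans)
      from gauge_products[OF S this s]
      have g: "norm (dotp f (inclusion e *v (S *v x))) \<le> (b * \<rho>) ^ t * s" if "f \<in> F" for f
        using that unfolding gauge_def by blast
      have "norm ((S *v x) $ j) \<le> (b * \<rho>) ^ t * s" for j
      proof -
        have "axis (e j) 1 \<in> F"
          by (rule F_ball) (simp add: norm_axis_one)
        from g[OF this] show ?thesis
          by (simp add: dotp_commute[of "axis _ _"] inclusion_nth[OF e])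
      qed
      then have "(\<Sum>j\<in>UNIV. norm ((S *v x) $ j)) \<le> CARD('m) * ((b * \<rho>) ^ t * s)"
        using sum_bounded_above[of UNIV "\<lambda>j. norm ((S *v x) $ j)"] by simp
      with norm_le_sum_nth[of "S *v x"] show ?thesis
        unfolding K2_def s_def by (simp add: mult_ac)
    qed simp
  qed
qed

end

section \<open>Principal submatrices of similar matrices\<close>

lemma matrix_mult_distribs:
  fixes X Y :: "'a::ring_1 ^ 'n ^ 'k" and Z W :: "'a ^ 'l ^ 'n"
  shows "(X + Y) ** Z = X ** Z + Y ** Z" "(X - Y) ** Z = X ** Z - Y ** Z"
    "X ** (Z + W) = X ** Z + X ** W" "X ** (Z - W) = X ** Z - X ** W"
  by (simp_all add: vec_eq_iff matrix_matrix_mult_def algebra_simps sum.distrib sum_subtractf)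

lemma bounded_matrix_sandwich:
  fixes X :: "'a::{real_normed_field,euclidean_space} ^ 'n ^ 'k" and Y :: "'a ^ 'l ^ 'p"
    and M :: "('a ^ 'p ^ 'n) set"
  assumes "bounded M"
  shows "bounded ((\<lambda>A. X ** A ** Y) ` M)"
proof (rule bounded_linear_image[OF assms])
  have "linear (\<lambda>A. X ** A ** Y)"
  proof (rule linearI)
    show "X ** (A + B) ** Y = X ** A ** Y + X ** B ** Y" for A B
      by (simp add: matrix_mult_distribs)
    show "X ** (r *\<^sub>R A) ** Y = r *\<^sub>R (X ** A ** Y)" for r A
      by (simp add: vec_eq_iff matrix_matrix_mult_def scaleR_sum_right sum_distrib_right)
  qed
  then show "bounded_linear (\<lambda>A. X ** A ** Y)" by (simp add: linear_conv_bounded_linear)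
qed

lemma matrix_inv_eq:
  fixes A B :: "'a::semiring_1 ^ 'n ^ 'n"
  assumes "A ** B = mat 1" "B ** A = mat 1"
  shows "matrix_inv A = B"
proof -
  have "A ** matrix_inv A = mat 1 \<and> matrix_inv A ** A = mat 1"
    unfolding matrix_inv_def by (rule someI[of _ B]) (use assms in simp)
  then have "matrix_inv A = (B ** A) ** matrix_inv A" using assms by simp
  also have "\<dots> = B ** (A ** matrix_inv A)" by (simp add: matrix_mul_assoc)
  also have "\<dots> = B" using \<open>A ** matrix_inv A = mat 1 \<and> _\<close> by simp
  finally show ?thesis .
qed

text \<open>
  With \<open>\<iota>\<close> the inclusion of the coordinate subspace and \<open>\<pi>\<close> the coordinate projection, the matrix
  \<open>Q = \<iota> (P - \<pi>)\<close> satisfies \<open>Q \<iota> = 0\<close> and \<open>Q\<^sup>2 = 0\<close>. Hence \<open>1 - Q\<close> has the inverse \<open>1 + Q\<close>; it fixes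
  the subspace, and \<open>\<pi> (1 + Q) = P\<close>.
\<close>

lemma compression_as_principal_submatrix:
  fixes P :: "'a::field ^ 'd::finite ^ 'm::finite" and R :: "'a ^ 'd ^ 'd"
  assumes e: "inj e" and P: "\<And>i j. P $ i $ e j = of_bool (i = j)" and R: "R ** Ri = mat 1" "Ri ** R = mat 1"
  obtains T where "invertible T"
    "\<And>A. principal_submatrix e (matrix_inv T ** A ** T) = P ** (Ri ** A ** R) ** inclusion e"
proof -
  define \<iota> where "\<iota> = (inclusion e :: 'a ^ 'm ^ 'd)"
  define \<pi> where "\<pi> = (\<chi> j i. of_bool (i = e j) :: 'a ^ 'd ^ 'm)"
  have \<pi>\<iota>: "\<pi> ** \<iota> = mat 1"
    by (simp add: \<pi>_def \<iota>_def inclusion_def vec_eq_iff matrix_matrix_mult_def mat_def inj_eq[OF e] of_bool_def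
        if_distrib[of "\<lambda>x. x * _"] cong: if_cong)
  have P\<iota>: "P ** \<iota> = mat 1"
    by (simp add: \<iota>_def inclusion_def vec_eq_iff matrix_matrix_mult_def mat_def P of_bool_def
        if_distrib[of "\<lambda>x. _ * x"] cong: if_cong)
  have sub: "principal_submatrix e X = \<pi> ** X ** \<iota>" for X :: "'a ^ 'd ^ 'd"
    by (simp add: principal_submatrix_def \<pi>_def \<iota>_def inclusion_def vec_eq_iff matrix_matrix_mult_def of_bool_def
        if_distrib[of "\<lambda>x. x * _"] if_distrib[of "\<lambda>x. _ * x"] cong: if_cong)
  define Q where "Q = \<iota> ** (P - \<pi>)"
  have Q\<iota>: "Q ** \<iota> = 0"
    unfolding Q_def by (simp add: matrix_mul_assoc[symmetric] matrix_mult_distribs P\<iota> \<pi>\<iota>)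
  then have QQ: "Q ** Q = 0"
    by (subst (2) Q_def) (simp add: matrix_mul_assoc)
  define T1 where "T1 = mat 1 - Q"
  define T1i where "T1i = mat 1 + Q"
  have T1: "T1 ** T1i = mat 1" "T1i ** T1 = mat 1"
    unfolding T1_def T1i_def
    by (simp_all add: matrix_mult_distribs QQ)
  have \<pi>T: "\<pi> ** T1i = P"
  proof -
    have "\<pi> ** T1i = \<pi> + (\<pi> ** \<iota>) ** (P - \<pi>)"
      unfolding T1i_def Q_def by (simp add: matrix_mult_distribs matrix_mul_assoc)
    then show ?thesis by (simp add: \<pi>\<iota>)
  qed
  have T\<iota>: "T1 ** \<iota> = \<iota>"
  proof -
    have "T1 ** \<iota> = \<iota> - Q ** \<iota>"
      unfolding T1_def by (simp add: matrix_mult_distribs)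
    then show ?thesis by (simp add: Q\<iota>)
  qed
  define T where "T = R ** T1"
  have 1: "T ** (T1i ** Ri) = mat 1"
  proof -
    have "T ** (T1i ** Ri) = R ** (T1 ** T1i) ** Ri" unfolding T_def by (simp add: matrix_mul_assoc)
    then show ?thesis by (simp add: T1 R)
  qed
  have 2: "(T1i ** Ri) ** T = mat 1"
  proof -
    have "(T1i ** Ri) ** T = T1i ** (Ri ** R) ** T1" unfolding T_def by (simp add: matrix_mul_assoc)
    then show ?thesis by (simp add: T1 R)
  qed
  show ?thesis
  proof (rule that[of T])
    show "invertible T" unfolding invertible_def using 1 2 by blast
    fix A
    have "principal_submatrix e (matrix_inv T ** A ** T) = (\<pi> ** T1i) ** (Ri ** A ** R) ** (T1 ** \<iota>)"
      unfolding matrix_inv_eq[OF 1 2] sub by (simp add: T_def matrix_mul_assoc)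
    then show "principal_submatrix e (matrix_inv T ** A ** T) = P ** (Ri ** A ** R) ** inclusion e"
      unfolding \<pi>T T\<iota> unfolding \<iota>_def .
  qed
qed

context conjugation
begin

text \<open>
  In coordinates, \<open>J1\<close>, \<open>range e\<close> and \<open>I\<close> are the index sets of \<open>V\<close>, \<open>X\<close> and \<open>W\<close>. The
  middle diagonal block, with index set \<open>D = I - J1\<close>, describes the action on \<open>W/V\<close>; padded with zeros
  it is a set with bounded products, and \<open>P\<close> is chosen for this set. The compressions of
  \<open>N\<close> act on \<open>V\<close> as \<open>N\<close> itself does and modulo \<open>V\<close> as the compressions of the middle blocks.
\<close>

lemma exists_compression:
  fixes e :: "'m::finite \<Rightarrow> 'd::finite" and N :: "('a ^ 'd ^ 'd) set"
  assumes e: "inj e" and fb: "frame_bound CARD('m) b" and b: "1 \<le> b" and \<rho>: "0 \<le> \<rho>"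
    and N: "N \<noteq> {}" "bounded N" and J: "J1 \<subseteq> range e" "range e \<subseteq> I"
    and inv1: "\<And>A x. A \<in> N \<Longrightarrow> supported_on J1 x \<Longrightarrow> supported_on J1 (A *v x)"
    and invI: "\<And>A x. A \<in> N \<Longrightarrow> supported_on I x \<Longrightarrow> supported_on I (A *v x)"
    and mid: "\<And>t S x. S \<in> products_of_length N t \<Longrightarrow> supported_on I x \<Longrightarrow>
        norm (cut (- J1) (S *v x)) \<le> K * \<rho> ^ t * norm x"
    and growth: "\<And>r. \<rho> < r \<Longrightarrow> \<exists>K>0. \<forall>t. \<forall>S\<in>products_of_length N t. \<forall>x. norm (S *v x) \<le> K * r ^ t * norm x"
  obtains P :: "'a ^ 'd ^ 'm" where "\<And>i j. P $ i $ e j = of_bool (i = j)"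
    "joint_spectral_radius ((\<lambda>A. P ** A ** inclusion e) ` N) \<le> b * \<rho>"
proof -
  define D where "D = I - J1"
  define block where "block A = (\<chi> i j. if i \<in> D \<and> j \<in> D then A $ i $ j else 0)" for A :: "'a ^ 'd ^ 'd"
  have block: "block A *v x = cut D (A *v cut D x)" for A x
    unfolding block_def
    by (auto simp: vec_eq_iff matrix_vector_mult_def intro!: sum.cong sum.neutral)
  have invI': "supported_on I (S *v x)" if "S \<in> products_of_length N t" "supported_on I x" for S t x
    using that
  proof (induction t arbitrary: S)
    case (Suc t)
    then show ?case
      by (auto simp: products_of_length_Suc invI simp flip: matrix_vector_mul_assoc)
  qed simp
  have cutD: "cut D x = cut (- J1) x" if "supported_on I x" for x :: "'a ^ 'd"
    using that by (auto simp: vec_eq_iff supported_on_def D_def)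
  have D_inv: "cut D (A *v cut D x) = cut D (A *v x)" if "A \<in> N" "supported_on I x" for A x
  proof -
    have "x = cut J1 x + cut D x" using cutD[OF that(2)] by (simp add: cut_split)
    then have "cut D (A *v x) = cut D (A *v cut J1 x) + cut D (A *v cut D x)"
      by (metis cut_add matrix_vector_right_distrib)
    also have "cut D (A *v cut J1 x) = 0"
      by (rule cut_eq_0[OF inv1[OF that(1) supported_on_cut]]) (auto simp: D_def)
    finally show ?thesis by simp
  qed
  \<comment> \<open>On \<open>D\<close> the products of the middle blocks are the middle blocks of the products.\<close>
  have block_products: "\<exists>R\<in>products_of_length N t. \<forall>x. supported_on D x \<longrightarrow> S *v x = cut D (R *v x)"
    if "S \<in> products_of_length (block ` N) t" for S t
    using that
  proof (induction t arbitrary: S)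
    case 0
    then show ?case by (simp add: cut_idem)
  next
    case (Suc t)
    then obtain A S' where A: "A \<in> N" "S = block A ** S'" and S': "S' \<in> products_of_length (block ` N) t"
      by (elim products_of_length_SucE) blast
    then obtain R where R: "R \<in> products_of_length N t" "\<And>x. supported_on D x \<Longrightarrow> S' *v x = cut D (R *v x)"
      using Suc.IH by blast
    have "S *v x = cut D (A ** R *v x)" if x: "supported_on D x" for x
    proof -
      have "supported_on I (R *v x)" by (rule invI'[OF R(1) supported_on_mono[OF x]]) (auto simp: D_def)
      then have "cut D (A *v cut D (R *v x)) = cut D (A *v (R *v x))" by (rule D_inv[OF A(1)])
      then show ?thesis
        unfolding A(2) using R(2)[OF x] cut_idem[OF supported_on_cut[of D "R *v x"]]
        by (simp add: block flip: matrix_vector_mul_assoc)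
    qed
    with products_of_length_SucI[OF A(1) R(1)] show ?case by blast
  qed
  have block_null: "S *v x = 0" if "S \<in> products_of_length (block ` N) (Suc t)" "cut D x = 0" for S t x
    using that
  proof (induction t arbitrary: S)
    case 0
    then show ?case by (auto simp: products_of_length_Suc block)
  next
    case (Suc t)
    then show ?case
      by (subst (asm) (2) products_of_length_Suc) (auto simp flip: matrix_vector_mul_assoc)
  qed
  have block_bound: "norm (S *v x) \<le> max K 1 * \<rho> ^ t * norm x"
    if S: "S \<in> products_of_length (block ` N) t" for S t x
  proof (cases t)
    case 0
    then show ?thesis using S mult_right_mono[of 1 "max K 1" "norm x"] by simp
  next
    case (Suc u)
    obtain R where R: "R \<in> products_of_length N t" "\<And>x. supported_on D x \<Longrightarrow> S *v x = cut D (R *v x)"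
      using block_products[OF S] by blast
    have "S *v x = S *v cut D x + S *v cut (- D) x"
      by (simp add: cut_split flip: matrix_vector_right_distrib)
    also have "S *v cut (- D) x = 0"
      by (rule block_null[of S u]) (use S Suc in \<open>auto simp: vec_eq_iff\<close>)
    also have "S *v cut D x = cut D (R *v cut D x)" by (rule R(2)[OF supported_on_cut])
    finally have Sx: "S *v x = cut D (R *v cut D x)" by simp
    have I: "supported_on I (cut D x)" by (rule supported_on_mono[OF supported_on_cut]) (auto simp: D_def)
    have "norm (S *v x) \<le> K * \<rho> ^ t * norm (cut D x)"
      unfolding Sx cutD[OF invI'[OF R(1) I]] by (rule mid[OF R(1) I])
    also have "\<dots> \<le> max K 1 * \<rho> ^ t * norm (cut D x)"
      using \<rho> by (intro mult_right_mono) auto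
    also have "\<dots> \<le> max K 1 * \<rho> ^ t * norm x"
      using \<rho> by (intro mult_left_mono norm_cut_le) auto
    finally show ?thesis .
  qed
  obtain P :: "'a ^ 'd ^ 'm" and K2 where P: "\<And>i j. P $ i $ e j = of_bool (i = j)" and K2: "0 \<le> K2"
    "\<And>t S x. S \<in> products_of_length ((\<lambda>A. P ** A ** inclusion e) ` block ` N) t \<Longrightarrow>
      norm (S *v x) \<le> K2 * (b * \<rho>) ^ t * norm x"
    using exists_projection_bounding_products[OF e fb b \<rho> block_bound] by metis
  define \<iota> where "\<iota> = (inclusion e :: 'a ^ 'm ^ 'd)"
  define C where "C = (\<lambda>A. P ** A ** \<iota>) ` N"
  define U where "U = {j. e j \<in> J1}"
  have \<iota>_U: "supported_on J1 (\<iota> *v x)" if "supported_on U x" for x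
    unfolding supported_on_def \<iota>_def
  proof (intro allI impI)
    fix i assume i: "i \<notin> J1"
    show "(inclusion e *v x) $ i = 0"
    proof (cases "i \<in> range e")
      case True
      then obtain j where "i = e j" by blast
      then show ?thesis using i that by (simp add: inclusion_nth[OF e] supported_on_def U_def)
    qed (rule inclusion_nth(2)[OF e])
  qed
  have P_eq: "(P *v y) $ j = y $ e j" if "supported_on (range e) y" for y j
  proof -
    have "(P *v y) $ j = (\<Sum>i\<in>range e. P $ j $ i * y $ i)"
      unfolding matrix_vector_mult_def vec_lambda_beta
      by (rule sum.mono_neutral_right) (use that in \<open>auto simp: supported_on_def\<close>)
    also have "\<dots> = (\<Sum>k\<in>UNIV. P $ j $ e k * y $ e k)"
      by (rule sum.reindex[OF e, unfolded comp_def])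
    also have "\<dots> = y $ e j" unfolding P by (simp add: of_bool_def if_distrib[of "\<lambda>x. x * _"] cong: if_cong)
    finally show ?thesis .
  qed
  have P_U: "supported_on U (P *v y)" if "supported_on J1 y" for y
    using that P_eq[OF supported_on_mono[OF that J(1)]] unfolding supported_on_def U_def by auto
  have \<iota>_P: "\<iota> *v (P *v y) = y" if y: "supported_on J1 y" for y
  proof -
    have "(\<iota> *v (P *v y)) $ i = y $ i" for i
    proof (cases "i \<in> range e")
      case True
      then show ?thesis unfolding \<iota>_def
        using P_eq[OF supported_on_mono[OF y J(1)]] by (auto simp: inclusion_nth[OF e])
    next
      case False
      then show ?thesis using J(1) y inclusion_nth(2)[OF e False, of "P *v y"]
        unfolding \<iota>_def supported_on_def by auto
    qed
    then show ?thesis by (simp add: vec_eq_iff)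
  qed
  have C_U: "supported_on U (X *v x)" if "X \<in> C" "supported_on U x" for X x
    using that P_U[OF inv1[OF _ \<iota>_U]] unfolding C_def by (auto simp flip: matrix_vector_mul_assoc)
  \<comment> \<open>The first diagonal block: on \<open>V\<close> the projection \<open>P\<close> acts as the identity, so the compressions
    multiply like the elements of \<open>N\<close>.\<close>
  have C_products_U: "\<exists>R\<in>products_of_length N t. \<forall>x. supported_on U x \<longrightarrow>
      supported_on J1 (R *v (\<iota> *v x)) \<and> \<iota> *v (S *v x) = R *v (\<iota> *v x)"
    if "S \<in> products_of_length C t" for S t
    using that
  proof (induction t arbitrary: S)
    case 0
    then show ?case by (simp add: \<iota>_U)
  next
    case (Suc t)
    then obtain A S' where A: "A \<in> N" "S = (P ** A ** \<iota>) ** S'" and S': "S' \<in> products_of_length C t"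
      unfolding C_def by (elim products_of_length_SucE) blast
    then obtain R where R: "R \<in> products_of_length N t" "\<And>x. supported_on U x \<Longrightarrow>
        supported_on J1 (R *v (\<iota> *v x)) \<and> \<iota> *v (S' *v x) = R *v (\<iota> *v x)"
      using Suc.IH by blast
    have "supported_on J1 (A ** R *v (\<iota> *v x)) \<and> \<iota> *v (S *v x) = A ** R *v (\<iota> *v x)"
      if x: "supported_on U x" for x
    proof -
      have s: "supported_on J1 (A *v (R *v (\<iota> *v x)))" using R(2)[OF x] inv1[OF A(1)] by blast
      moreover have "\<iota> *v (S *v x) = \<iota> *v (P *v (A *v (\<iota> *v (S' *v x))))"
        unfolding A(2) by (simp add: matrix_vector_mul_assoc matrix_mul_assoc)
      ultimately show ?thesis
        using R(2)[OF x] \<iota>_P[OF s] by (simp flip: matrix_vector_mul_assoc)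
    qed
    with products_of_length_SucI[OF A(1) R(1)] show ?case by blast
  qed
  have \<iota>_cut: "cut D (\<iota> *v x) = \<iota> *v cut (- U) x" for x
  proof -
    have "cut D (\<iota> *v x) $ i = (\<iota> *v cut (- U) x) $ i" for i
    proof (cases "i \<in> range e")
      case True
      then obtain j where "i = e j" by blast
      then show ?thesis using J(2) by (auto simp: \<iota>_def inclusion_nth[OF e] D_def U_def)
    next
      case False
      then show ?thesis by (simp add: \<iota>_def inclusion_nth[OF e])
    qed
    then show ?thesis by (simp add: vec_eq_iff)
  qed
  \<comment> \<open>The second diagonal block: \<open>W\<close> is invariant, so \<open>A\<close> maps \<open>X\<close> to \<open>W\<close>, and components in \<open>V\<close> are lost
    modulo \<open>V\<close>. Only the middle block of \<open>A\<close> remains.\<close>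
  have compress_block: "cut (- U) (P ** A ** \<iota> *v x) = cut (- U) (P ** block A ** \<iota> *v x)"
    if A: "A \<in> N" for A x
  proof -
    let ?y = "\<iota> *v x" and ?z = "\<iota> *v cut (- U) x"
    have yz: "?y = \<iota> *v cut U x + ?z"
      by (simp add: cut_split flip: matrix_vector_right_distrib)
    have I: "supported_on I ?z"
      unfolding \<iota>_cut[symmetric] by (rule supported_on_mono[OF supported_on_cut]) (auto simp: D_def)
    have "A *v ?z = cut J1 (A *v ?z) + cut D (A *v ?z)"
      unfolding cutD[OF invI[OF A I]] by (simp add: cut_split)
    then have "A *v ?y = (A *v (\<iota> *v cut U x) + cut J1 (A *v ?z)) + cut D (A *v ?z)"
      by (subst yz) (simp add: matrix_vector_right_distrib add.assoc)
    then have "P *v (A *v ?y) = (P *v (A *v (\<iota> *v cut U x)) + P *v cut J1 (A *v ?z)) + P *v cut D (A *v ?z)"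
      by (simp add: matrix_vector_right_distrib)
    moreover have "cut (- U) (P *v (A *v (\<iota> *v cut U x))) = 0"
      by (rule cut_eq_0[OF P_U[OF inv1[OF A \<iota>_U[OF supported_on_cut]]]]) auto
    moreover have "cut (- U) (P *v cut J1 (A *v ?z)) = 0"
      by (rule cut_eq_0[OF P_U[OF supported_on_cut]]) auto
    moreover have "P ** block A ** \<iota> *v x = P *v cut D (A *v ?z)"
      by (simp add: block \<iota>_cut flip: matrix_vector_mul_assoc)
    ultimately show ?thesis
      by (simp add: cut_add flip: matrix_vector_mul_assoc)
  qed
  have C_products_quotient: "\<exists>R\<in>products_of_length ((\<lambda>A. P ** A ** \<iota>) ` block ` N) t.
      \<forall>x. cut (- U) (S *v x) = cut (- U) (R *v x)"
    if "S \<in> products_of_length C t" for S t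
    using that
  proof (induction t arbitrary: S)
    case 0
    then show ?case by simp
  next
    case (Suc t)
    then obtain A S' where A: "A \<in> N" "S = (P ** A ** \<iota>) ** S'" and S': "S' \<in> products_of_length C t"
      unfolding C_def by (elim products_of_length_SucE) blast
    then obtain R where R: "R \<in> products_of_length ((\<lambda>A. P ** A ** \<iota>) ` block ` N) t"
        "\<And>x. cut (- U) (S' *v x) = cut (- U) (R *v x)"
      using Suc.IH by blast
    have "cut (- U) (S *v x) = cut (- U) ((P ** block A ** \<iota>) ** R *v x)" for x
    proof -
      have "cut (- U) (S *v x) = cut (- U) (P ** A ** \<iota> *v (S' *v x))"
        unfolding A(2) by (simp add: matrix_vector_mul_assoc)
      also have "\<dots> = cut (- U) (P ** block A ** \<iota> *v (S' *v x))" by (rule compress_block[OF A(1)])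
      also have "P ** block A ** \<iota> *v (S' *v x) = P *v cut D (A *v (\<iota> *v cut (- U) (S' *v x)))"
        by (simp add: block \<iota>_cut flip: matrix_vector_mul_assoc)
      also have "\<dots> = P ** block A ** \<iota> *v (R *v x)"
        unfolding R(2) by (simp add: block \<iota>_cut flip: matrix_vector_mul_assoc)
      finally show ?thesis by (simp add: matrix_vector_mul_assoc)
    qed
    moreover have "(P ** block A ** \<iota>) ** R \<in> products_of_length ((\<lambda>A. P ** A ** \<iota>) ` block ` N) (Suc t)"
      using A(1) R(1) by (intro products_of_length_SucI) auto
    ultimately show ?case by blast
  qed
  have C: "C \<noteq> {}" "bounded C"
    unfolding C_def using N bounded_matrix_sandwich by auto
  have "joint_spectral_radius C \<le> r" if r: "b * \<rho> < r" for r
  proof -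
    have "1 * \<rho> \<le> b * \<rho>" using b \<rho> by (intro mult_right_mono)
    with r \<rho> have \<rho>r: "\<rho> < r" "0 < r" by auto
    obtain K1 where K1: "K1 > 0" "\<And>t S x. S \<in> products_of_length N t \<Longrightarrow> norm (S *v x) \<le> K1 * r ^ t * norm x"
      using growth[OF \<rho>r(1)] by blast
    obtain K where "\<And>t S x. S \<in> products_of_length C t \<Longrightarrow> norm (S *v x) \<le> K * (real t + 1) * r ^ t * norm x"
    proof (rule block_triangular_growth[where M = C and U = U and ?K1.0 = K1 and ?K2.0 = K2 and r = r and c = "norm P * (K1 * r)"])
      show "supported_on U (X *v x)" if "X \<in> C" "supported_on U x" for X x by (rule C_U[OF that])
      show "norm (S *v x) \<le> K1 * r ^ t * norm x" if S: "S \<in> products_of_length C t" and x: "supported_on U x" for t S x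
      proof -
        obtain R where "R \<in> products_of_length N t" "\<iota> *v (S *v x) = R *v (\<iota> *v x)"
          using C_products_U[OF S] x by blast
        then have "norm (\<iota> *v (S *v x)) \<le> K1 * r ^ t * norm (\<iota> *v x)" using K1(2) by simp
        then show ?thesis unfolding \<iota>_def norm_inclusion[OF e] .
      qed
      show "norm (cut (- U) (S *v x)) \<le> K2 * r ^ t * norm x" if S: "S \<in> products_of_length C t" for t S x
      proof -
        obtain R where R: "R \<in> products_of_length ((\<lambda>A. P ** A ** \<iota>) ` block ` N) t"
            "cut (- U) (S *v x) = cut (- U) (R *v x)"
          using C_products_quotient[OF S] by blast
        have "norm (cut (- U) (S *v x)) \<le> norm (R *v x)" unfolding R(2) by (rule norm_cut_le)
        also have "\<dots> \<le> K2 * (b * \<rho>) ^ t * norm x" by (rule K2(2)) (use R(1) \<iota>_def in simp)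
        also have "\<dots> \<le> K2 * r ^ t * norm x"
          using K2(1) r b \<rho> by (intro mult_right_mono mult_left_mono power_mono) auto
        finally show ?thesis .
      qed
      show "norm (X *v x) \<le> norm P * (K1 * r) * norm x" if X: "X \<in> C" for X x
      proof -
        obtain A where A: "A \<in> N" "X = P ** A ** \<iota>" using X unfolding C_def by blast
        have "norm (X *v x) \<le> norm P * norm (A *v (\<iota> *v x))"
          unfolding A(2) by (simp add: norm_matrix_vector_le flip: matrix_vector_mul_assoc)
        also have "\<dots> \<le> norm P * (K1 * r ^ 1 * norm (\<iota> *v x))"
          by (intro mult_left_mono K1(2) products_of_length_1 A(1)) simp
        finally show ?thesis unfolding \<iota>_def norm_inclusion[OF e] by (simp add: mult_ac)
      qed
    qed (use \<rho>r K1 K2 in auto)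
    with \<rho>r show ?thesis by (intro joint_spectral_radius_le[OF C]) auto
  qed
  then have "joint_spectral_radius C \<le> b * \<rho>" by (rule dense_ge)
  with P show ?thesis using that unfolding C_def \<iota>_def by blast
qed

text \<open>
  The choice of \<open>V\<close> and \<open>W\<close> and the change to coordinates adapted to them. If \<open>W\<close> had dimension less than
  \<open>CARD('m)\<close>, it would be no larger than \<open>V\<close> by maximality of \<open>V\<close>, although it contains a vector with bounded
  orbit outside \<open>V\<close>.
\<close>

theorem exists_principal_submatrix_bound:
  fixes e :: "'m::finite \<Rightarrow> 'd::finite" and M :: "('a ^ 'd ^ 'd) set"
  assumes e: "inj e" and fb: "frame_bound CARD('m) b" and b: "1 \<le> b"
    and M: "M \<noteq> {}" "bounded M"
  obtains T where "invertible T"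
    "joint_spectral_radius (principal_submatrix e ` similar_set T M) \<le> b * joint_spectral_radius M"
proof -
  define \<rho> where "\<rho> = joint_spectral_radius M"
  have \<rho>: "0 \<le> \<rho>" unfolding \<rho>_def by (rule joint_spectral_radius_nonneg[OF M])
  define invariant where "invariant V \<longleftrightarrow> vec.subspace V \<and> (\<forall>A\<in>M. \<forall>x\<in>V. A *v x \<in> V)" for V
  have "\<exists>n. (\<exists>V. invariant V \<and> vec.dim V = n \<and> n < CARD('m)) \<and>
      (\<forall>k. (\<exists>V. invariant V \<and> vec.dim V = k \<and> k < CARD('m)) \<longrightarrow> k \<le> n)"
  proof (rule ex_has_greatest_nat[of _ 0 "\<lambda>n. n" "CARD('m)"])
    have "invariant {0}" unfolding invariant_def by auto
    then show "\<exists>V. invariant V \<and> vec.dim V = 0 \<and> 0 < CARD('m)" by (intro exI[of _ "{0}"]) auto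
  qed auto
  then obtain V where V: "invariant V" "vec.dim V < CARD('m)"
    and max: "\<And>V'. invariant V' \<Longrightarrow> vec.dim V' < CARD('m) \<Longrightarrow> vec.dim V' \<le> vec.dim V"
    by blast
  have subV: "vec.subspace V" and MV: "\<And>A x. A \<in> M \<Longrightarrow> x \<in> V \<Longrightarrow> A *v x \<in> V"
    using V(1) unfolding invariant_def by auto
  obtain Q where Q: "\<And>x. x \<in> V \<longleftrightarrow> Q *v x = 0" "\<And>x. x - Q *v x \<in> V" "Q ** Q = Q"
    using exists_projection_killing_subspace[OF subV] by blast
  have QAQ: "Q ** A ** Q = Q ** A" if "A \<in> M" for A
    unfolding matrix_eq
  proof
    fix x
    have "Q *v (A *v (x - Q *v x)) = 0" using MV[OF that Q(2)] Q(1) by blast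
    then show "Q ** A ** Q *v x = Q ** A *v x"
      by (simp add: matrix_vector_mult_diff_distrib matrix_vector_mul_assoc matrix_mul_assoc)
  qed
  have card_J: "card (range e) = CARD('m)" using e by (simp add: card_image)
  have md: "CARD('m) \<le> CARD('d)" using card_J card_mono[of UNIV "range e"] by simp
  have "V \<noteq> UNIV" using V(2) md by (auto simp: card_cart_basis)
  then have "Q \<noteq> 0" using Q(1) by fastforce
  obtain x0 where x0: "x0 \<noteq> 0" "Q *v x0 = x0"
    "\<And>t S. S \<in> products_of_length M t \<Longrightarrow> norm (Q *v (S *v x0)) \<le> \<rho> ^ t * norm x0"
    unfolding \<rho>_def using exists_bounded_orbit[OF M QAQ Q(3) \<open>Q \<noteq> 0\<close>] by metis
  define W where "W = {x. \<exists>K. \<forall>t. \<forall>S\<in>products_of_length M t. norm (Q *v (S *v x)) \<le> K * \<rho> ^ t}"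
  have SV: "S *v x \<in> V" if "S \<in> products_of_length M t" "x \<in> V" for S t x
    using that
  proof (induction t arbitrary: S)
    case (Suc t)
    then show ?case by (auto simp: products_of_length_Suc MV simp flip: matrix_vector_mul_assoc)
  qed simp
  have VW: "V \<subseteq> W"
  proof
    fix x assume "x \<in> V"
    then have "\<forall>t. \<forall>S\<in>products_of_length M t. norm (Q *v (S *v x)) \<le> 0 * \<rho> ^ t"
      using SV Q(1) by auto
    then show "x \<in> W" unfolding W_def by blast
  qed
  have subW: "vec.subspace W"
  proof (rule vec.subspaceI)
    show "0 \<in> W" using VW subV vec.subspace_0 by blast
  next
    fix x y assume "x \<in> W" "y \<in> W"
    then obtain K K' where K: "\<forall>t. \<forall>S\<in>products_of_length M t. norm (Q *v (S *v x)) \<le> K * \<rho> ^ t"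
      "\<forall>t. \<forall>S\<in>products_of_length M t. norm (Q *v (S *v y)) \<le> K' * \<rho> ^ t"
      unfolding W_def by blast
    have "norm (Q *v (S *v (x + y))) \<le> (K + K') * \<rho> ^ t" if "S \<in> products_of_length M t" for S t
    proof -
      have "norm (Q *v (S *v (x + y))) \<le> norm (Q *v (S *v x)) + norm (Q *v (S *v y))"
        by (simp add: matrix_vector_right_distrib norm_triangle_ineq)
      also have "\<dots> \<le> K * \<rho> ^ t + K' * \<rho> ^ t" using K that by (intro add_mono) auto
      finally show ?thesis by (simp add: distrib_right)
    qed
    then show "x + y \<in> W" unfolding W_def by blast
  next
    fix c x assume "x \<in> W"
    then obtain K where K: "\<forall>t. \<forall>S\<in>products_of_length M t. norm (Q *v (S *v x)) \<le> K * \<rho> ^ t"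
      unfolding W_def by blast
    have norm_smult: "norm (c *s y) = norm c * norm y" for y :: "'a ^ 'd"
      unfolding norm_vec_def by (simp add: norm_mult L2_set_right_distrib)
    have "norm (Q *v (S *v (c *s x))) \<le> (norm c * K) * \<rho> ^ t" if "S \<in> products_of_length M t" for S t
    proof -
      have "norm (Q *v (S *v (c *s x))) = norm c * norm (Q *v (S *v x))"
        by (simp add: vector_scalar_commute norm_smult)
      also have "\<dots> \<le> norm c * (K * \<rho> ^ t)" using K that by (intro mult_left_mono) auto
      finally show ?thesis by (simp add: mult.assoc)
    qed
    then show "c *s x \<in> W" unfolding W_def by blast
  qed
  have MW: "A *v x \<in> W" if "A \<in> M" and x: "x \<in> W" for A x
  proof -
    obtain K where K: "\<forall>t. \<forall>S\<in>products_of_length M t. norm (Q *v (S *v x)) \<le> K * \<rho> ^ t"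
      using x unfolding W_def by blast
    have "norm (Q *v (S *v (A *v x))) \<le> (K * \<rho>) * \<rho> ^ t" if "S \<in> products_of_length M t" for S t
      using K[rule_format, OF products_of_length_SucI'[OF \<open>A \<in> M\<close> that]]
      by (simp add: matrix_vector_mul_assoc mult_ac)
    then show ?thesis unfolding W_def by blast
  qed
  have "x0 \<in> W" unfolding W_def using x0(3) by (intro CollectI exI[of _ "norm x0"]) (auto simp: mult.commute)
  have dimW: "CARD('m) \<le> vec.dim W"
  proof (rule ccontr)
    assume *: "\<not> CARD('m) \<le> vec.dim W"
    have "invariant W" unfolding invariant_def using subW MW by blast
    then have "vec.dim W \<le> vec.dim V" using * by (intro max) auto
    then have "V = W" by (rule vec.subspace_dim_equal[OF subV subW VW])
    then show False using \<open>x0 \<in> W\<close> x0 Q(1) by auto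
  qed
  obtain R :: "'a ^ 'd ^ 'd" and J1 I where R: "invertible R" "J1 \<subseteq> range e" "range e \<subseteq> I"
    "V = (*v) R ` {x. supported_on J1 x}" "W = (*v) R ` {x. supported_on I x}"
  proof (rule exists_adapted_basis[OF subV subW VW, of "range e"])
    show "vec.dim V \<le> card (range e)" "card (range e) \<le> vec.dim W"
      using V(2) dimW card_J by auto
  qed
  obtain Ri where Ri: "R ** Ri = mat 1" "Ri ** R = mat 1" using R(1) unfolding invertible_def by blast
  have RiR: "Ri *v (R *v x) = x" "R *v (Ri *v x) = x" for x
    using Ri by (simp_all add: matrix_vector_mul_assoc)
  define N where "N = (\<lambda>A. Ri ** A ** R) ` M"
  have in_V: "supported_on J1 (Ri *v y)" if "y \<in> V" for y using that R(4) RiR by auto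
  have in_W: "supported_on I (Ri *v y)" if "y \<in> W" for y using that R(5) RiR by auto
  have N_products: "\<exists>S'\<in>products_of_length M t. S = Ri ** S' ** R" if "S \<in> products_of_length N t" for S t
    using that
  proof (induction t arbitrary: S)
    case 0
    then show ?case using Ri by simp
  next
    case (Suc t)
    then obtain A S1 where A: "A \<in> M" "S = (Ri ** A ** R) ** S1" and S1: "S1 \<in> products_of_length N t"
      unfolding N_def by (elim products_of_length_SucE) blast
    then obtain S' where S': "S' \<in> products_of_length M t" "S1 = Ri ** S' ** R" using Suc.IH by blast
    have "S = Ri ** A ** (R ** Ri) ** S' ** R" unfolding A(2) S'(2) by (simp add: matrix_mul_assoc)
    also have "\<dots> = Ri ** (A ** S') ** R" by (simp add: Ri matrix_mul_assoc)
    finally show ?case using products_of_length_SucI[OF A(1) S'(1)] by blast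
  qed
  have unif: "\<exists>K. \<forall>t. \<forall>S\<in>products_of_length M t. norm (Q *v (S *v (R *v axis j 1))) \<le> K * \<rho> ^ t" if "j \<in> I" for j
  proof -
    have "supported_on I (axis j 1 :: 'a ^ 'd)" using that by (auto simp: supported_on_def axis_def)
    then have "R *v axis j 1 \<in> W" using R(5) by blast
    then show ?thesis unfolding W_def by blast
  qed
  then obtain Kj where Kj: "\<And>j t S. j \<in> I \<Longrightarrow> S \<in> products_of_length M t \<Longrightarrow>
      norm (Q *v (S *v (R *v axis j 1))) \<le> Kj j * \<rho> ^ t"
    by metis
  \<comment> \<open>The orbit bound of each vector of \<open>W\<close> has its own constant; a bound on the basis vectors makes it
    uniform.\<close>
  define K where "K = norm Ri * (\<Sum>j\<in>I. \<bar>Kj j\<bar>)"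
  have mid: "norm (cut (- J1) (S *v x)) \<le> K * \<rho> ^ t * norm x"
    if S: "S \<in> products_of_length N t" and x: "supported_on I x" for S t x
  proof -
    obtain S' where S': "S' \<in> products_of_length M t" "S = Ri ** S' ** R" using N_products[OF S] by blast
    define X where "X = Q ** S' ** R"
    have Sx: "S *v x = Ri *v (S' *v (R *v x) - X *v x) + Ri *v (X *v x)"
      unfolding S'(2) by (simp add: matrix_vector_mul_assoc matrix_mul_assoc matrix_vector_mult_diff_distrib)
    have "S' *v (R *v x) - X *v x \<in> V"
      using Q(2)[of "S' *v (R *v x)"] unfolding X_def by (simp add: matrix_vector_mul_assoc matrix_mul_assoc)
    then have "cut (- J1) (Ri *v (S' *v (R *v x) - X *v x)) = 0"
      by (intro cut_eq_0[OF in_V]) auto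
    then have "norm (cut (- J1) (S *v x)) = norm (cut (- J1) (Ri *v (X *v x)))"
      unfolding Sx cut_add by simp
    also have "\<dots> \<le> norm Ri * norm (X *v x)"
      by (rule order.trans[OF norm_cut_le norm_matrix_vector_le])
    also have "norm (X *v x) \<le> (\<Sum>j\<in>I. \<bar>Kj j\<bar>) * \<rho> ^ t * norm x"
    proof -
      have "X *v x = X *v (\<Sum>j\<in>UNIV. x $ j *s axis j 1)" by (simp only: basis_expansion)
      also have "\<dots> = (\<Sum>j\<in>UNIV. x $ j *s (X *v axis j 1))"
        by (simp add: vec.sum vector_scalar_commute)
      also have "\<dots> = (\<Sum>j\<in>I. x $ j *s (X *v axis j 1))"
        by (rule sum.mono_neutral_right) (use x in \<open>auto simp: supported_on_def\<close>)
      finally have "norm (X *v x) \<le> (\<Sum>j\<in>I. norm (x $ j *s (X *v axis j 1)))"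
        by (simp only: norm_sum)
      also have "\<dots> \<le> (\<Sum>j\<in>I. norm x * (\<bar>Kj j\<bar> * \<rho> ^ t))"
      proof (rule sum_mono)
        fix j assume j: "j \<in> I"
        have "norm (x $ j *s (X *v axis j 1)) = norm (x $ j) * norm (X *v axis j 1)"
          unfolding norm_vec_def by (simp add: norm_mult L2_set_right_distrib)
        also have "\<dots> \<le> norm x * (\<bar>Kj j\<bar> * \<rho> ^ t)"
        proof (rule mult_mono)
          show "norm (x $ j) \<le> norm x" by (rule Finite_Cartesian_Product.norm_nth_le)
          have "norm (X *v axis j 1) \<le> Kj j * \<rho> ^ t"
            using Kj[OF j S'(1)] unfolding X_def by (simp add: matrix_vector_mul_assoc matrix_mul_assoc)
          also have "\<dots> \<le> \<bar>Kj j\<bar> * \<rho> ^ t" using \<rho> by (intro mult_right_mono) auto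
          finally show "norm (X *v axis j 1) \<le> \<bar>Kj j\<bar> * \<rho> ^ t" .
        qed auto
        finally show "norm (x $ j *s (X *v axis j 1)) \<le> norm x * (\<bar>Kj j\<bar> * \<rho> ^ t)" .
      qed
      also have "\<dots> = (\<Sum>j\<in>I. \<bar>Kj j\<bar>) * \<rho> ^ t * norm x"
        by (simp add: sum_distrib_left sum_distrib_right mult_ac)
      finally show ?thesis .
    qed
    finally show ?thesis unfolding K_def by (simp add: mult_left_mono mult.assoc)
  qed
  have growth: "\<exists>K>0. \<forall>t. \<forall>S\<in>products_of_length N t. \<forall>x. norm (S *v x) \<le> K * r ^ t * norm x"
    if r: "\<rho> < r" for r
  proof -
    obtain K0 where K0: "K0 > 0" "\<And>t S x. S \<in> products_of_length M t \<Longrightarrow> norm (S *v x) \<le> K0 * r ^ t * norm x"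
      using product_bound[OF M] r unfolding \<rho>_def by metis
    define K' where "K' = norm Ri * K0 * norm R + 1"
    have "norm (S *v x) \<le> K' * r ^ t * norm x" if S: "S \<in> products_of_length N t" for S t x
    proof -
      obtain S' where S': "S' \<in> products_of_length M t" "S = Ri ** S' ** R" using N_products[OF S] by blast
      have "norm (S *v x) \<le> norm Ri * norm (S' *v (R *v x))"
        unfolding S'(2) by (simp add: norm_matrix_vector_le flip: matrix_vector_mul_assoc)
      also have "\<dots> \<le> norm Ri * (K0 * r ^ t * (norm R * norm x))"
      proof (rule mult_left_mono)
        have "norm (S' *v (R *v x)) \<le> K0 * r ^ t * norm (R *v x)" by (rule K0(2)[OF S'(1)])
        also have "\<dots> \<le> K0 * r ^ t * (norm R * norm x)"
          using K0(1) r \<rho> by (intro mult_left_mono norm_matrix_vector_le) auto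
        finally show "norm (S' *v (R *v x)) \<le> K0 * r ^ t * (norm R * norm x)" .
      qed simp
      also have "\<dots> = (norm Ri * K0 * norm R) * (r ^ t * norm x)" by (simp add: mult_ac)
      also have "\<dots> \<le> K' * (r ^ t * norm x)"
        unfolding K'_def using r \<rho> by (intro mult_right_mono) auto
      finally show ?thesis by (simp add: mult.assoc)
    qed
    moreover have "K' > 0" unfolding K'_def using K0(1) by (intro add_nonneg_pos) auto
    ultimately show ?thesis by blast
  qed
  have inv1: "supported_on J1 (A *v x)" if A: "A \<in> N" and x: "supported_on J1 x" for A x
  proof -
    obtain A' where A': "A' \<in> M" "A = Ri ** A' ** R" using A unfolding N_def by blast
    have "R *v x \<in> V" using R(4) x by blast
    then show ?thesis
      using in_V[OF MV[OF A'(1)]] unfolding A'(2) by (simp flip: matrix_vector_mul_assoc)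
  qed
  have invI: "supported_on I (A *v x)" if A: "A \<in> N" and x: "supported_on I x" for A x
  proof -
    obtain A' where A': "A' \<in> M" "A = Ri ** A' ** R" using A unfolding N_def by blast
    have "R *v x \<in> W" using R(5) x by blast
    then show ?thesis
      using in_W[OF MW[OF A'(1)]] unfolding A'(2) by (simp flip: matrix_vector_mul_assoc)
  qed
  have N: "N \<noteq> {}" "bounded N" unfolding N_def using M bounded_matrix_sandwich by auto
  obtain P :: "'a ^ 'd ^ 'm" where P: "\<And>i j. P $ i $ e j = of_bool (i = j)"
    "joint_spectral_radius ((\<lambda>A. P ** A ** inclusion e) ` N) \<le> b * \<rho>"
  proof (rule exists_compression[OF e fb b \<rho> N R(2,3)])
    show "supported_on J1 (A *v x)" if "A \<in> N" "supported_on J1 x" for A x by (rule inv1[OF that])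
    show "supported_on I (A *v x)" if "A \<in> N" "supported_on I x" for A x by (rule invI[OF that])
    show "norm (cut (- J1) (S *v x)) \<le> K * \<rho> ^ t * norm x"
      if "S \<in> products_of_length N t" "supported_on I x" for S t x by (rule mid[OF that])
    show "\<exists>K>0. \<forall>t. \<forall>S\<in>products_of_length N t. \<forall>x. norm (S *v x) \<le> K * r ^ t * norm x"
      if "\<rho> < r" for r by (rule growth[OF that])
  qed blast
  obtain T where T: "invertible T"
    "\<And>A. principal_submatrix e (matrix_inv T ** A ** T) = P ** (Ri ** A ** R) ** inclusion e"
    using compression_as_principal_submatrix[OF e P(1) Ri] by blast
  have "principal_submatrix e ` similar_set T M = (\<lambda>A. P ** A ** inclusion e) ` N"
    unfolding similar_set_def N_def image_image T(2) ..
  with T(1) P(2) show ?thesis using that unfolding \<rho>_def by simp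
qed

end

theorem theorem4p7:
  fixes J :: "'d::finite set" and e :: "'m::finite \<Rightarrow> 'd" and m :: nat
  assumes "card J = m" and "m \<ge> 1" and "bij_betw e UNIV J"
  shows
    "(\<forall>M :: (real ^ 'd ^ 'd) set. M \<noteq> {} \<and> compact M \<longrightarrow>
        (\<exists>T :: real ^ 'd ^ 'd. invertible T \<and>
           joint_spectral_radius (principal_submatrix e ` similar_set T M)
             \<le> delta_real m * joint_spectral_radius M \<and>
           delta_real m * joint_spectral_radius M \<le> sqrt (real m) * joint_spectral_radius M)) \<and>
     (\<forall>M :: (complex ^ 'd ^ 'd) set. M \<noteq> {} \<and> compact M \<longrightarrow>
        (\<exists>T :: complex ^ 'd ^ 'd. invertible T \<and>
           joint_spectral_radius (principal_submatrix e ` similar_set T M)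
             \<le> delta_complex m * joint_spectral_radius M \<and>
           delta_complex m * joint_spectral_radius M \<le> sqrt (real m) * joint_spectral_radius M))"
proof (intro conjI allI impI; elim conjE)
  have e: "inj e" using assms(3) by (rule bij_betw_imp_inj_on)
  have m: "CARD('m) = m" using bij_betw_same_card[OF assms(3)] assms(1) by simp
  {
    fix M :: "(real ^ 'd ^ 'd) set" assume "M \<noteq> {}" "compact M"
    then have M: "M \<noteq> {}" "bounded M" by (auto intro: compact_imp_bounded)
    obtain T where "invertible T" "joint_spectral_radius (principal_submatrix e ` similar_set T M)
        \<le> delta_real m * joint_spectral_radius M"
      using conjugation.exists_principal_submatrix_bound[OF conjugation_real e _ _ M]
        frame_bound_real[OF assms(2)] delta_real_ge_1[OF assms(2)] unfolding m by metis
    moreover have "delta_real m * joint_spectral_radius M \<le> sqrt (real m) * joint_spectral_radius M"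
      by (intro mult_right_mono delta_real_le_sqrt assms joint_spectral_radius_nonneg M)
    ultimately show "\<exists>T :: real ^ 'd ^ 'd. invertible T \<and>
           joint_spectral_radius (principal_submatrix e ` similar_set T M)
             \<le> delta_real m * joint_spectral_radius M \<and>
           delta_real m * joint_spectral_radius M \<le> sqrt (real m) * joint_spectral_radius M"
      by blast
  }
  {
    fix M :: "(complex ^ 'd ^ 'd) set" assume "M \<noteq> {}" "compact M"
    then have M: "M \<noteq> {}" "bounded M" by (auto intro: compact_imp_bounded)
    obtain T where "invertible T" "joint_spectral_radius (principal_submatrix e ` similar_set T M)
        \<le> delta_complex m * joint_spectral_radius M"
      using conjugation.exists_principal_submatrix_bound[OF conjugation_complex e _ _ M]
        frame_bound_complex[OF assms(2)] delta_complex_ge_1[OF assms(2)] unfolding m by metis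
    moreover have "delta_complex m * joint_spectral_radius M \<le> sqrt (real m) * joint_spectral_radius M"
      by (intro mult_right_mono delta_complex_le_sqrt assms joint_spectral_radius_nonneg M)
    ultimately show "\<exists>T :: complex ^ 'd ^ 'd. invertible T \<and>
           joint_spectral_radius (principal_submatrix e ` similar_set T M)
             \<le> delta_complex m * joint_spectral_radius M \<and>
           delta_complex m * joint_spectral_radius M \<le> sqrt (real m) * joint_spectral_radius M"
      by blast
  }
qed

end
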